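(* Let $\mathcal C$ be a symmetric monoidal category. The category $\mathbf{Symm\text{-}Mon}(\mathbf{Th}(\mathbf{K\text{-}Frob}),\mathcal C)$ of symmetric monoidal functors $\mathbf{Th}(\mathbf{K\text{-}Frob})\to\mathcal C$ and their monoidal natural transformations is equivalent as a symmetric monoidal category to the category $\mathbf{K\text{-}Frob}(\mathcal C)$ of knowledgeable Frobenius algebras in $\mathcal C$.
   Context: **Knowledgeable Frobenius algebras.** Let $(\mathcal C,\otimes,\mathbb 1,\alpha,\lambda,\rho,\tau)$ be a symmetric monoidal category. A Frobenius algebra object $(A,\mu,\eta,\Delta,\epsilon)$ in $\mathcal C$ is an (associative unital) algebra object $(A,\mu,\eta)$ and a (coassociative counital) coalgebra object $(A,\Delta,\epsilon)$ with $(\mathrm{id}_A\otimes\mu)\circ\alpha\circ(\Delta\otimes\mathrm{id}_A)=\Delta\circ\mu=(\mu\otimes\mathrm{id}_A)\circ\alpha^{-1}\circ(\mathrm{id}_A\otimes\Delta)$. It is symmetric if $\epsilon\circ\mu=\epsilon\circ\mu\circ\tau$, commutative if $\mu=\mu\circ\tau$. Homomorphisms of Frobenius algebras are morphisms that are both algebra and coalgebra homomorphisms. A knowledgeable Frobenius algebra $(A,C,\imath,\imath^* )$ in $\mathcal C$ consists of a symmetric Frobenius algebra $A$, a commutative Frobenius algebra $C$, and morphisms $\imath:C\to A$, $\imath^*:A\to C$ such that $\imath$ is a homomorphism of algebra objects and (knowledge) $\mu_A\circ(\imath\otimes\mathrm{id}_A)=\mu_A\circ\tau_{A,A}\circ(\imath\otimes\mathrm{id}_A)$;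 (duality) $\epsilon_C\circ\mu_C\circ(\mathrm{id}_C\otimes\imath^* )=\epsilon_A\circ\mu_A\circ(\imath\otimes\mathrm{id}_A)$; (Cardy) $\mu_A\circ\tau_{A,A}\circ\Delta_A=\imath\circ\imath^*$. A homomorphism $(A,C,\imath,\imath^* )\to(A',C',\imath',\imath'^* )$ is a pair $(\varphi_1,\varphi_2)$ of Frobenius algebra homomorphisms $\varphi_1:A\to A'$, $\varphi_2:C\to C'$ with $\imath'\varphi_2=\varphi_1\imath$ and $\imath'^*\varphi_1=\varphi_2\imath^*$. These form the category $\mathbf{K\text{-}Frob}(\mathcal C)$, which is symmetric monoidal with componentwise tensor product $(A\otimes A',C\otimes C',\imath\otimes\imath',\imath^*\otimes\imath'^* )$ (with the usual tensor product of Frobenius algebras), unit $(\mathbb 1,\mathbb 1,\mathrm{id},\mathrm{id})$, and constraints and braiding induced by those of $\mathcal C$. **The category $\mathbf{Th}(\mathbf{K\text{-}Frob})$.** Its objects are the formal words generated from symbols $\mathbb 1,A,C$ by a binary operation $(X\otimes Y)$. Take the graph on these objects with edges $\mu_A:A\otimes A\to A$, $\eta_A:\mathbb 1\to A$, $\Delta_A:A\to A\otimes A$, $\epsilon_A:A\to\mathbb 1$, $\mu_C:C\otimes C\to C$, $\eta_C:\mathbb 1\to C$, $\Delta_C:C\to C\otimes C$, $\epsilon_C:C\to\mathbb 1$, $\imath:C\to A$, $\imath^*:A\to C$; for all objects $X,Y,Z$, edges $\alpha_{X,Y,Z}:(X\otimes Y)\otimes Z\to X\otimes(Y\otimes Z)$,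 $\tau_{X,Y}:X\otimes Y\to Y\otimes X$, $\lambda_X:\mathbb 1\otimes X\to X$, $\rho_X:X\otimes\mathbb 1\to X$ and edges $\bar\alpha,\bar\tau,\bar\lambda,\bar\rho$ in the opposite directions; and, for every edge $f:X\to Y$ and object $Z$, edges $Z\otimes f:Z\otimes X\to Z\otimes Y$ and $f\otimes Z:X\otimes Z\to Y\otimes Z$. $\mathbf{Th}(\mathbf{K\text{-}Frob})$ is the free category on this graph modulo the category congruence generated by: the relations making $(A,C,\imath,\imath^* )$ a knowledgeable Frobenius algebra; the pentagon, triangle and symmetric braiding axioms for $\alpha,\lambda,\rho,\tau$; the relations making $\otimes$ a functor ($(X\otimes p)(X\otimes q)\sim X\otimes(pq)$, $(p\otimes X)(q\otimes X)\sim(pq)\otimes X$, $(t\otimes Y)(X\otimes s)\sim(X\otimes s)(t\otimes Y)$ whenever these composites make sense with the appropriate objects, $\mathrm{id}_{X\otimes Y}\sim X\otimes\mathrm{id}_Y\sim\mathrm{id}_X\otimes Y$); naturality of $\alpha,\lambda,\rho,\tau,\bar\alpha,\bar\lambda,\bar\rho,\bar\tau$; that each $e,\bar e$ are mutually inverse; and all relations obtained from these by tensoring finitely often on the left or right with objects. Thus $\mathbf{Th}(\mathbf{K\text{-}Frob})$ is the symmetric monoidal category freely generated by a knowledgeable Frobenius algebra $(A,C,\imath,\imath^* )$. **Functor categories and equivalence.** For a small symmetric monoidal category $\mathcal D$, $\mathbf{Symm\text{-}Mon}(\mathcal D,\mathcal C)$ is the category of (strong) symmetric monoidal functors $(\psi,\psi_2,\psi_0)$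 and monoidal natural transformations, with symmetric monoidal structure given by the pointwise tensor product. Two symmetric monoidal categories are equivalent as symmetric monoidal categories if there is an equivalence of categories given by functors $F,G$ and natural isomorphisms $\mathrm{id}\Rightarrow GF$, $FG\Rightarrow\mathrm{id}$ such that $F,G$ are (strong) symmetric monoidal functors and the natural isomorphisms are monoidal. *)

theory Defs
  imports Main "HOL-Library.FuncSet"
begin

section \<open>Categories and symmetric monoidal categories\<close>

text \<open>
  Object and arrow sets are explicit carriers. Operations are total HOL functions whose values
  outside the carriers, or on arrows that do not compose, are irrelevant.
\<close>

record ('o, 'a) category_data =
  obj :: "'o set"
  arr :: "'a set"
  src :: "'a \<Rightarrow> 'o"
  tgt :: "'a \<Rightarrow> 'o"
  idt :: "'o \<Rightarrow> 'a" ("\<i>\<d>\<index>")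
  cmp :: "'a \<Rightarrow> 'a \<Rightarrow> 'a" (infixr "\<cdot>\<index>" 55)

record ('o, 'a) sm_data = "('o, 'a) category_data" +
  tensor_obj :: "'o \<Rightarrow> 'o \<Rightarrow> 'o" (infixr "\<boxtimes>\<index>" 75)
  tensor_arr :: "'a \<Rightarrow> 'a \<Rightarrow> 'a" (infixr "\<otimes>\<index>" 70)
  unit_obj :: 'o ("\<one>\<index>")
  associator :: "'o \<Rightarrow> 'o \<Rightarrow> 'o \<Rightarrow> 'a" ("\<alpha>\<index>")
  left_unitor :: "'o \<Rightarrow> 'a" ("\<ll>\<index>")
  right_unitor :: "'o \<Rightarrow> 'a" ("\<rr>\<index>")
  braiding :: "'o \<Rightarrow> 'o \<Rightarrow> 'a" ("\<tau>\<index>")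

definition hom :: "('o, 'a, 'm) category_data_scheme \<Rightarrow> 'o \<Rightarrow> 'o \<Rightarrow> 'a set" where
  "hom C X Y = {f \<in> arr C. src C f = X \<and> tgt C f = Y}"

locale category =
  fixes C :: "('o, 'a, 'm) category_data_scheme" (structure)
  assumes src_obj: "f \<in> arr C \<Longrightarrow> src C f \<in> obj C"
    and tgt_obj: "f \<in> arr C \<Longrightarrow> tgt C f \<in> obj C"
    and id_hom: "X \<in> obj C \<Longrightarrow> \<i>\<d> X \<in> hom C X X"
    and cmp_hom: "\<lbrakk>f \<in> hom C X Y; g \<in> hom C Y Z\<rbrakk> \<Longrightarrow> g \<cdot> f \<in> hom C X Z"
    and id_left: "f \<in> hom C X Y \<Longrightarrow> \<i>\<d> Y \<cdot> f = f"
    and id_right: "f \<in> hom C X Y \<Longrightarrow> f \<cdot> \<i>\<d> X = f"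
    and cmp_assoc:
      "\<lbrakk>f \<in> hom C W X; g \<in> hom C X Y; h \<in> hom C Y Z\<rbrakk> \<Longrightarrow> (h \<cdot> g) \<cdot> f = h \<cdot> (g \<cdot> f)"

definition inverse_arrows :: "('o, 'a, 'm) category_data_scheme \<Rightarrow> 'a \<Rightarrow> 'a \<Rightarrow> bool" where
  "inverse_arrows C f g \<longleftrightarrow>
     f \<in> arr C \<and> g \<in> hom C (tgt C f) (src C f) \<and>
     g \<cdot>\<^bsub>C\<^esub> f = \<i>\<d>\<^bsub>C\<^esub> (src C f) \<and> f \<cdot>\<^bsub>C\<^esub> g = \<i>\<d>\<^bsub>C\<^esub> (tgt C f)"

definition iso :: "('o, 'a, 'm) category_data_scheme \<Rightarrow> 'a \<Rightarrow> bool" where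
  "iso C f \<longleftrightarrow> (\<exists>g. inverse_arrows C f g)"

definition inverse_arrow :: "('o, 'a, 'm) category_data_scheme \<Rightarrow> 'a \<Rightarrow> 'a" where
  "inverse_arrow C f = (THE g. inverse_arrows C f g)"

text \<open>
  \<open>braid_unit\<close> is listed among the axioms as in Mac Lane's definition; it follows from the others.
\<close>

locale symmetric_monoidal_category =
  category C for C :: "('o, 'a) sm_data" (structure) +
  assumes tensor_obj: "\<lbrakk>X \<in> obj C; Y \<in> obj C\<rbrakk> \<Longrightarrow> X \<boxtimes> Y \<in> obj C"
    and unit_obj: "\<one> \<in> obj C"
    and tensor_hom: "\<lbrakk>f \<in> hom C X Y; g \<in> hom C X' Y'\<rbrakk> \<Longrightarrow> f \<otimes> g \<in> hom C (X \<boxtimes> X') (Y \<boxtimes> Y')"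
    and tensor_id: "\<lbrakk>X \<in> obj C; Y \<in> obj C\<rbrakk> \<Longrightarrow> \<i>\<d> X \<otimes> \<i>\<d> Y = \<i>\<d> (X \<boxtimes> Y)"
    and tensor_cmp:
      "\<lbrakk>f \<in> hom C X Y; g \<in> hom C Y Z; f' \<in> hom C X' Y'; g' \<in> hom C Y' Z'\<rbrakk>
       \<Longrightarrow> (g \<cdot> f) \<otimes> (g' \<cdot> f') = (g \<otimes> g') \<cdot> (f \<otimes> f')"
    and assoc_hom:
      "\<lbrakk>X \<in> obj C; Y \<in> obj C; Z \<in> obj C\<rbrakk>
       \<Longrightarrow> \<alpha> X Y Z \<in> hom C ((X \<boxtimes> Y) \<boxtimes> Z) (X \<boxtimes> (Y \<boxtimes> Z)) \<and> iso C (\<alpha> X Y Z)"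
    and lunit_hom: "X \<in> obj C \<Longrightarrow> \<ll> X \<in> hom C (\<one> \<boxtimes> X) X \<and> iso C (\<ll> X)"
    and runit_hom: "X \<in> obj C \<Longrightarrow> \<rr> X \<in> hom C (X \<boxtimes> \<one>) X \<and> iso C (\<rr> X)"
    and braid_hom: "\<lbrakk>X \<in> obj C; Y \<in> obj C\<rbrakk> \<Longrightarrow> \<tau> X Y \<in> hom C (X \<boxtimes> Y) (Y \<boxtimes> X)"
    and assoc_natural:
      "\<lbrakk>f \<in> hom C X X'; g \<in> hom C Y Y'; h \<in> hom C Z Z'\<rbrakk>
       \<Longrightarrow> \<alpha> X' Y' Z' \<cdot> ((f \<otimes> g) \<otimes> h) = (f \<otimes> (g \<otimes> h)) \<cdot> \<alpha> X Y Z"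
    and lunit_natural: "f \<in> hom C X X' \<Longrightarrow> \<ll> X' \<cdot> (\<i>\<d> \<one> \<otimes> f) = f \<cdot> \<ll> X"
    and runit_natural: "f \<in> hom C X X' \<Longrightarrow> \<rr> X' \<cdot> (f \<otimes> \<i>\<d> \<one>) = f \<cdot> \<rr> X"
    and braid_natural:
      "\<lbrakk>f \<in> hom C X X'; g \<in> hom C Y Y'\<rbrakk> \<Longrightarrow> \<tau> X' Y' \<cdot> (f \<otimes> g) = (g \<otimes> f) \<cdot> \<tau> X Y"
    and pentagon:
      "\<lbrakk>W \<in> obj C; X \<in> obj C; Y \<in> obj C; Z \<in> obj C\<rbrakk>
       \<Longrightarrow> \<alpha> W X (Y \<boxtimes> Z) \<cdot> \<alpha> (W \<boxtimes> X) Y Z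
         = (\<i>\<d> W \<otimes> \<alpha> X Y Z) \<cdot> \<alpha> W (X \<boxtimes> Y) Z \<cdot> (\<alpha> W X Y \<otimes> \<i>\<d> Z)"
    and triangle:
      "\<lbrakk>X \<in> obj C; Y \<in> obj C\<rbrakk> \<Longrightarrow> (\<i>\<d> X \<otimes> \<ll> Y) \<cdot> \<alpha> X \<one> Y = \<rr> X \<otimes> \<i>\<d> Y"
    and braid_symmetric:
      "\<lbrakk>X \<in> obj C; Y \<in> obj C\<rbrakk> \<Longrightarrow> \<tau> Y X \<cdot> \<tau> X Y = \<i>\<d> (X \<boxtimes> Y)"
    and braid_unit: "X \<in> obj C \<Longrightarrow> \<ll> X \<cdot> \<tau> X \<one> = \<rr> X"
    and hexagon:
      "\<lbrakk>X \<in> obj C; Y \<in> obj C; Z \<in> obj C\<rbrakk>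
       \<Longrightarrow> \<alpha> Y Z X \<cdot> \<tau> X (Y \<boxtimes> Z) \<cdot> \<alpha> X Y Z
         = (\<i>\<d> Y \<otimes> \<tau> X Z) \<cdot> \<alpha> Y X Z \<cdot> (\<tau> X Y \<otimes> \<i>\<d> Z)"

text \<open>The middle-four interchange \<open>(W \<boxtimes> X) \<boxtimes> (Y \<boxtimes> Z) \<rightarrow> (W \<boxtimes> Y) \<boxtimes> (X \<boxtimes> Z)\<close>.\<close>

definition interchange :: "('o, 'a) sm_data \<Rightarrow> 'o \<Rightarrow> 'o \<Rightarrow> 'o \<Rightarrow> 'o \<Rightarrow> 'a" where
  "interchange C W X Y Z =
     inverse_arrow C (\<alpha>\<^bsub>C\<^esub> W Y (X \<boxtimes>\<^bsub>C\<^esub> Z)) \<cdot>\<^bsub>C\<^esub>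
     (\<i>\<d>\<^bsub>C\<^esub> W \<otimes>\<^bsub>C\<^esub>
        (\<alpha>\<^bsub>C\<^esub> Y X Z \<cdot>\<^bsub>C\<^esub> (\<tau>\<^bsub>C\<^esub> X Y \<otimes>\<^bsub>C\<^esub> \<i>\<d>\<^bsub>C\<^esub> Z) \<cdot>\<^bsub>C\<^esub> inverse_arrow C (\<alpha>\<^bsub>C\<^esub> X Y Z))) \<cdot>\<^bsub>C\<^esub>
     \<alpha>\<^bsub>C\<^esub> W X (Y \<boxtimes>\<^bsub>C\<^esub> Z)"


section \<open>Symmetric monoidal functors and monoidal natural transformations\<close>

record ('o1, 'a1, 'o2, 'a2) functor_data =
  fobj :: "'o1 \<Rightarrow> 'o2"
  farr :: "'a1 \<Rightarrow> 'a2"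

record ('o1, 'a1, 'o2, 'a2) mon_functor = "('o1, 'a1, 'o2, 'a2) functor_data" +
  ften :: "'o1 \<Rightarrow> 'o1 \<Rightarrow> 'a2"
  funit :: 'a2

locale cat_functor = D: category D + C: category C
  for D :: "('o1, 'a1, 'm1) category_data_scheme"
    and C :: "('o2, 'a2, 'm2) category_data_scheme" +
  fixes F :: "('o1, 'a1, 'o2, 'a2, 'f) functor_data_scheme"
  assumes fobj_obj: "X \<in> obj D \<Longrightarrow> fobj F X \<in> obj C"
    and farr_hom: "f \<in> hom D X Y \<Longrightarrow> farr F f \<in> hom C (fobj F X) (fobj F Y)"
    and farr_id: "X \<in> obj D \<Longrightarrow> farr F (\<i>\<d>\<^bsub>D\<^esub> X) = \<i>\<d>\<^bsub>C\<^esub> (fobj F X)"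
    and farr_cmp:
      "\<lbrakk>f \<in> hom D X Y; g \<in> hom D Y Z\<rbrakk> \<Longrightarrow> farr F (g \<cdot>\<^bsub>D\<^esub> f) = farr F g \<cdot>\<^bsub>C\<^esub> farr F f"

locale natural_transformation = F: cat_functor D C F + G: cat_functor D C G
  for D :: "('o1, 'a1, 'm1) category_data_scheme"
    and C :: "('o2, 'a2, 'm2) category_data_scheme"
    and F :: "('o1, 'a1, 'o2, 'a2, 'f) functor_data_scheme"
    and G :: "('o1, 'a1, 'o2, 'a2, 'g) functor_data_scheme" +
  fixes \<theta> :: "'o1 \<Rightarrow> 'a2"
  assumes component_hom: "X \<in> obj D \<Longrightarrow> \<theta> X \<in> hom C (fobj F X) (fobj G X)"
    and naturality: "f \<in> hom D X Y \<Longrightarrow> \<theta> Y \<cdot>\<^bsub>C\<^esub> farr F f = farr G f \<cdot>\<^bsub>C\<^esub> \<theta> X"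

locale symmetric_monoidal_functor =
  D: symmetric_monoidal_category D + C: symmetric_monoidal_category C + cat_functor D C F
  for D :: "('o1, 'a1) sm_data" and C :: "('o2, 'a2) sm_data"
    and F :: "('o1, 'a1, 'o2, 'a2) mon_functor" +
  assumes ften_hom:
      "\<lbrakk>X \<in> obj D; Y \<in> obj D\<rbrakk>
       \<Longrightarrow> ften F X Y \<in> hom C (fobj F X \<boxtimes>\<^bsub>C\<^esub> fobj F Y) (fobj F (X \<boxtimes>\<^bsub>D\<^esub> Y)) \<and> iso C (ften F X Y)"
    and funit_hom: "funit F \<in> hom C \<one>\<^bsub>C\<^esub> (fobj F \<one>\<^bsub>D\<^esub>) \<and> iso C (funit F)"
    and ften_natural:
      "\<lbrakk>f \<in> hom D X X'; g \<in> hom D Y Y'\<rbrakk>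
       \<Longrightarrow> ften F X' Y' \<cdot>\<^bsub>C\<^esub> (farr F f \<otimes>\<^bsub>C\<^esub> farr F g) = farr F (f \<otimes>\<^bsub>D\<^esub> g) \<cdot>\<^bsub>C\<^esub> ften F X Y"
    and ften_assoc:
      "\<lbrakk>X \<in> obj D; Y \<in> obj D; Z \<in> obj D\<rbrakk>
       \<Longrightarrow> farr F (\<alpha>\<^bsub>D\<^esub> X Y Z) \<cdot>\<^bsub>C\<^esub> ften F (X \<boxtimes>\<^bsub>D\<^esub> Y) Z \<cdot>\<^bsub>C\<^esub> (ften F X Y \<otimes>\<^bsub>C\<^esub> \<i>\<d>\<^bsub>C\<^esub> (fobj F Z))
         = ften F X (Y \<boxtimes>\<^bsub>D\<^esub> Z) \<cdot>\<^bsub>C\<^esub> (\<i>\<d>\<^bsub>C\<^esub> (fobj F X) \<otimes>\<^bsub>C\<^esub> ften F Y Z)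
             \<cdot>\<^bsub>C\<^esub> \<alpha>\<^bsub>C\<^esub> (fobj F X) (fobj F Y) (fobj F Z)"
    and ften_lunit:
      "X \<in> obj D \<Longrightarrow>
       farr F (\<ll>\<^bsub>D\<^esub> X) \<cdot>\<^bsub>C\<^esub> ften F \<one>\<^bsub>D\<^esub> X \<cdot>\<^bsub>C\<^esub> (funit F \<otimes>\<^bsub>C\<^esub> \<i>\<d>\<^bsub>C\<^esub> (fobj F X)) = \<ll>\<^bsub>C\<^esub> (fobj F X)"
    and ften_runit:
      "X \<in> obj D \<Longrightarrow>
       farr F (\<rr>\<^bsub>D\<^esub> X) \<cdot>\<^bsub>C\<^esub> ften F X \<one>\<^bsub>D\<^esub> \<cdot>\<^bsub>C\<^esub> (\<i>\<d>\<^bsub>C\<^esub> (fobj F X) \<otimes>\<^bsub>C\<^esub> funit F) = \<rr>\<^bsub>C\<^esub> (fobj F X)"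
    and ften_braid:
      "\<lbrakk>X \<in> obj D; Y \<in> obj D\<rbrakk>
       \<Longrightarrow> ften F Y X \<cdot>\<^bsub>C\<^esub> \<tau>\<^bsub>C\<^esub> (fobj F X) (fobj F Y) = farr F (\<tau>\<^bsub>D\<^esub> X Y) \<cdot>\<^bsub>C\<^esub> ften F X Y"

locale monoidal_transformation =
  F: symmetric_monoidal_functor D C F + G: symmetric_monoidal_functor D C G +
  natural_transformation D C F G \<theta>
  for D :: "('o1, 'a1) sm_data" and C :: "('o2, 'a2) sm_data"
    and F :: "('o1, 'a1, 'o2, 'a2) mon_functor" and G :: "('o1, 'a1, 'o2, 'a2) mon_functor"
    and \<theta> :: "'o1 \<Rightarrow> 'a2" +
  assumes component_tensor:
      "\<lbrakk>X \<in> obj D; Y \<in> obj D\<rbrakk>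
       \<Longrightarrow> \<theta> (X \<boxtimes>\<^bsub>D\<^esub> Y) \<cdot>\<^bsub>C\<^esub> ften F X Y = ften G X Y \<cdot>\<^bsub>C\<^esub> (\<theta> X \<otimes>\<^bsub>C\<^esub> \<theta> Y)"
    and component_unit: "\<theta> \<one>\<^bsub>D\<^esub> \<cdot>\<^bsub>C\<^esub> funit F = funit G"

definition mon_functor_id :: "('o, 'a) sm_data \<Rightarrow> ('o, 'a, 'o, 'a) mon_functor" where
  "mon_functor_id D =
     \<lparr>fobj = (\<lambda>X. X), farr = (\<lambda>f. f), ften = (\<lambda>X Y. \<i>\<d>\<^bsub>D\<^esub> (X \<boxtimes>\<^bsub>D\<^esub> Y)), funit = \<i>\<d>\<^bsub>D\<^esub> \<one>\<^bsub>D\<^esub>\<rparr>"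

text \<open>\<open>mon_functor_comp E G F\<close> is the composite of \<open>F\<close> followed by \<open>G\<close>, where \<open>E\<close> is the target of \<open>G\<close>.\<close>

definition mon_functor_comp ::
    "('o3, 'a3) sm_data \<Rightarrow> ('o2, 'a2, 'o3, 'a3) mon_functor \<Rightarrow> ('o1, 'a1, 'o2, 'a2) mon_functor
     \<Rightarrow> ('o1, 'a1, 'o3, 'a3) mon_functor" where
  "mon_functor_comp E G F =
     \<lparr>fobj = (\<lambda>X. fobj G (fobj F X)),
      farr = (\<lambda>f. farr G (farr F f)),
      ften = (\<lambda>X Y. farr G (ften F X Y) \<cdot>\<^bsub>E\<^esub> ften G (fobj F X) (fobj F Y)),
      funit = farr G (funit F) \<cdot>\<^bsub>E\<^esub> funit G\<rparr>"

definition symmetric_monoidal_equivalent ::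
    "('o1, 'a1) sm_data \<Rightarrow> ('o2, 'a2) sm_data \<Rightarrow> bool" where
  "symmetric_monoidal_equivalent D E \<longleftrightarrow>
     symmetric_monoidal_category D \<and> symmetric_monoidal_category E \<and>
     (\<exists>F G \<eta> \<epsilon>.
        symmetric_monoidal_functor D E F \<and>
        symmetric_monoidal_functor E D G \<and>
        monoidal_transformation D D (mon_functor_id D) (mon_functor_comp D G F) \<eta> \<and>
        (\<forall>X\<in>obj D. iso D (\<eta> X)) \<and>
        monoidal_transformation E E (mon_functor_comp E F G) (mon_functor_id E) \<epsilon> \<and>
        (\<forall>Y\<in>obj E. iso E (\<epsilon> Y)))"


section \<open>The symmetric monoidal category of symmetric monoidal functors\<close>

record ('o1, 'a1, 'o2, 'a2) mon_trans =
  tr_src :: "('o1, 'a1, 'o2, 'a2) mon_functor"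
  tr_tgt :: "('o1, 'a1, 'o2, 'a2) mon_functor"
  tr_cmp :: "'o1 \<Rightarrow> 'a2"

text \<open>
  Objects and arrows of the functor category are required to be extensional, so that equality of
  functors and of transformations in HOL is equality on the carriers of the domain category.
\<close>

definition extensional_mon_functor ::
    "('o1, 'a1) sm_data \<Rightarrow> ('o1, 'a1, 'o2, 'a2) mon_functor \<Rightarrow> bool" where
  "extensional_mon_functor D F \<longleftrightarrow>
     fobj F \<in> extensional (obj D) \<and> farr F \<in> extensional (arr D) \<and>
     ften F \<in> extensional (obj D) \<and> (\<forall>X\<in>obj D. ften F X \<in> extensional (obj D))"

definition mon_functor_tensor ::
    "('o1, 'a1) sm_data \<Rightarrow> ('o2, 'a2) sm_data \<Rightarrow> ('o1, 'a1, 'o2, 'a2) mon_functor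
     \<Rightarrow> ('o1, 'a1, 'o2, 'a2) mon_functor \<Rightarrow> ('o1, 'a1, 'o2, 'a2) mon_functor" where
  "mon_functor_tensor D C F G =
     \<lparr>fobj = (\<lambda>X\<in>obj D. fobj F X \<boxtimes>\<^bsub>C\<^esub> fobj G X),
      farr = (\<lambda>f\<in>arr D. farr F f \<otimes>\<^bsub>C\<^esub> farr G f),
      ften = (\<lambda>X\<in>obj D. \<lambda>Y\<in>obj D.
                (ften F X Y \<otimes>\<^bsub>C\<^esub> ften G X Y) \<cdot>\<^bsub>C\<^esub>
                interchange C (fobj F X) (fobj G X) (fobj F Y) (fobj G Y)),
      funit = (funit F \<otimes>\<^bsub>C\<^esub> funit G) \<cdot>\<^bsub>C\<^esub> inverse_arrow C (\<ll>\<^bsub>C\<^esub> \<one>\<^bsub>C\<^esub>)\<rparr>"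

definition mon_functor_unit ::
    "('o1, 'a1) sm_data \<Rightarrow> ('o2, 'a2) sm_data \<Rightarrow> ('o1, 'a1, 'o2, 'a2) mon_functor" where
  "mon_functor_unit D C =
     \<lparr>fobj = (\<lambda>X\<in>obj D. \<one>\<^bsub>C\<^esub>),
      farr = (\<lambda>f\<in>arr D. \<i>\<d>\<^bsub>C\<^esub> \<one>\<^bsub>C\<^esub>),
      ften = (\<lambda>X\<in>obj D. \<lambda>Y\<in>obj D. \<ll>\<^bsub>C\<^esub> \<one>\<^bsub>C\<^esub>),
      funit = \<i>\<d>\<^bsub>C\<^esub> \<one>\<^bsub>C\<^esub>\<rparr>"

definition Symm_Mon_obj ::
    "('o1, 'a1) sm_data \<Rightarrow> ('o2, 'a2) sm_data \<Rightarrow> ('o1, 'a1, 'o2, 'a2) mon_functor set" where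
  "Symm_Mon_obj D C = {F. symmetric_monoidal_functor D C F \<and> extensional_mon_functor D F}"

definition Symm_Mon ::
    "('o1, 'a1) sm_data \<Rightarrow> ('o2, 'a2) sm_data
     \<Rightarrow> (('o1, 'a1, 'o2, 'a2) mon_functor, ('o1, 'a1, 'o2, 'a2) mon_trans) sm_data" where
  "Symm_Mon D C =
    (let ten = mon_functor_tensor D C;
         e = mon_functor_unit D C;
         mk = (\<lambda>F G \<theta>. \<lparr>tr_src = F, tr_tgt = G, tr_cmp = (\<lambda>X\<in>obj D. \<theta> X)\<rparr>)
     in
     \<lparr>obj = Symm_Mon_obj D C,
      arr = {\<theta>. tr_src \<theta> \<in> Symm_Mon_obj D C \<and> tr_tgt \<theta> \<in> Symm_Mon_obj D C \<and>
                tr_cmp \<theta> \<in> extensional (obj D) \<and>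
                monoidal_transformation D C (tr_src \<theta>) (tr_tgt \<theta>) (tr_cmp \<theta>)},
      src = tr_src,
      tgt = tr_tgt,
      idt = (\<lambda>F. mk F F (\<lambda>X. \<i>\<d>\<^bsub>C\<^esub> (fobj F X))),
      cmp = (\<lambda>\<phi> \<theta>. mk (tr_src \<theta>) (tr_tgt \<phi>) (\<lambda>X. tr_cmp \<phi> X \<cdot>\<^bsub>C\<^esub> tr_cmp \<theta> X)),
      tensor_obj = ten,
      tensor_arr = (\<lambda>\<theta> \<phi>. mk (ten (tr_src \<theta>) (tr_src \<phi>)) (ten (tr_tgt \<theta>) (tr_tgt \<phi>))
                              (\<lambda>X. tr_cmp \<theta> X \<otimes>\<^bsub>C\<^esub> tr_cmp \<phi> X)),
      unit_obj = e,
      associator = (\<lambda>F G H. mk (ten (ten F G) H) (ten F (ten G H))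
                              (\<lambda>X. \<alpha>\<^bsub>C\<^esub> (fobj F X) (fobj G X) (fobj H X))),
      left_unitor = (\<lambda>F. mk (ten e F) F (\<lambda>X. \<ll>\<^bsub>C\<^esub> (fobj F X))),
      right_unitor = (\<lambda>F. mk (ten F e) F (\<lambda>X. \<rr>\<^bsub>C\<^esub> (fobj F X))),
      braiding = (\<lambda>F G. mk (ten F G) (ten G F) (\<lambda>X. \<tau>\<^bsub>C\<^esub> (fobj F X) (fobj G X)))\<rparr>)"


section \<open>Knowledgeable Frobenius algebras\<close>

record ('o, 'a) frobenius =
  car :: 'o
  mu :: 'a
  eta :: 'a
  delta :: 'a
  eps :: 'a

record ('o, 'a) kfrob =
  open_alg :: "('o, 'a) frobenius"
  closed_alg :: "('o, 'a) frobenius"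
  iota :: 'a  \<comment> \<open>\<open>\<imath> : C \<rightarrow> A\<close>\<close>
  iota_star :: 'a  \<comment> \<open>\<open>\<imath>\<^sup>* : A \<rightarrow> C\<close>\<close>

locale algebra_object = symmetric_monoidal_category C
  for C :: "('o, 'a) sm_data" (structure) +
  fixes A :: 'o and \<mu> :: 'a and \<eta> :: 'a
  assumes alg_obj: "A \<in> obj C"
    and mult_hom: "\<mu> \<in> hom C (A \<boxtimes> A) A"
    and unit_hom: "\<eta> \<in> hom C \<one> A"
    and mult_assoc: "\<mu> \<cdot> (\<mu> \<otimes> \<i>\<d> A) = \<mu> \<cdot> (\<i>\<d> A \<otimes> \<mu>) \<cdot> \<alpha> A A A"
    and mult_lunit: "\<mu> \<cdot> (\<eta> \<otimes> \<i>\<d> A) = \<ll> A"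
    and mult_runit: "\<mu> \<cdot> (\<i>\<d> A \<otimes> \<eta>) = \<rr> A"

locale coalgebra_object = symmetric_monoidal_category C
  for C :: "('o, 'a) sm_data" (structure) +
  fixes A :: 'o and \<Delta> :: 'a and \<epsilon> :: 'a
  assumes coalg_obj: "A \<in> obj C"
    and comult_hom: "\<Delta> \<in> hom C A (A \<boxtimes> A)"
    and counit_hom: "\<epsilon> \<in> hom C A \<one>"
    and comult_coassoc: "\<alpha> A A A \<cdot> (\<Delta> \<otimes> \<i>\<d> A) \<cdot> \<Delta> = (\<i>\<d> A \<otimes> \<Delta>) \<cdot> \<Delta>"
    and comult_lcounit: "\<ll> A \<cdot> (\<epsilon> \<otimes> \<i>\<d> A) \<cdot> \<Delta> = \<i>\<d> A"
    and comult_rcounit: "\<rr> A \<cdot> (\<i>\<d> A \<otimes> \<epsilon>) \<cdot> \<Delta> = \<i>\<d> A"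

locale frobenius_algebra =
  algebra_object C "car A" "mu A" "eta A" + coalgebra_object C "car A" "delta A" "eps A"
  for C :: "('o, 'a) sm_data" (structure) and A :: "('o, 'a) frobenius" +
  assumes frobenius_left:
      "(\<i>\<d> (car A) \<otimes> mu A) \<cdot> \<alpha> (car A) (car A) (car A) \<cdot> (delta A \<otimes> \<i>\<d> (car A)) = delta A \<cdot> mu A"
    and frobenius_right:
      "delta A \<cdot> mu A =
       (mu A \<otimes> \<i>\<d> (car A)) \<cdot> inverse_arrow C (\<alpha> (car A) (car A) (car A)) \<cdot> (\<i>\<d> (car A) \<otimes> delta A)"

locale symmetric_frobenius_algebra = frobenius_algebra +
  assumes symmetric: "eps A \<cdot> mu A = eps A \<cdot> mu A \<cdot> \<tau> (car A) (car A)"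

locale commutative_frobenius_algebra = frobenius_algebra +
  assumes commutative: "mu A = mu A \<cdot> \<tau> (car A) (car A)"

definition algebra_hom ::
    "('o, 'a) sm_data \<Rightarrow> ('o, 'a) frobenius \<Rightarrow> ('o, 'a) frobenius \<Rightarrow> 'a \<Rightarrow> bool" where
  "algebra_hom C A B f \<longleftrightarrow>
     f \<in> hom C (car A) (car B) \<and>
     f \<cdot>\<^bsub>C\<^esub> mu A = mu B \<cdot>\<^bsub>C\<^esub> (f \<otimes>\<^bsub>C\<^esub> f) \<and>
     f \<cdot>\<^bsub>C\<^esub> eta A = eta B"

definition coalgebra_hom ::
    "('o, 'a) sm_data \<Rightarrow> ('o, 'a) frobenius \<Rightarrow> ('o, 'a) frobenius \<Rightarrow> 'a \<Rightarrow> bool" where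
  "coalgebra_hom C A B f \<longleftrightarrow>
     f \<in> hom C (car A) (car B) \<and>
     delta B \<cdot>\<^bsub>C\<^esub> f = (f \<otimes>\<^bsub>C\<^esub> f) \<cdot>\<^bsub>C\<^esub> delta A \<and>
     eps B \<cdot>\<^bsub>C\<^esub> f = eps A"

definition frobenius_hom ::
    "('o, 'a) sm_data \<Rightarrow> ('o, 'a) frobenius \<Rightarrow> ('o, 'a) frobenius \<Rightarrow> 'a \<Rightarrow> bool" where
  "frobenius_hom C A B f \<longleftrightarrow> algebra_hom C A B f \<and> coalgebra_hom C A B f"

locale knowledgeable_frobenius_algebra =
  A: symmetric_frobenius_algebra C "open_alg K" +
  C: commutative_frobenius_algebra C "closed_alg K"
  for C :: "('o, 'a) sm_data" (structure) and K :: "('o, 'a) kfrob" +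
  assumes iota_hom: "algebra_hom C (closed_alg K) (open_alg K) (iota K)"
    and iota_star_hom: "iota_star K \<in> hom C (car (open_alg K)) (car (closed_alg K))"
    and knowledge:
      "mu (open_alg K) \<cdot> (iota K \<otimes> \<i>\<d> (car (open_alg K))) =
       mu (open_alg K) \<cdot> \<tau> (car (open_alg K)) (car (open_alg K)) \<cdot> (iota K \<otimes> \<i>\<d> (car (open_alg K)))"
    and duality:
      "eps (closed_alg K) \<cdot> mu (closed_alg K) \<cdot> (\<i>\<d> (car (closed_alg K)) \<otimes> iota_star K) =
       eps (open_alg K) \<cdot> mu (open_alg K) \<cdot> (iota K \<otimes> \<i>\<d> (car (open_alg K)))"
    and cardy:
      "mu (open_alg K) \<cdot> \<tau> (car (open_alg K)) (car (open_alg K)) \<cdot> delta (open_alg K) =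
       iota K \<cdot> iota_star K"

definition kfrob_hom ::
    "('o, 'a) sm_data \<Rightarrow> ('o, 'a) kfrob \<Rightarrow> ('o, 'a) kfrob \<Rightarrow> 'a \<times> 'a \<Rightarrow> bool" where
  "kfrob_hom C K L \<phi> \<longleftrightarrow>
     frobenius_hom C (open_alg K) (open_alg L) (fst \<phi>) \<and>
     frobenius_hom C (closed_alg K) (closed_alg L) (snd \<phi>) \<and>
     iota L \<cdot>\<^bsub>C\<^esub> snd \<phi> = fst \<phi> \<cdot>\<^bsub>C\<^esub> iota K \<and>
     iota_star L \<cdot>\<^bsub>C\<^esub> fst \<phi> = snd \<phi> \<cdot>\<^bsub>C\<^esub> iota_star K"

definition frobenius_tensor ::
    "('o, 'a) sm_data \<Rightarrow> ('o, 'a) frobenius \<Rightarrow> ('o, 'a) frobenius \<Rightarrow> ('o, 'a) frobenius" where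
  "frobenius_tensor C A B =
     \<lparr>car = car A \<boxtimes>\<^bsub>C\<^esub> car B,
      mu = (mu A \<otimes>\<^bsub>C\<^esub> mu B) \<cdot>\<^bsub>C\<^esub> interchange C (car A) (car B) (car A) (car B),
      eta = (eta A \<otimes>\<^bsub>C\<^esub> eta B) \<cdot>\<^bsub>C\<^esub> inverse_arrow C (\<ll>\<^bsub>C\<^esub> \<one>\<^bsub>C\<^esub>),
      delta = interchange C (car A) (car A) (car B) (car B) \<cdot>\<^bsub>C\<^esub> (delta A \<otimes>\<^bsub>C\<^esub> delta B),
      eps = \<ll>\<^bsub>C\<^esub> \<one>\<^bsub>C\<^esub> \<cdot>\<^bsub>C\<^esub> (eps A \<otimes>\<^bsub>C\<^esub> eps B)\<rparr>"

definition frobenius_unit :: "('o, 'a) sm_data \<Rightarrow> ('o, 'a) frobenius" where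
  "frobenius_unit C =
     \<lparr>car = \<one>\<^bsub>C\<^esub>, mu = \<ll>\<^bsub>C\<^esub> \<one>\<^bsub>C\<^esub>, eta = \<i>\<d>\<^bsub>C\<^esub> \<one>\<^bsub>C\<^esub>,
      delta = inverse_arrow C (\<ll>\<^bsub>C\<^esub> \<one>\<^bsub>C\<^esub>), eps = \<i>\<d>\<^bsub>C\<^esub> \<one>\<^bsub>C\<^esub>\<rparr>"

definition kfrob_tensor ::
    "('o, 'a) sm_data \<Rightarrow> ('o, 'a) kfrob \<Rightarrow> ('o, 'a) kfrob \<Rightarrow> ('o, 'a) kfrob" where
  "kfrob_tensor C K L =
     \<lparr>open_alg = frobenius_tensor C (open_alg K) (open_alg L),
      closed_alg = frobenius_tensor C (closed_alg K) (closed_alg L),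
      iota = iota K \<otimes>\<^bsub>C\<^esub> iota L,
      iota_star = iota_star K \<otimes>\<^bsub>C\<^esub> iota_star L\<rparr>"

definition kfrob_unit :: "('o, 'a) sm_data \<Rightarrow> ('o, 'a) kfrob" where
  "kfrob_unit C =
     \<lparr>open_alg = frobenius_unit C, closed_alg = frobenius_unit C,
      iota = \<i>\<d>\<^bsub>C\<^esub> \<one>\<^bsub>C\<^esub>, iota_star = \<i>\<d>\<^bsub>C\<^esub> \<one>\<^bsub>C\<^esub>\<rparr>"

abbreviation carA :: "('o, 'a) kfrob \<Rightarrow> 'o" where "carA K \<equiv> car (open_alg K)"
abbreviation carC :: "('o, 'a) kfrob \<Rightarrow> 'o" where "carC K \<equiv> car (closed_alg K)"

record ('o, 'a) kfrob_mor =
  kf_src :: "('o, 'a) kfrob"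
  kf_tgt :: "('o, 'a) kfrob"
  kf_map :: "'a \<times> 'a"

definition K_Frob :: "('o, 'a) sm_data \<Rightarrow> (('o, 'a) kfrob, ('o, 'a) kfrob_mor) sm_data" where
  "K_Frob C =
    (let ten = kfrob_tensor C;
         e = kfrob_unit C;
         mk = (\<lambda>K L \<phi>. \<lparr>kf_src = K, kf_tgt = L, kf_map = \<phi>\<rparr>)
     in
     \<lparr>obj = {K. knowledgeable_frobenius_algebra C K},
      arr = {\<phi>. knowledgeable_frobenius_algebra C (kf_src \<phi>) \<and>
                knowledgeable_frobenius_algebra C (kf_tgt \<phi>) \<and>
                kfrob_hom C (kf_src \<phi>) (kf_tgt \<phi>) (kf_map \<phi>)},
      src = kf_src,
      tgt = kf_tgt,
      idt = (\<lambda>K. mk K K (\<i>\<d>\<^bsub>C\<^esub> (carA K), \<i>\<d>\<^bsub>C\<^esub> (carC K))),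
      cmp = (\<lambda>\<psi> \<phi>. mk (kf_src \<phi>) (kf_tgt \<psi>)
                       (fst (kf_map \<psi>) \<cdot>\<^bsub>C\<^esub> fst (kf_map \<phi>), snd (kf_map \<psi>) \<cdot>\<^bsub>C\<^esub> snd (kf_map \<phi>))),
      tensor_obj = ten,
      tensor_arr = (\<lambda>\<phi> \<psi>. mk (ten (kf_src \<phi>) (kf_src \<psi>)) (ten (kf_tgt \<phi>) (kf_tgt \<psi>))
                       (fst (kf_map \<phi>) \<otimes>\<^bsub>C\<^esub> fst (kf_map \<psi>), snd (kf_map \<phi>) \<otimes>\<^bsub>C\<^esub> snd (kf_map \<psi>))),
      unit_obj = e,
      associator = (\<lambda>K L M. mk (ten (ten K L) M) (ten K (ten L M))
                       (\<alpha>\<^bsub>C\<^esub> (carA K) (carA L) (carA M), \<alpha>\<^bsub>C\<^esub> (carC K) (carC L) (carC M))),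
      left_unitor = (\<lambda>K. mk (ten e K) K (\<ll>\<^bsub>C\<^esub> (carA K), \<ll>\<^bsub>C\<^esub> (carC K))),
      right_unitor = (\<lambda>K. mk (ten K e) K (\<rr>\<^bsub>C\<^esub> (carA K), \<rr>\<^bsub>C\<^esub> (carC K))),
      braiding = (\<lambda>K L. mk (ten K L) (ten L K)
                       (\<tau>\<^bsub>C\<^esub> (carA K) (carA L), \<tau>\<^bsub>C\<^esub> (carC K) (carC L)))\<rparr>)"


section \<open>The theory of knowledgeable Frobenius algebras\<close>

text \<open>
  The generating objects \<open>A\<close> and \<open>C\<close> are \<open>Gen Op\<close> and \<open>Gen Cl\<close>. The edges \<open>Mu\<close>, \<open>Eta\<close>,
  \<open>Delta\<close>, \<open>Eps\<close> carry the colour that says to which of the two they belong.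
\<close>

datatype colour = Op | Cl

datatype word = One | Gen colour | Ten word word (infixr "\<otimes>\<^sub>w" 75)

datatype edge =
    Mu colour | Eta colour | Delta colour | Eps colour
  | Iota | IotaStar
  | Alpha word word word | AlphaBar word word word
  | Tau word word | TauBar word word
  | Lam word | LamBar word
  | Rho word | RhoBar word
  | TenL word edge
  | TenR edge word

fun esrc :: "edge \<Rightarrow> word" and etgt :: "edge \<Rightarrow> word" where
  "esrc (Mu c) = Gen c \<otimes>\<^sub>w Gen c"
| "esrc (Eta c) = One"
| "esrc (Delta c) = Gen c"
| "esrc (Eps c) = Gen c"
| "esrc Iota = Gen Cl"
| "esrc IotaStar = Gen Op"
| "esrc (Alpha X Y Z) = (X \<otimes>\<^sub>w Y) \<otimes>\<^sub>w Z"
| "esrc (AlphaBar X Y Z) = X \<otimes>\<^sub>w (Y \<otimes>\<^sub>w Z)"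
| "esrc (Tau X Y) = X \<otimes>\<^sub>w Y"
| "esrc (TauBar X Y) = Y \<otimes>\<^sub>w X"
| "esrc (Lam X) = One \<otimes>\<^sub>w X"
| "esrc (LamBar X) = X"
| "esrc (Rho X) = X \<otimes>\<^sub>w One"
| "esrc (RhoBar X) = X"
| "esrc (TenL Z f) = Z \<otimes>\<^sub>w esrc f"
| "esrc (TenR f Z) = esrc f \<otimes>\<^sub>w Z"
| "etgt (Mu c) = Gen c"
| "etgt (Eta c) = Gen c"
| "etgt (Delta c) = Gen c \<otimes>\<^sub>w Gen c"
| "etgt (Eps c) = One"
| "etgt Iota = Gen Op"
| "etgt IotaStar = Gen Cl"
| "etgt (Alpha X Y Z) = X \<otimes>\<^sub>w (Y \<otimes>\<^sub>w Z)"
| "etgt (AlphaBar X Y Z) = (X \<otimes>\<^sub>w Y) \<otimes>\<^sub>w Z"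
| "etgt (Tau X Y) = Y \<otimes>\<^sub>w X"
| "etgt (TauBar X Y) = X \<otimes>\<^sub>w Y"
| "etgt (Lam X) = X"
| "etgt (LamBar X) = One \<otimes>\<^sub>w X"
| "etgt (Rho X) = X"
| "etgt (RhoBar X) = X \<otimes>\<^sub>w One"
| "etgt (TenL Z f) = Z \<otimes>\<^sub>w etgt f"
| "etgt (TenR f Z) = etgt f \<otimes>\<^sub>w Z"

text \<open>
  Arrows of the free category: a source word together with a list of edges, the edge traversed
  first being the head of the list.
\<close>

type_synonym path = "word \<times> edge list"

fun chain :: "word \<Rightarrow> edge list \<Rightarrow> bool" where
  "chain X [] \<longleftrightarrow> True"
| "chain X (e # es) \<longleftrightarrow> esrc e = X \<and> chain (etgt e) es"

fun chain_end :: "word \<Rightarrow> edge list \<Rightarrow> word" where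
  "chain_end X [] = X"
| "chain_end X (e # es) = chain_end (etgt e) es"

definition paths :: "path set" where
  "paths = {p. chain (fst p) (snd p)}"

definition psrc :: "path \<Rightarrow> word" where "psrc p = fst p"
definition ptgt :: "path \<Rightarrow> word" where "ptgt p = chain_end (fst p) (snd p)"

definition pid :: "word \<Rightarrow> path" where
  "pid X = (X, [])"

definition pcmp :: "path \<Rightarrow> path \<Rightarrow> path" (infixr "\<bullet>" 55) where
  "q \<bullet> p = (fst p, snd p @ snd q)"

definition pedge :: "edge \<Rightarrow> path" ("\<langle>_\<rangle>") where
  "\<langle>e\<rangle> = (esrc e, [e])"

definition tenl :: "word \<Rightarrow> path \<Rightarrow> path" (infixr "\<rhd>" 70) where
  "X \<rhd> p = (X \<otimes>\<^sub>w fst p, map (TenL X) (snd p))"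

definition tenr :: "path \<Rightarrow> word \<Rightarrow> path" (infixl "\<lhd>" 70) where
  "p \<lhd> X = (fst p \<otimes>\<^sub>w X, map (\<lambda>e. TenR e X) (snd p))"

definition pten :: "path \<Rightarrow> path \<Rightarrow> path" (infixr "\<otimes>\<^sub>p" 70) where
  "p \<otimes>\<^sub>p q = (p \<lhd> ptgt q) \<bullet> (psrc p \<rhd> q)"

text \<open>
  Since words act on paths edge by edge, the relations \<open>(X \<otimes> p)(X \<otimes> q) \<sim> X \<otimes> (pq)\<close>,
  \<open>(p \<otimes> X)(q \<otimes> X) \<sim> (pq) \<otimes> X\<close> and \<open>id\<^bsub>X \<otimes> Y\<^esub> \<sim> X \<otimes> id\<^bsub>Y\<^esub> \<sim> id\<^bsub>X\<^esub> \<otimes> Y\<close> hold as equalities of paths,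
  and do not reappear among the generating relations below.
\<close>

lemma tenl_pcmp: "(X \<rhd> p) \<bullet> (X \<rhd> q) = X \<rhd> (p \<bullet> q)"
  and tenr_pcmp: "(p \<lhd> X) \<bullet> (q \<lhd> X) = (p \<bullet> q) \<lhd> X"
  and tenl_pid: "X \<rhd> pid Y = pid (X \<otimes>\<^sub>w Y)"
  and tenr_pid: "pid X \<lhd> Y = pid (X \<otimes>\<^sub>w Y)"
  by (simp_all add: tenl_def tenr_def pcmp_def pid_def)

abbreviation A_w :: word where "A_w \<equiv> Gen Op"
abbreviation C_w :: word where "C_w \<equiv> Gen Cl"

inductive th_rel :: "path \<Rightarrow> path \<Rightarrow> bool" (infix "\<approx>" 50) where
  mult_assoc:
    "\<langle>Mu c\<rangle> \<bullet> (\<langle>Mu c\<rangle> \<lhd> Gen c) \<approx> \<langle>Mu c\<rangle> \<bullet> (Gen c \<rhd> \<langle>Mu c\<rangle>) \<bullet> \<langle>Alpha (Gen c) (Gen c) (Gen c)\<rangle>"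
| mult_lunit: "\<langle>Mu c\<rangle> \<bullet> (\<langle>Eta c\<rangle> \<lhd> Gen c) \<approx> \<langle>Lam (Gen c)\<rangle>"
| mult_runit: "\<langle>Mu c\<rangle> \<bullet> (Gen c \<rhd> \<langle>Eta c\<rangle>) \<approx> \<langle>Rho (Gen c)\<rangle>"
| comult_coassoc:
    "\<langle>Alpha (Gen c) (Gen c) (Gen c)\<rangle> \<bullet> (\<langle>Delta c\<rangle> \<lhd> Gen c) \<bullet> \<langle>Delta c\<rangle> \<approx> (Gen c \<rhd> \<langle>Delta c\<rangle>) \<bullet> \<langle>Delta c\<rangle>"
| comult_lcounit: "\<langle>Lam (Gen c)\<rangle> \<bullet> (\<langle>Eps c\<rangle> \<lhd> Gen c) \<bullet> \<langle>Delta c\<rangle> \<approx> pid (Gen c)"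
| comult_rcounit: "\<langle>Rho (Gen c)\<rangle> \<bullet> (Gen c \<rhd> \<langle>Eps c\<rangle>) \<bullet> \<langle>Delta c\<rangle> \<approx> pid (Gen c)"
| frobenius_left:
    "(Gen c \<rhd> \<langle>Mu c\<rangle>) \<bullet> \<langle>Alpha (Gen c) (Gen c) (Gen c)\<rangle> \<bullet> (\<langle>Delta c\<rangle> \<lhd> Gen c) \<approx> \<langle>Delta c\<rangle> \<bullet> \<langle>Mu c\<rangle>"
| frobenius_right:
    "\<langle>Delta c\<rangle> \<bullet> \<langle>Mu c\<rangle> \<approx> (\<langle>Mu c\<rangle> \<lhd> Gen c) \<bullet> \<langle>AlphaBar (Gen c) (Gen c) (Gen c)\<rangle> \<bullet> (Gen c \<rhd> \<langle>Delta c\<rangle>)"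
| symmetric: "\<langle>Eps Op\<rangle> \<bullet> \<langle>Mu Op\<rangle> \<approx> \<langle>Eps Op\<rangle> \<bullet> \<langle>Mu Op\<rangle> \<bullet> \<langle>Tau A_w A_w\<rangle>"
| commutative: "\<langle>Mu Cl\<rangle> \<approx> \<langle>Mu Cl\<rangle> \<bullet> \<langle>Tau C_w C_w\<rangle>"
| iota_mult: "\<langle>Iota\<rangle> \<bullet> \<langle>Mu Cl\<rangle> \<approx> \<langle>Mu Op\<rangle> \<bullet> (\<langle>Iota\<rangle> \<otimes>\<^sub>p \<langle>Iota\<rangle>)"
| iota_unit: "\<langle>Iota\<rangle> \<bullet> \<langle>Eta Cl\<rangle> \<approx> \<langle>Eta Op\<rangle>"
| knowledge: "\<langle>Mu Op\<rangle> \<bullet> (\<langle>Iota\<rangle> \<lhd> A_w) \<approx> \<langle>Mu Op\<rangle> \<bullet> \<langle>Tau A_w A_w\<rangle> \<bullet> (\<langle>Iota\<rangle> \<lhd> A_w)"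
| duality: "\<langle>Eps Cl\<rangle> \<bullet> \<langle>Mu Cl\<rangle> \<bullet> (C_w \<rhd> \<langle>IotaStar\<rangle>) \<approx> \<langle>Eps Op\<rangle> \<bullet> \<langle>Mu Op\<rangle> \<bullet> (\<langle>Iota\<rangle> \<lhd> A_w)"
| cardy: "\<langle>Mu Op\<rangle> \<bullet> \<langle>Tau A_w A_w\<rangle> \<bullet> \<langle>Delta Op\<rangle> \<approx> \<langle>Iota\<rangle> \<bullet> \<langle>IotaStar\<rangle>"
| pentagon:
    "\<langle>Alpha W X (Y \<otimes>\<^sub>w Z)\<rangle> \<bullet> \<langle>Alpha (W \<otimes>\<^sub>w X) Y Z\<rangle> \<approx>
     (W \<rhd> \<langle>Alpha X Y Z\<rangle>) \<bullet> \<langle>Alpha W (X \<otimes>\<^sub>w Y) Z\<rangle> \<bullet> (\<langle>Alpha W X Y\<rangle> \<lhd> Z)"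
| triangle: "(X \<rhd> \<langle>Lam Y\<rangle>) \<bullet> \<langle>Alpha X One Y\<rangle> \<approx> \<langle>Rho X\<rangle> \<lhd> Y"
| braid_symmetric: "\<langle>Tau Y X\<rangle> \<bullet> \<langle>Tau X Y\<rangle> \<approx> pid (X \<otimes>\<^sub>w Y)"
| braid_unit: "\<langle>Lam X\<rangle> \<bullet> \<langle>Tau X One\<rangle> \<approx> \<langle>Rho X\<rangle>"
| hexagon:
    "\<langle>Alpha Y Z X\<rangle> \<bullet> \<langle>Tau X (Y \<otimes>\<^sub>w Z)\<rangle> \<bullet> \<langle>Alpha X Y Z\<rangle> \<approx>
     (Y \<rhd> \<langle>Tau X Z\<rangle>) \<bullet> \<langle>Alpha Y X Z\<rangle> \<bullet> (\<langle>Tau X Y\<rangle> \<lhd> Z)"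
| interchange:
    "\<lbrakk>t \<in> paths; s \<in> paths\<rbrakk> \<Longrightarrow> (t \<lhd> ptgt s) \<bullet> (psrc t \<rhd> s) \<approx> (ptgt t \<rhd> s) \<bullet> (t \<lhd> psrc s)"
| alpha_natural:
    "\<lbrakk>p \<in> paths; q \<in> paths; r \<in> paths\<rbrakk> \<Longrightarrow>
     \<langle>Alpha (ptgt p) (ptgt q) (ptgt r)\<rangle> \<bullet> ((p \<otimes>\<^sub>p q) \<otimes>\<^sub>p r) \<approx>
     (p \<otimes>\<^sub>p (q \<otimes>\<^sub>p r)) \<bullet> \<langle>Alpha (psrc p) (psrc q) (psrc r)\<rangle>"
| alphabar_natural:
    "\<lbrakk>p \<in> paths; q \<in> paths; r \<in> paths\<rbrakk> \<Longrightarrow>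
     \<langle>AlphaBar (ptgt p) (ptgt q) (ptgt r)\<rangle> \<bullet> (p \<otimes>\<^sub>p (q \<otimes>\<^sub>p r)) \<approx>
     ((p \<otimes>\<^sub>p q) \<otimes>\<^sub>p r) \<bullet> \<langle>AlphaBar (psrc p) (psrc q) (psrc r)\<rangle>"
| tau_natural:
    "\<lbrakk>p \<in> paths; q \<in> paths\<rbrakk> \<Longrightarrow>
     \<langle>Tau (ptgt p) (ptgt q)\<rangle> \<bullet> (p \<otimes>\<^sub>p q) \<approx> (q \<otimes>\<^sub>p p) \<bullet> \<langle>Tau (psrc p) (psrc q)\<rangle>"
| taubar_natural:
    "\<lbrakk>p \<in> paths; q \<in> paths\<rbrakk> \<Longrightarrow>
     \<langle>TauBar (ptgt p) (ptgt q)\<rangle> \<bullet> (q \<otimes>\<^sub>p p) \<approx> (p \<otimes>\<^sub>p q) \<bullet> \<langle>TauBar (psrc p) (psrc q)\<rangle>"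
| lam_natural: "p \<in> paths \<Longrightarrow> \<langle>Lam (ptgt p)\<rangle> \<bullet> (One \<rhd> p) \<approx> p \<bullet> \<langle>Lam (psrc p)\<rangle>"
| lambar_natural: "p \<in> paths \<Longrightarrow> \<langle>LamBar (ptgt p)\<rangle> \<bullet> p \<approx> (One \<rhd> p) \<bullet> \<langle>LamBar (psrc p)\<rangle>"
| rho_natural: "p \<in> paths \<Longrightarrow> \<langle>Rho (ptgt p)\<rangle> \<bullet> (p \<lhd> One) \<approx> p \<bullet> \<langle>Rho (psrc p)\<rangle>"
| rhobar_natural: "p \<in> paths \<Longrightarrow> \<langle>RhoBar (ptgt p)\<rangle> \<bullet> p \<approx> (p \<lhd> One) \<bullet> \<langle>RhoBar (psrc p)\<rangle>"
| alpha_inv1: "\<langle>AlphaBar X Y Z\<rangle> \<bullet> \<langle>Alpha X Y Z\<rangle> \<approx> pid ((X \<otimes>\<^sub>w Y) \<otimes>\<^sub>w Z)"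
| alpha_inv2: "\<langle>Alpha X Y Z\<rangle> \<bullet> \<langle>AlphaBar X Y Z\<rangle> \<approx> pid (X \<otimes>\<^sub>w (Y \<otimes>\<^sub>w Z))"
| tau_inv1: "\<langle>TauBar X Y\<rangle> \<bullet> \<langle>Tau X Y\<rangle> \<approx> pid (X \<otimes>\<^sub>w Y)"
| tau_inv2: "\<langle>Tau X Y\<rangle> \<bullet> \<langle>TauBar X Y\<rangle> \<approx> pid (Y \<otimes>\<^sub>w X)"
| lam_inv1: "\<langle>LamBar X\<rangle> \<bullet> \<langle>Lam X\<rangle> \<approx> pid (One \<otimes>\<^sub>w X)"
| lam_inv2: "\<langle>Lam X\<rangle> \<bullet> \<langle>LamBar X\<rangle> \<approx> pid X"
| rho_inv1: "\<langle>RhoBar X\<rangle> \<bullet> \<langle>Rho X\<rangle> \<approx> pid (X \<otimes>\<^sub>w One)"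
| rho_inv2: "\<langle>Rho X\<rangle> \<bullet> \<langle>RhoBar X\<rangle> \<approx> pid X"
| tensor_left: "p \<approx> q \<Longrightarrow> X \<rhd> p \<approx> X \<rhd> q"
| tensor_right: "p \<approx> q \<Longrightarrow> p \<lhd> X \<approx> q \<lhd> X"

inductive th_cong :: "path \<Rightarrow> path \<Rightarrow> bool" (infix "\<sim>" 50) where
  base: "p \<approx> q \<Longrightarrow> p \<sim> q"
| refl: "p \<in> paths \<Longrightarrow> p \<sim> p"
| sym: "p \<sim> q \<Longrightarrow> q \<sim> p"
| trans: "\<lbrakk>p \<sim> q; q \<sim> r\<rbrakk> \<Longrightarrow> p \<sim> r"
| comp: "\<lbrakk>p \<sim> p'; q \<sim> q'; ptgt p = psrc q\<rbrakk> \<Longrightarrow> q \<bullet> p \<sim> q' \<bullet> p'"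

definition th_class :: "path \<Rightarrow> path set" where
  "th_class p = {q. p \<sim> q}"

definition th_rep :: "path set \<Rightarrow> path" where
  "th_rep f = (SOME p. p \<in> f)"

definition Th_K_Frob :: "(word, path set) sm_data" where
  "Th_K_Frob =
     \<lparr>obj = UNIV,
      arr = th_class ` paths,
      src = (\<lambda>f. psrc (th_rep f)),
      tgt = (\<lambda>f. ptgt (th_rep f)),
      idt = (\<lambda>X. th_class (pid X)),
      cmp = (\<lambda>g f. th_class (th_rep g \<bullet> th_rep f)),
      tensor_obj = Ten,
      tensor_arr = (\<lambda>f g. th_class (th_rep f \<otimes>\<^sub>p th_rep g)),
      unit_obj = One,
      associator = (\<lambda>X Y Z. th_class \<langle>Alpha X Y Z\<rangle>),
      left_unitor = (\<lambda>X. th_class \<langle>Lam X\<rangle>),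
      right_unitor = (\<lambda>X. th_class \<langle>Rho X\<rangle>),
      braiding = (\<lambda>X Y. th_class \<langle>Tau X Y\<rangle>)\<rparr>"

end

theory Submission
  imports Defs
begin

text \<open>
  Evaluating a symmetric monoidal functor out of the theory at the generic algebra gives a
  knowledgeable Frobenius algebra (\<open>eval\<close>), and evaluating a monoidal transformation at the two
  generating objects gives a homomorphism (\<open>eval_trans\<close>). This evaluation is the equivalence. With
  the chosen tensor products it commutes with all the monoidal structure on the nose, it is onto on
  objects, and it is bijective on each hom set (\<open>eval_strict_equivalence\<close>). Everything else is then
  formal: along such a map the axioms of a symmetric monoidal category pass from the source to the
  target, and a choice of preimages of the objects extends in one way to an inverse functor, whose
  coherence conditions hold because they hold after applying the faithful map (locale
  \<open>strict_equivalence\<close>). In particular the tensor product of two algebras is an algebra because it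
  is the value of a tensor product of functors.

  Two inputs remain.

  First, the functor category has to be symmetric monoidal. The pointwise tensor product of functors
  is a monoidal functor, with monoidal associator, unitors and braiding, precisely because the
  middle-four interchange satisfies certain identities in up to six objects. All of them compare two
  canonical morphisms with the same underlying permutation, so they are instances of Mac Lane's
  coherence theorem for symmetric monoidal categories (\<open>coherence\<close>). The theorem is proved by
  removing letters from words one at a time: for a letter \<open>n\<close> of a word \<open>w\<close> without repetitions
  there is a canonical isomorphism (\<open>pull\<close>) from \<open>w\<close> to \<open>n \<otimes> w'\<close>, where \<open>w'\<close> is \<open>w\<close> with
  \<open>n\<close> replaced by the unit, and it is natural in all canonical morphisms. Hence two parallel canonical
  morphisms agree as soon as they agree after the letter is erased, and between words without letters
  there is only one canonical morphism.

  Second, evaluation has to be onto on objects and bijective on homs. Words and paths are interpreted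
  in any structure \<open>K\<close> of the right type. For a functor \<open>F\<close> there is an isomorphism (\<open>compare\<close>) from the
  interpretation of a word in \<open>eval C F\<close> to its value under \<open>F\<close>, natural in all paths. Related
  paths have equal values under \<open>F\<close>, hence equal interpretations in \<open>eval C F\<close>, and for the
  generating relations these equations are the axioms of a knowledgeable Frobenius algebra. Conversely
  the interpretation in such an algebra respects all relations, so it descends to a functor
  (\<open>free_functor\<close>) whose value at the generic algebra is the given one. A homomorphism
  extends to words by tensoring and is transported along \<open>compare\<close> to a monoidal transformation;
  a monoidal transformation is determined by its components at the generators since its components
  at tensor products and at the unit are forced.
\<close>

section \<open>Calculating with arrows\<close>

text \<open>
  The axioms are stated for hom sets, whose end points a rewriting engine would have to guess.
  Below they are restated with the hypotheses \<open>f \<in> arr C\<close>, \<open>src C f =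
  X\<close>, \<open>tgt C f = Y\<close>, which simplification can decide; an axiom restated in
  this way keeps its name with a prime. Composites are kept associated to the right, and one more
  prime on the name of an equation marks the version that applies in front of a further composite.
\<close>

lemma hom_iff: "f \<in> hom C X Y \<longleftrightarrow> f \<in> arr C \<and> src C f = X \<and> tgt C f = Y"
  by (simp add: hom_def)

context category
begin

lemma src_obj' [simp]: "f \<in> arr C \<Longrightarrow> src C f \<in> obj C"
  and tgt_obj' [simp]: "f \<in> arr C \<Longrightarrow> tgt C f \<in> obj C"
  by (simp_all add: src_obj tgt_obj)

lemma id_arr [simp]:
  assumes "X \<in> obj C"
  shows "\<i>\<d> X \<in> arr C" "src C (\<i>\<d> X) = X" "tgt C (\<i>\<d> X) = X"
  using id_hom[OF assms] by (simp_all add: hom_iff)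

lemma cmp_arr [simp]:
  assumes "f \<in> arr C" "g \<in> arr C" "src C g = tgt C f"
  shows "g \<cdot> f \<in> arr C" "src C (g \<cdot> f) = src C f" "tgt C (g \<cdot> f) = tgt C g"
  using cmp_hom[of f "src C f" "tgt C f" g "tgt C g"] assms by (simp_all add: hom_iff)

lemma id_left' [simp]: "\<lbrakk>f \<in> arr C; tgt C f = Y\<rbrakk> \<Longrightarrow> \<i>\<d> Y \<cdot> f = f"
  and id_right' [simp]: "\<lbrakk>f \<in> arr C; src C f = X\<rbrakk> \<Longrightarrow> f \<cdot> \<i>\<d> X = f"
  by (auto intro!: id_left id_right simp: hom_iff)

lemma cmp_assoc' [simp]:
  "\<lbrakk>f \<in> arr C; g \<in> arr C; h \<in> arr C; src C g = tgt C f; src C h = tgt C g\<rbrakk>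
   \<Longrightarrow> (h \<cdot> g) \<cdot> f = h \<cdot> (g \<cdot> f)"
  by (rule cmp_assoc) (auto simp: hom_iff)

lemma cmp_square:
  assumes "g \<cdot> f = g' \<cdot> f'"
    and "f \<in> arr C" "g \<in> arr C" "src C g = tgt C f"
    and "f' \<in> arr C" "g' \<in> arr C" "src C g' = tgt C f'"
    and "k \<in> arr C" "tgt C k = src C f"
  shows "g \<cdot> f \<cdot> k = g' \<cdot> f' \<cdot> k"
proof -
  have "src C f' = src C (g' \<cdot> f')" using assms(5-7) by simp
  also have "\<dots> = src C (g \<cdot> f)" using assms(1) by simp
  also have "\<dots> = src C f" using assms(2-4) by simp
  finally have "src C f' = src C f" .
  then have "(g' \<cdot> f') \<cdot> k = g' \<cdot> f' \<cdot> k"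
    using assms(2-) by (intro cmp_assoc') simp_all
  moreover have "(g \<cdot> f) \<cdot> k = g \<cdot> f \<cdot> k"
    using assms(2-) by (intro cmp_assoc') simp_all
  ultimately show ?thesis using assms(1) by metis
qed

abbreviation iv where "iv f \<equiv> inverse_arrow C f"

lemma inverse_arrows_unique:
  assumes "inverse_arrows C f g" "inverse_arrows C f h"
  shows "g = h"
proof -
  have f: "f \<in> arr C" and g: "g \<in> arr C" "src C g = tgt C f" "tgt C g = src C f"
    and h: "h \<in> arr C" "src C h = tgt C f" "tgt C h = src C f"
    and eq: "g \<cdot> f = \<i>\<d> (src C f)" "f \<cdot> h = \<i>\<d> (tgt C f)"
    using assms by (auto simp: inverse_arrows_def hom_iff)
  have "g = g \<cdot> f \<cdot> h" using f g h eq by simp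
  also have "\<dots> = (g \<cdot> f) \<cdot> h" using f g h by simp
  also have "\<dots> = h" using f g h eq by simp
  finally show ?thesis .
qed

lemma inverse_arrow_eqI: "inverse_arrows C f g \<Longrightarrow> iv f = g"
  unfolding inverse_arrow_def by (blast intro: inverse_arrows_unique)

lemma iso_inverse_arrows: "iso C f \<Longrightarrow> inverse_arrows C f (iv f)"
  unfolding iso_def using inverse_arrow_eqI by metis

lemma iso_arr: "iso C f \<Longrightarrow> f \<in> arr C"
  by (auto simp: iso_def inverse_arrows_def)

lemma inv_arr [simp]:
  assumes "iso C f"
  shows "iv f \<in> arr C" "src C (iv f) = tgt C f" "tgt C (iv f) = src C f"
    "iv f \<cdot> f = \<i>\<d> (src C f)" "f \<cdot> iv f = \<i>\<d> (tgt C f)"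
  using iso_inverse_arrows[OF assms] by (auto simp: inverse_arrows_def hom_iff)

lemma inv_cancel [simp]:
  assumes "iso C f" "k \<in> arr C"
  shows "tgt C k = src C f \<Longrightarrow> iv f \<cdot> f \<cdot> k = k"
    and "tgt C k = tgt C f \<Longrightarrow> f \<cdot> iv f \<cdot> k = k"
proof -
  note f = iso_arr[OF assms(1)]
  show "tgt C k = src C f \<Longrightarrow> iv f \<cdot> f \<cdot> k = k"
    using cmp_assoc'[of k f "iv f"] assms f by (simp del: cmp_assoc')
  show "tgt C k = tgt C f \<Longrightarrow> f \<cdot> iv f \<cdot> k = k"
    using cmp_assoc'[of k "iv f" f] assms f by (simp del: cmp_assoc')
qed

lemma inverse_arrows_inv: "iso C f \<Longrightarrow> inverse_arrows C (iv f) f"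
  by (simp add: inverse_arrows_def hom_iff iso_arr)

lemma iso_inv [simp]: "iso C f \<Longrightarrow> iso C (iv f)"
  and inv_inv [simp]: "iso C f \<Longrightarrow> iv (iv f) = f"
  using inverse_arrows_inv inverse_arrow_eqI unfolding iso_def by blast+

lemma isoI:
  assumes "f \<in> arr C" "g \<in> arr C" "src C g = tgt C f" "tgt C g = src C f"
    "g \<cdot> f = \<i>\<d> (src C f)" "f \<cdot> g = \<i>\<d> (tgt C f)"
  shows "iso C f \<and> iv f = g"
proof -
  have "inverse_arrows C f g" using assms by (auto simp: inverse_arrows_def hom_iff)
  then show ?thesis by (auto simp: iso_def inverse_arrow_eqI)
qed

lemma iso_id [simp]:
  assumes "X \<in> obj C" shows "iso C (\<i>\<d> X)" "iv (\<i>\<d> X) = \<i>\<d> X"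
  using isoI[of "\<i>\<d> X" "\<i>\<d> X"] assms by simp_all

lemma iso_cmp [simp]:
  assumes "iso C f" "iso C g" "src C g = tgt C f"
  shows "iso C (g \<cdot> f)" "iv (g \<cdot> f) = iv f \<cdot> iv g"
proof -
  note ar = assms(1,2)[THEN iso_arr]
  have "iso C (g \<cdot> f) \<and> iv (g \<cdot> f) = iv f \<cdot> iv g"
    by (rule isoI) (use assms ar in simp_all)
  then show "iso C (g \<cdot> f)" "iv (g \<cdot> f) = iv f \<cdot> iv g" by simp_all
qed

lemma iso_cancel_left:
  assumes "iso C h" "f \<in> arr C" "g \<in> arr C" "tgt C f = src C h" "tgt C g = src C h" "h \<cdot> f = h \<cdot> g"
  shows "f = g"
proof -
  have "iv h \<cdot> h \<cdot> f = f" "iv h \<cdot> h \<cdot> g = g" using assms(1-5) by simp_all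
  then show ?thesis using assms(6) by metis
qed

lemma iso_cancel_right:
  assumes "iso C h" "f \<in> arr C" "g \<in> arr C" "src C f = tgt C h" "src C g = tgt C h" "f \<cdot> h = g \<cdot> h"
  shows "f = g"
proof -
  have "(f \<cdot> h) \<cdot> iv h = f" "(g \<cdot> h) \<cdot> iv h = g"
    using assms(1-5) iso_arr[OF assms(1)] by simp_all
  then show ?thesis using assms(6) by metis
qed

text \<open>
  Naturality of a family of isomorphisms gives naturality of the inverses; used for every inverse
  constraint.
\<close>

lemma iso_square_flip:
  assumes "iso C a" "iso C b" "f \<in> arr C" "g \<in> arr C"
    and "src C f = src C a" "tgt C f = src C b" "src C g = tgt C a" "tgt C g = tgt C b"
    and "b \<cdot> f = g \<cdot> a"
  shows "iv b \<cdot> g = f \<cdot> iv a"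
proof (rule iso_cancel_right[OF assms(1)])
  have ar: "a \<in> arr C" "b \<in> arr C" using assms(1,2)[THEN iso_arr] by auto
  show "iv b \<cdot> g \<in> arr C" "f \<cdot> iv a \<in> arr C" "src C (iv b \<cdot> g) = tgt C a" "src C (f \<cdot> iv a) = tgt C a"
    using assms(1-8) ar by simp_all
  have "(iv b \<cdot> g) \<cdot> a = iv b \<cdot> g \<cdot> a" "(f \<cdot> iv a) \<cdot> a = f"
    using assms(1-8) ar by simp_all
  moreover have "iv b \<cdot> b \<cdot> f = f" using assms(1-8) by simp
  ultimately show "(iv b \<cdot> g) \<cdot> a = (f \<cdot> iv a) \<cdot> a" by (simp only: assms(9))
qed

end

context symmetric_monoidal_category
begin

lemma obj_simps [simp]: "\<one> \<in> obj C" "\<lbrakk>X \<in> obj C; Y \<in> obj C\<rbrakk> \<Longrightarrow> X \<boxtimes> Y \<in> obj C"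
  by (simp_all add: unit_obj tensor_obj)

lemma tensor_arr [simp]:
  assumes "f \<in> arr C" "g \<in> arr C"
  shows "f \<otimes> g \<in> arr C" "src C (f \<otimes> g) = src C f \<boxtimes> src C g" "tgt C (f \<otimes> g) = tgt C f \<boxtimes> tgt C g"
  using tensor_hom[of f "src C f" "tgt C f" g "src C g" "tgt C g"] assms by (simp_all add: hom_iff)

lemma tensor_id' [simp]: "\<lbrakk>X \<in> obj C; Y \<in> obj C\<rbrakk> \<Longrightarrow> \<i>\<d> X \<otimes> \<i>\<d> Y = \<i>\<d> (X \<boxtimes> Y)"
  by (rule tensor_id)

lemma tensor_cmp':
  "\<lbrakk>f \<in> arr C; g \<in> arr C; src C g = tgt C f; f' \<in> arr C; g' \<in> arr C; src C g' = tgt C f'\<rbrakk>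
   \<Longrightarrow> (g \<otimes> g') \<cdot> (f \<otimes> f') = (g \<cdot> f) \<otimes> (g' \<cdot> f')"
  by (rule tensor_cmp[symmetric]) (auto simp: hom_iff)

lemma tensor_cmp'':
  assumes "f \<in> arr C" "g \<in> arr C" "src C g = tgt C f" "f' \<in> arr C" "g' \<in> arr C" "src C g' = tgt C f'"
    "k \<in> arr C" "tgt C k = src C f \<boxtimes> src C f'"
  shows "(g \<otimes> g') \<cdot> (f \<otimes> f') \<cdot> k = ((g \<cdot> f) \<otimes> (g' \<cdot> f')) \<cdot> k"
  using assms cmp_assoc'[of k "f \<otimes> f'" "g \<otimes> g'"] by (simp add: tensor_cmp')

lemma assoc_arr [simp]:
  assumes "X \<in> obj C" "Y \<in> obj C" "Z \<in> obj C"
  shows "\<alpha> X Y Z \<in> arr C" "src C (\<alpha> X Y Z) = (X \<boxtimes> Y) \<boxtimes> Z" "tgt C (\<alpha> X Y Z) = X \<boxtimes> (Y \<boxtimes> Z)"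
    "iso C (\<alpha> X Y Z)"
  using assoc_hom[OF assms] by (simp_all add: hom_iff)

lemma unitor_arr [simp]:
  assumes "X \<in> obj C"
  shows "\<ll> X \<in> arr C" "src C (\<ll> X) = \<one> \<boxtimes> X" "tgt C (\<ll> X) = X" "iso C (\<ll> X)"
    "\<rr> X \<in> arr C" "src C (\<rr> X) = X \<boxtimes> \<one>" "tgt C (\<rr> X) = X" "iso C (\<rr> X)"
  using lunit_hom[OF assms] runit_hom[OF assms] by (simp_all add: hom_iff)

lemma braid_arr [simp]:
  assumes "X \<in> obj C" "Y \<in> obj C"
  shows "\<tau> X Y \<in> arr C" "src C (\<tau> X Y) = X \<boxtimes> Y" "tgt C (\<tau> X Y) = Y \<boxtimes> X"
  using braid_hom[OF assms] by (simp_all add: hom_iff)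

lemma braid_iso [simp]:
  assumes "X \<in> obj C" "Y \<in> obj C"
  shows "iso C (\<tau> X Y)" "iv (\<tau> X Y) = \<tau> Y X"
  using isoI[of "\<tau> X Y" "\<tau> Y X"] assms by (simp_all add: braid_symmetric)

lemma iso_tensor [simp]:
  assumes "iso C f" "iso C g"
  shows "iso C (f \<otimes> g)" "iv (f \<otimes> g) = iv f \<otimes> iv g"
proof -
  note ar = assms[THEN iso_arr]
  have "iso C (f \<otimes> g) \<and> iv (f \<otimes> g) = iv f \<otimes> iv g"
    by (rule isoI) (use assms ar in \<open>simp_all add: tensor_cmp'\<close>)
  then show "iso C (f \<otimes> g)" "iv (f \<otimes> g) = iv f \<otimes> iv g" by simp_all
qed

lemma assoc_natural':
  "\<lbrakk>f \<in> arr C; g \<in> arr C; h \<in> arr C; tgt C f = X; tgt C g = Y; tgt C h = Z\<rbrakk>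
   \<Longrightarrow> \<alpha> X Y Z \<cdot> ((f \<otimes> g) \<otimes> h) = (f \<otimes> (g \<otimes> h)) \<cdot> \<alpha> (src C f) (src C g) (src C h)"
  by (rule assoc_natural) (auto simp: hom_iff)

lemma assoc_natural'':
  assumes "f \<in> arr C" "g \<in> arr C" "h \<in> arr C" "tgt C f = X" "tgt C g = Y" "tgt C h = Z"
    "k \<in> arr C" "tgt C k = (src C f \<boxtimes> src C g) \<boxtimes> src C h"
  shows "\<alpha> X Y Z \<cdot> ((f \<otimes> g) \<otimes> h) \<cdot> k = (f \<otimes> (g \<otimes> h)) \<cdot> \<alpha> (src C f) (src C g) (src C h) \<cdot> k"
  by (rule cmp_square) (use assms in \<open>auto simp: assoc_natural'\<close>)

lemma braid_natural':
  "\<lbrakk>f \<in> arr C; g \<in> arr C; tgt C f = X; tgt C g = Y\<rbrakk>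
   \<Longrightarrow> \<tau> X Y \<cdot> (f \<otimes> g) = (g \<otimes> f) \<cdot> \<tau> (src C f) (src C g)"
  by (rule braid_natural) (auto simp: hom_iff)

lemma braid_natural'':
  assumes "f \<in> arr C" "g \<in> arr C" "tgt C f = X" "tgt C g = Y" "k \<in> arr C" "tgt C k = src C f \<boxtimes> src C g"
  shows "\<tau> X Y \<cdot> (f \<otimes> g) \<cdot> k = (g \<otimes> f) \<cdot> \<tau> (src C f) (src C g) \<cdot> k"
  by (rule cmp_square) (use assms in \<open>auto simp: braid_natural'\<close>)

lemma lunit_natural': "\<lbrakk>f \<in> arr C; tgt C f = X\<rbrakk> \<Longrightarrow> \<ll> X \<cdot> (\<i>\<d> \<one> \<otimes> f) = f \<cdot> \<ll> (src C f)"
  and runit_natural': "\<lbrakk>f \<in> arr C; tgt C f = X\<rbrakk> \<Longrightarrow> \<rr> X \<cdot> (f \<otimes> \<i>\<d> \<one>) = f \<cdot> \<rr> (src C f)"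
  by (auto intro!: lunit_natural runit_natural simp: hom_iff)

lemma assoc_inv_natural:
  assumes "f \<in> arr C" "g \<in> arr C" "h \<in> arr C" "tgt C f = X" "tgt C g = Y" "tgt C h = Z"
  shows "iv (\<alpha> X Y Z) \<cdot> (f \<otimes> (g \<otimes> h)) = ((f \<otimes> g) \<otimes> h) \<cdot> iv (\<alpha> (src C f) (src C g) (src C h))"
  by (rule iso_square_flip) (use assms in \<open>auto simp: assoc_natural'\<close>)

lemma assoc_inv_natural':
  assumes "f \<in> arr C" "g \<in> arr C" "h \<in> arr C" "tgt C f = X" "tgt C g = Y" "tgt C h = Z"
    "k \<in> arr C" "tgt C k = src C f \<boxtimes> (src C g \<boxtimes> src C h)"
  shows "iv (\<alpha> X Y Z) \<cdot> (f \<otimes> (g \<otimes> h)) \<cdot> k = ((f \<otimes> g) \<otimes> h) \<cdot> iv (\<alpha> (src C f) (src C g) (src C h)) \<cdot> k"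
  by (rule cmp_square) (use assms in \<open>auto simp: assoc_inv_natural\<close>)

lemma lunit_natural'':
  assumes "f \<in> arr C" "tgt C f = X" "k \<in> arr C" "tgt C k = \<one> \<boxtimes> src C f"
  shows "\<ll> X \<cdot> (\<i>\<d> \<one> \<otimes> f) \<cdot> k = f \<cdot> \<ll> (src C f) \<cdot> k"
  by (rule cmp_square) (use assms in \<open>auto simp: lunit_natural'\<close>)

lemma runit_natural'':
  assumes "f \<in> arr C" "tgt C f = X" "k \<in> arr C" "tgt C k = src C f \<boxtimes> \<one>"
  shows "\<rr> X \<cdot> (f \<otimes> \<i>\<d> \<one>) \<cdot> k = f \<cdot> \<rr> (src C f) \<cdot> k"
  by (rule cmp_square) (use assms in \<open>auto simp: runit_natural'\<close>)

lemma lunit_inv_natural: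
  assumes "f \<in> arr C" "tgt C f = X"
  shows "iv (\<ll> X) \<cdot> f = (\<i>\<d> \<one> \<otimes> f) \<cdot> iv (\<ll> (src C f))"
  by (rule iso_square_flip) (use assms in \<open>auto simp: lunit_natural'\<close>)

lemma runit_inv_natural:
  assumes "f \<in> arr C" "tgt C f = X"
  shows "iv (\<rr> X) \<cdot> f = (f \<otimes> \<i>\<d> \<one>) \<cdot> iv (\<rr> (src C f))"
  by (rule iso_square_flip) (use assms in \<open>auto simp: runit_natural'\<close>)

end

section \<open>Coherence for symmetric monoidal categories\<close>

context symmetric_monoidal_category
begin

text \<open>
  Conjugating \<open>\<one> \<otimes> f\<close> by the left unitor gives back \<open>f\<close>.
\<close>

lemma unit_tensor_faithful:
  assumes "f \<in> arr C" "g \<in> arr C" "src C f = src C g" "tgt C f = tgt C g"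
  shows "\<i>\<d> \<one> \<otimes> f = \<i>\<d> \<one> \<otimes> g \<Longrightarrow> f = g"
    and "f \<otimes> \<i>\<d> \<one> = g \<otimes> \<i>\<d> \<one> \<Longrightarrow> f = g"
proof -
  show "f = g" if "\<i>\<d> \<one> \<otimes> f = \<i>\<d> \<one> \<otimes> g"
  proof (rule iso_cancel_right[of "\<ll> (src C f)"])
    show "f \<cdot> \<ll> (src C f) = g \<cdot> \<ll> (src C f)"
      using lunit_natural'[of f "tgt C f"] lunit_natural'[of g "tgt C f"] assms that by metis
  qed (use assms in auto)
  show "f = g" if "f \<otimes> \<i>\<d> \<one> = g \<otimes> \<i>\<d> \<one>"
  proof (rule iso_cancel_right[of "\<rr> (src C f)"])
    show "f \<cdot> \<rr> (src C f) = g \<cdot> \<rr> (src C f)"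
      using runit_natural'[of f "tgt C f"] runit_natural'[of g "tgt C f"] assms that by metis
  qed (use assms in auto)
qed

lemma pentagon':
  assumes "W \<in> obj C" "X \<in> obj C" "Y \<in> obj C" "Z \<in> obj C" "k \<in> arr C" "tgt C k = ((W \<boxtimes> X) \<boxtimes> Y) \<boxtimes> Z"
  shows "\<alpha> W X (Y \<boxtimes> Z) \<cdot> \<alpha> (W \<boxtimes> X) Y Z \<cdot> k
    = (\<i>\<d> W \<otimes> \<alpha> X Y Z) \<cdot> \<alpha> W (X \<boxtimes> Y) Z \<cdot> (\<alpha> W X Y \<otimes> \<i>\<d> Z) \<cdot> k"
  using cmp_square[OF pentagon, of W X Y Z k] assms by simp

text \<open>
  Kelly's redundancy of the unit axioms: after tensoring with the unit, the claim becomes the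
  pentagon for \<open>\<one>, \<one>, X, Y\<close> with two of its sides rewritten by the
  triangle.
\<close>

lemma lunit_tensor:
  assumes "X \<in> obj C" "Y \<in> obj C"
  shows "\<ll> (X \<boxtimes> Y) \<cdot> \<alpha> \<one> X Y = \<ll> X \<otimes> \<i>\<d> Y"
proof (rule unit_tensor_faithful(1))
  let ?p = "\<alpha> \<one> (\<one> \<boxtimes> X) Y \<cdot> (\<alpha> \<one> \<one> X \<otimes> \<i>\<d> Y)"
  show "\<i>\<d> \<one> \<otimes> (\<ll> (X \<boxtimes> Y) \<cdot> \<alpha> \<one> X Y) = \<i>\<d> \<one> \<otimes> (\<ll> X \<otimes> \<i>\<d> Y)"
  proof (rule iso_cancel_right[of ?p])
    have "(\<i>\<d> \<one> \<otimes> (\<ll> (X \<boxtimes> Y) \<cdot> \<alpha> \<one> X Y)) \<cdot> ?p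
        = (\<i>\<d> \<one> \<otimes> \<ll> (X \<boxtimes> Y)) \<cdot> (\<i>\<d> \<one> \<otimes> \<alpha> \<one> X Y) \<cdot> ?p"
      using assms by (simp add: tensor_cmp'')
    also have "\<dots> = (\<i>\<d> \<one> \<otimes> \<ll> (X \<boxtimes> Y)) \<cdot> \<alpha> \<one> \<one> (X \<boxtimes> Y) \<cdot> \<alpha> (\<one> \<boxtimes> \<one>) X Y"
      using assms by (simp add: pentagon)
    also have "\<dots> = (\<rr> \<one> \<otimes> \<i>\<d> (X \<boxtimes> Y)) \<cdot> \<alpha> (\<one> \<boxtimes> \<one>) X Y"
      using assms by (subst triangle[symmetric]) simp_all
    also have "\<dots> = \<alpha> \<one> X Y \<cdot> ((\<rr> \<one> \<otimes> \<i>\<d> X) \<otimes> \<i>\<d> Y)"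
      using assms by (simp add: assoc_natural')
    also have "\<dots> = \<alpha> \<one> X Y \<cdot> ((\<i>\<d> \<one> \<otimes> \<ll> X) \<otimes> \<i>\<d> Y) \<cdot> (\<alpha> \<one> \<one> X \<otimes> \<i>\<d> Y)"
      using assms by (subst triangle[symmetric]) (simp_all add: tensor_cmp')
    also have "\<dots> = (\<i>\<d> \<one> \<otimes> (\<ll> X \<otimes> \<i>\<d> Y)) \<cdot> ?p"
      using assms by (simp add: assoc_natural'')
    finally show "(\<i>\<d> \<one> \<otimes> (\<ll> (X \<boxtimes> Y) \<cdot> \<alpha> \<one> X Y)) \<cdot> ?p = (\<i>\<d> \<one> \<otimes> (\<ll> X \<otimes> \<i>\<d> Y)) \<cdot> ?p" .
  qed (use assms in simp_all)
qed (use assms in simp_all)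

lemma runit_tensor:
  assumes "X \<in> obj C" "Y \<in> obj C"
  shows "\<rr> (X \<boxtimes> Y) = (\<i>\<d> X \<otimes> \<rr> Y) \<cdot> \<alpha> X Y \<one>"
proof (rule unit_tensor_faithful(2))
  show "\<rr> (X \<boxtimes> Y) \<otimes> \<i>\<d> \<one> = ((\<i>\<d> X \<otimes> \<rr> Y) \<cdot> \<alpha> X Y \<one>) \<otimes> \<i>\<d> \<one>"
  proof (rule iso_cancel_left[of "\<alpha> X Y \<one>"])
    have "\<alpha> X Y \<one> \<cdot> (\<rr> (X \<boxtimes> Y) \<otimes> \<i>\<d> \<one>)
        = \<alpha> X Y \<one> \<cdot> (\<i>\<d> (X \<boxtimes> Y) \<otimes> \<ll> \<one>) \<cdot> \<alpha> (X \<boxtimes> Y) \<one> \<one>"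
      using assms by (simp add: triangle)
    also have "\<dots> = (\<i>\<d> X \<otimes> (\<i>\<d> Y \<otimes> \<ll> \<one>)) \<cdot> \<alpha> X Y (\<one> \<boxtimes> \<one>) \<cdot> \<alpha> (X \<boxtimes> Y) \<one> \<one>"
      using assms assoc_natural''[of "\<i>\<d> X" "\<i>\<d> Y" "\<ll> \<one>" X Y \<one> "\<alpha> (X \<boxtimes> Y) \<one> \<one>"] by simp
    also have "\<dots> = (\<i>\<d> X \<otimes> (\<i>\<d> Y \<otimes> \<ll> \<one>)) \<cdot> (\<i>\<d> X \<otimes> \<alpha> Y \<one> \<one>) \<cdot> \<alpha> X (Y \<boxtimes> \<one>) \<one> \<cdot> (\<alpha> X Y \<one> \<otimes> \<i>\<d> \<one>)"
      using assms by (simp add: pentagon)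
    also have "\<dots> = (\<i>\<d> X \<otimes> (\<rr> Y \<otimes> \<i>\<d> \<one>)) \<cdot> \<alpha> X (Y \<boxtimes> \<one>) \<one> \<cdot> (\<alpha> X Y \<one> \<otimes> \<i>\<d> \<one>)"
      using assms by (simp add: tensor_cmp'' triangle)
    also have "\<dots> = \<alpha> X Y \<one> \<cdot> ((\<i>\<d> X \<otimes> \<rr> Y) \<otimes> \<i>\<d> \<one>) \<cdot> (\<alpha> X Y \<one> \<otimes> \<i>\<d> \<one>)"
      using assms by (simp add: assoc_natural'')
    also have "\<dots> = \<alpha> X Y \<one> \<cdot> (((\<i>\<d> X \<otimes> \<rr> Y) \<cdot> \<alpha> X Y \<one>) \<otimes> \<i>\<d> \<one>)"
      using assms by (simp add: tensor_cmp')
    finally show "\<alpha> X Y \<one> \<cdot> (\<rr> (X \<boxtimes> Y) \<otimes> \<i>\<d> \<one>) = \<alpha> X Y \<one> \<cdot> (((\<i>\<d> X \<otimes> \<rr> Y) \<cdot> \<alpha> X Y \<one>) \<otimes> \<i>\<d> \<one>)" .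
  qed (use assms in simp_all)
qed (use assms in simp_all)

lemma unitors_agree: "\<ll> \<one> = \<rr> \<one>"
proof (rule unit_tensor_faithful(2))
  have "\<ll> (\<one> \<boxtimes> \<one>) = \<i>\<d> \<one> \<otimes> \<ll> \<one>"
    by (rule iso_cancel_left[of "\<ll> \<one>"]) (simp_all add: lunit_natural')
  then show "\<ll> \<one> \<otimes> \<i>\<d> \<one> = \<rr> \<one> \<otimes> \<i>\<d> \<one>"
    using lunit_tensor[of \<one> \<one>] triangle[of \<one> \<one>] by simp
qed simp_all

lemma braid_unit_unit: "\<tau> \<one> \<one> = \<i>\<d> (\<one> \<boxtimes> \<one>)"
  by (rule iso_cancel_left[of "\<ll> \<one>"]) (use braid_unit[of \<one>] unitors_agree in simp_all)

lemma runit_braid: "X \<in> obj C \<Longrightarrow> \<rr> X \<cdot> \<tau> \<one> X = \<ll> X"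
  by (simp add: braid_unit[symmetric] braid_symmetric)

text \<open>
  The transposition of the first two factors of a right-nested product.
\<close>

definition swap :: "'o \<Rightarrow> 'o \<Rightarrow> 'o \<Rightarrow> 'a" where
  "swap X N Y = \<alpha> N X Y \<cdot> (\<tau> X N \<otimes> \<i>\<d> Y) \<cdot> iv (\<alpha> X N Y)"

lemma swap_arr [simp]:
  assumes "X \<in> obj C" "N \<in> obj C" "Y \<in> obj C"
  shows "swap X N Y \<in> arr C" "src C (swap X N Y) = X \<boxtimes> (N \<boxtimes> Y)" "tgt C (swap X N Y) = N \<boxtimes> (X \<boxtimes> Y)"
    "iso C (swap X N Y)"
  using assms by (simp_all add: swap_def)

lemma swap_assoc:
  assumes "X \<in> obj C" "N \<in> obj C" "Y \<in> obj C"
  shows "swap X N Y \<cdot> \<alpha> X N Y = \<alpha> N X Y \<cdot> (\<tau> X N \<otimes> \<i>\<d> Y)"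
  using assms by (simp add: swap_def)

lemma swap_natural:
  assumes "f \<in> arr C" "g \<in> arr C" "h \<in> arr C" "tgt C f = X" "tgt C g = N" "tgt C h = Y"
  shows "swap X N Y \<cdot> (f \<otimes> (g \<otimes> h)) = (g \<otimes> (f \<otimes> h)) \<cdot> swap (src C f) (src C g) (src C h)"
proof -
  have "(\<tau> X N \<cdot> (f \<otimes> g)) \<otimes> (\<i>\<d> Y \<cdot> h) = ((g \<otimes> f) \<cdot> \<tau> (src C f) (src C g)) \<otimes> (h \<cdot> \<i>\<d> (src C h))"
    using assms by (auto simp: braid_natural')
  moreover have "X \<in> obj C" "N \<in> obj C" "Y \<in> obj C" using assms by auto
  ultimately have "(\<tau> X N \<otimes> \<i>\<d> Y) \<cdot> ((f \<otimes> g) \<otimes> h)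
      = ((g \<otimes> f) \<otimes> h) \<cdot> (\<tau> (src C f) (src C g) \<otimes> \<i>\<d> (src C h))"
    using assms by (simp add: tensor_cmp')
  then have "(\<tau> X N \<otimes> \<i>\<d> Y) \<cdot> ((f \<otimes> g) \<otimes> h) \<cdot> iv (\<alpha> (src C f) (src C g) (src C h))
      = ((g \<otimes> f) \<otimes> h) \<cdot> (\<tau> (src C f) (src C g) \<otimes> \<i>\<d> (src C h)) \<cdot> iv (\<alpha> (src C f) (src C g) (src C h))"
    using assms by (intro cmp_square) auto
  then show ?thesis
    using assms \<open>X \<in> obj C\<close> \<open>N \<in> obj C\<close> \<open>Y \<in> obj C\<close>
    by (simp add: swap_def assoc_inv_natural assoc_natural'')
qed

lemma swap_natural':
  assumes "f \<in> arr C" "g \<in> arr C" "h \<in> arr C" "tgt C f = X" "tgt C g = N" "tgt C h = Y"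
    "k \<in> arr C" "tgt C k = src C f \<boxtimes> (src C g \<boxtimes> src C h)"
  shows "swap X N Y \<cdot> (f \<otimes> (g \<otimes> h)) \<cdot> k = (g \<otimes> (f \<otimes> h)) \<cdot> swap (src C f) (src C g) (src C h) \<cdot> k"
  by (rule cmp_square) (use assms in \<open>auto simp: swap_natural\<close>)

text \<open>
  This and \<open>swap_assoc_right\<close>, \<open>swap_braid\<close>, \<open>swap_unit\<close>
  say that moving the factor \<open>N\<close> to the front commutes with each constraint acting on
  the remaining factors; they are the cases of the naturality proof for \<open>pull\<close>. Here
  the identity is precomposed with \<open>\<alpha> X N Y \<otimes> \<i>\<d> Z\<close>, which turns
  it into two pentagons.
\<close>

lemma swap_assoc_left:
  assumes "X \<in> obj C" "N \<in> obj C" "Y \<in> obj C" "Z \<in> obj C"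
  shows "swap X N (Y \<boxtimes> Z) \<cdot> (\<i>\<d> X \<otimes> \<alpha> N Y Z) \<cdot> \<alpha> X (N \<boxtimes> Y) Z
    = (\<i>\<d> N \<otimes> \<alpha> X Y Z) \<cdot> \<alpha> N (X \<boxtimes> Y) Z \<cdot> (swap X N Y \<otimes> \<i>\<d> Z)"
proof (rule iso_cancel_right[of "\<alpha> X N Y \<otimes> \<i>\<d> Z"])
  have "(swap X N (Y \<boxtimes> Z) \<cdot> (\<i>\<d> X \<otimes> \<alpha> N Y Z) \<cdot> \<alpha> X (N \<boxtimes> Y) Z) \<cdot> (\<alpha> X N Y \<otimes> \<i>\<d> Z)
      = swap X N (Y \<boxtimes> Z) \<cdot> \<alpha> X N (Y \<boxtimes> Z) \<cdot> \<alpha> (X \<boxtimes> N) Y Z"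
    using assms by (simp add: pentagon)
  also have "\<dots> = \<alpha> N X (Y \<boxtimes> Z) \<cdot> (\<tau> X N \<otimes> \<i>\<d> (Y \<boxtimes> Z)) \<cdot> \<alpha> (X \<boxtimes> N) Y Z"
    using assms by (simp add: swap_def)
  also have "\<dots> = \<alpha> N X (Y \<boxtimes> Z) \<cdot> \<alpha> (N \<boxtimes> X) Y Z \<cdot> ((\<tau> X N \<otimes> \<i>\<d> Y) \<otimes> \<i>\<d> Z)"
    using assms by (simp add: assoc_natural')
  also have "\<dots> = (\<i>\<d> N \<otimes> \<alpha> X Y Z) \<cdot> \<alpha> N (X \<boxtimes> Y) Z \<cdot> (\<alpha> N X Y \<otimes> \<i>\<d> Z) \<cdot> ((\<tau> X N \<otimes> \<i>\<d> Y) \<otimes> \<i>\<d> Z)"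
    using assms by (simp add: pentagon')
  also have "\<dots> = ((\<i>\<d> N \<otimes> \<alpha> X Y Z) \<cdot> \<alpha> N (X \<boxtimes> Y) Z \<cdot> (swap X N Y \<otimes> \<i>\<d> Z)) \<cdot> (\<alpha> X N Y \<otimes> \<i>\<d> Z)"
    using assms by (simp add: tensor_cmp' swap_assoc)
  finally show "(swap X N (Y \<boxtimes> Z) \<cdot> (\<i>\<d> X \<otimes> \<alpha> N Y Z) \<cdot> \<alpha> X (N \<boxtimes> Y) Z) \<cdot> (\<alpha> X N Y \<otimes> \<i>\<d> Z)
      = ((\<i>\<d> N \<otimes> \<alpha> X Y Z) \<cdot> \<alpha> N (X \<boxtimes> Y) Z \<cdot> (swap X N Y \<otimes> \<i>\<d> Z)) \<cdot> (\<alpha> X N Y \<otimes> \<i>\<d> Z)" .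
qed (use assms in simp_all)

lemma braid_tensor_right:
  assumes "N \<in> obj C" "X \<in> obj C" "Y \<in> obj C"
  shows "\<alpha> N Y X \<cdot> \<tau> X (N \<boxtimes> Y) = (\<i>\<d> N \<otimes> \<tau> X Y) \<cdot> swap X N Y"
proof (rule iso_cancel_right[of "\<alpha> X N Y"])
  show "(\<alpha> N Y X \<cdot> \<tau> X (N \<boxtimes> Y)) \<cdot> \<alpha> X N Y = ((\<i>\<d> N \<otimes> \<tau> X Y) \<cdot> swap X N Y) \<cdot> \<alpha> X N Y"
    using assms by (simp add: hexagon swap_assoc)
qed (use assms in simp_all)

lemma swap_braid:
  assumes "N \<in> obj C" "X \<in> obj C" "Y \<in> obj C"
  shows "swap X N Y \<cdot> \<tau> (N \<boxtimes> Y) X = (\<i>\<d> N \<otimes> \<tau> Y X) \<cdot> \<alpha> N Y X"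
proof (rule iso_cancel_left[of "\<i>\<d> N \<otimes> \<tau> X Y"])
  have "(\<i>\<d> N \<otimes> \<tau> X Y) \<cdot> swap X N Y \<cdot> \<tau> (N \<boxtimes> Y) X = \<alpha> N Y X \<cdot> \<tau> X (N \<boxtimes> Y) \<cdot> \<tau> (N \<boxtimes> Y) X"
    using cmp_square[OF braid_tensor_right[symmetric], of N X Y "\<tau> (N \<boxtimes> Y) X"] assms by simp
  also have "\<dots> = (\<i>\<d> N \<otimes> \<tau> X Y) \<cdot> (\<i>\<d> N \<otimes> \<tau> Y X) \<cdot> \<alpha> N Y X"
    using assms by (simp add: tensor_cmp'' braid_symmetric)
  finally show "(\<i>\<d> N \<otimes> \<tau> X Y) \<cdot> swap X N Y \<cdot> \<tau> (N \<boxtimes> Y) X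
      = (\<i>\<d> N \<otimes> \<tau> X Y) \<cdot> (\<i>\<d> N \<otimes> \<tau> Y X) \<cdot> \<alpha> N Y X" .
qed (use assms in simp_all)

text \<open>
  The hexagon for \<open>\<tau> (X \<boxtimes> Y) N\<close> is the inverse of the one for
  \<open>\<tau> N (X \<boxtimes> Y)\<close>, because the braiding is symmetric.
\<close>

lemma braid_tensor_left:
  assumes "N \<in> obj C" "X \<in> obj C" "Y \<in> obj C"
  shows "swap X N Y \<cdot> (\<i>\<d> X \<otimes> \<tau> Y N) \<cdot> \<alpha> X Y N = \<tau> (X \<boxtimes> Y) N"
proof -
  have h: "\<alpha> X Y N \<cdot> \<tau> N (X \<boxtimes> Y) = (\<i>\<d> X \<otimes> \<tau> N Y) \<cdot> swap N X Y"
    by (rule braid_tensor_right) (use assms in simp_all)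
  have sw: "swap X N Y \<cdot> swap N X Y = \<i>\<d> (N \<boxtimes> (X \<boxtimes> Y))"
    using assms by (simp add: swap_def tensor_cmp'' braid_symmetric)
  show ?thesis
  proof (rule iso_cancel_right[of "\<tau> N (X \<boxtimes> Y)"])
    have "(swap X N Y \<cdot> (\<i>\<d> X \<otimes> \<tau> Y N) \<cdot> \<alpha> X Y N) \<cdot> \<tau> N (X \<boxtimes> Y)
        = swap X N Y \<cdot> (\<i>\<d> X \<otimes> \<tau> Y N) \<cdot> (\<i>\<d> X \<otimes> \<tau> N Y) \<cdot> swap N X Y"
      using assms by (simp add: h)
    also have "\<dots> = \<tau> (X \<boxtimes> Y) N \<cdot> \<tau> N (X \<boxtimes> Y)"
      using assms by (simp add: tensor_cmp'' braid_symmetric sw)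
    finally show "(swap X N Y \<cdot> (\<i>\<d> X \<otimes> \<tau> Y N) \<cdot> \<alpha> X Y N) \<cdot> \<tau> N (X \<boxtimes> Y)
        = \<tau> (X \<boxtimes> Y) N \<cdot> \<tau> N (X \<boxtimes> Y)" .
  qed (use assms in simp_all)
qed

lemma swap_assoc_right:
  assumes "X \<in> obj C" "N \<in> obj C" "Y \<in> obj C" "Z \<in> obj C"
  shows "swap X N (Y \<boxtimes> Z) \<cdot> (\<i>\<d> X \<otimes> swap Y N Z) \<cdot> \<alpha> X Y (N \<boxtimes> Z)
    = (\<i>\<d> N \<otimes> \<alpha> X Y Z) \<cdot> swap (X \<boxtimes> Y) N Z"
proof (rule iso_cancel_right[of "\<alpha> (X \<boxtimes> Y) N Z"])
  have "(swap X N (Y \<boxtimes> Z) \<cdot> (\<i>\<d> X \<otimes> swap Y N Z) \<cdot> \<alpha> X Y (N \<boxtimes> Z)) \<cdot> \<alpha> (X \<boxtimes> Y) N Z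
      = swap X N (Y \<boxtimes> Z) \<cdot> (\<i>\<d> X \<otimes> (swap Y N Z \<cdot> \<alpha> Y N Z)) \<cdot> \<alpha> X (Y \<boxtimes> N) Z \<cdot> (\<alpha> X Y N \<otimes> \<i>\<d> Z)"
    using assms by (simp add: pentagon tensor_cmp'')
  also have "\<dots> = swap X N (Y \<boxtimes> Z) \<cdot> (\<i>\<d> X \<otimes> \<alpha> N Y Z) \<cdot> (\<i>\<d> X \<otimes> (\<tau> Y N \<otimes> \<i>\<d> Z)) \<cdot> \<alpha> X (Y \<boxtimes> N) Z \<cdot> (\<alpha> X Y N \<otimes> \<i>\<d> Z)"
    using assms by (simp add: swap_assoc tensor_cmp'')
  also have "\<dots> = (swap X N (Y \<boxtimes> Z) \<cdot> (\<i>\<d> X \<otimes> \<alpha> N Y Z) \<cdot> \<alpha> X (N \<boxtimes> Y) Z) \<cdot> ((\<i>\<d> X \<otimes> \<tau> Y N) \<otimes> \<i>\<d> Z) \<cdot> (\<alpha> X Y N \<otimes> \<i>\<d> Z)"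
    using assms by (simp add: assoc_natural'')
  also have "\<dots> = (\<i>\<d> N \<otimes> \<alpha> X Y Z) \<cdot> \<alpha> N (X \<boxtimes> Y) Z \<cdot> (swap X N Y \<otimes> \<i>\<d> Z) \<cdot> ((\<i>\<d> X \<otimes> \<tau> Y N) \<otimes> \<i>\<d> Z) \<cdot> (\<alpha> X Y N \<otimes> \<i>\<d> Z)"
    using assms by (simp only: swap_assoc_left) simp
  also have "\<dots> = (\<i>\<d> N \<otimes> \<alpha> X Y Z) \<cdot> \<alpha> N (X \<boxtimes> Y) Z \<cdot> (\<tau> (X \<boxtimes> Y) N \<otimes> \<i>\<d> Z)"
    using assms by (simp add: tensor_cmp' braid_tensor_left)
  also have "\<dots> = ((\<i>\<d> N \<otimes> \<alpha> X Y Z) \<cdot> swap (X \<boxtimes> Y) N Z) \<cdot> \<alpha> (X \<boxtimes> Y) N Z"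
    using assms by (simp add: swap_assoc)
  finally show "(swap X N (Y \<boxtimes> Z) \<cdot> (\<i>\<d> X \<otimes> swap Y N Z) \<cdot> \<alpha> X Y (N \<boxtimes> Z)) \<cdot> \<alpha> (X \<boxtimes> Y) N Z
      = ((\<i>\<d> N \<otimes> \<alpha> X Y Z) \<cdot> swap (X \<boxtimes> Y) N Z) \<cdot> \<alpha> (X \<boxtimes> Y) N Z" .
qed (use assms in simp_all)

lemma swap_unit:
  assumes "N \<in> obj C" "X \<in> obj C"
  shows "(\<i>\<d> N \<otimes> \<ll> X) \<cdot> swap \<one> N X = \<ll> (N \<boxtimes> X)"
proof (rule iso_cancel_right[of "\<alpha> \<one> N X"])
  have "((\<i>\<d> N \<otimes> \<ll> X) \<cdot> swap \<one> N X) \<cdot> \<alpha> \<one> N X = ((\<i>\<d> N \<otimes> \<ll> X) \<cdot> \<alpha> N \<one> X) \<cdot> (\<tau> \<one> N \<otimes> \<i>\<d> X)"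
    using assms by (simp add: swap_assoc)
  also have "\<dots> = \<ll> (N \<boxtimes> X) \<cdot> \<alpha> \<one> N X"
    using assms by (simp only: triangle) (simp add: tensor_cmp' runit_braid lunit_tensor)
  finally show "((\<i>\<d> N \<otimes> \<ll> X) \<cdot> swap \<one> N X) \<cdot> \<alpha> \<one> N X = \<ll> (N \<boxtimes> X) \<cdot> \<alpha> \<one> N X" .
qed (use assms in simp_all)

end

text \<open>
  Formal tensor words in variables, and formal canonical morphisms between them. The inverse is a
  constructor for arbitrary terms, so that flipping a square settles naturality for the inverses
  of all constraints at once.
\<close>

datatype cword = U | V nat | T cword cword

datatype cterm =
    Idt cword | Cmp cterm cterm | Tns cterm cterm | Al cword cword cword
  | La cword | Rh cword | Br cword cword | Inv cterm

fun cdom :: "cterm \<Rightarrow> cword" and ccod :: "cterm \<Rightarrow> cword" where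
  "cdom (Idt w) = w"
| "cdom (Cmp t s) = cdom s"
| "cdom (Tns s t) = T (cdom s) (cdom t)"
| "cdom (Al x y z) = T (T x y) z"
| "cdom (La x) = T U x"
| "cdom (Rh x) = T x U"
| "cdom (Br x y) = T x y"
| "cdom (Inv t) = ccod t"
| "ccod (Idt w) = w"
| "ccod (Cmp t s) = ccod t"
| "ccod (Tns s t) = T (ccod s) (ccod t)"
| "ccod (Al x y z) = T x (T y z)"
| "ccod (La x) = x"
| "ccod (Rh x) = x"
| "ccod (Br x y) = T y x"
| "ccod (Inv t) = cdom t"

fun well_typed :: "cterm \<Rightarrow> bool" where
  "well_typed (Cmp t s) \<longleftrightarrow> well_typed t \<and> well_typed s \<and> cdom t = ccod s"
| "well_typed (Tns s t) \<longleftrightarrow> well_typed s \<and> well_typed t"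
| "well_typed (Inv t) \<longleftrightarrow> well_typed t"
| "well_typed t \<longleftrightarrow> True"

fun letters :: "cword \<Rightarrow> nat list" where
  "letters U = []"
| "letters (V n) = [n]"
| "letters (T x y) = letters x @ letters y"

text \<open>
  Erasing a letter keeps the shape of the word and puts the unit in its place, so that a formal
  morphism stays one of the same shape.
\<close>

fun erase :: "nat \<Rightarrow> cword \<Rightarrow> cword" where
  "erase n U = U"
| "erase n (V m) = (if m = n then U else V m)"
| "erase n (T x y) = T (erase n x) (erase n y)"

fun erase_term :: "nat \<Rightarrow> cterm \<Rightarrow> cterm" where
  "erase_term n (Idt w) = Idt (erase n w)"
| "erase_term n (Cmp t s) = Cmp (erase_term n t) (erase_term n s)"
| "erase_term n (Tns s t) = Tns (erase_term n s) (erase_term n t)"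
| "erase_term n (Al x y z) = Al (erase n x) (erase n y) (erase n z)"
| "erase_term n (La x) = La (erase n x)"
| "erase_term n (Rh x) = Rh (erase n x)"
| "erase_term n (Br x y) = Br (erase n x) (erase n y)"
| "erase_term n (Inv t) = Inv (erase_term n t)"

lemma erase_absent: "n \<notin> set (letters w) \<Longrightarrow> erase n w = w"
  by (induction w) auto

lemma letters_erase: "letters (erase n w) = filter (\<lambda>m. m \<noteq> n) (letters w)"
  by (induction w) auto

lemma erase_term_type [simp]:
  "cdom (erase_term n t) = erase n (cdom t)" "ccod (erase_term n t) = erase n (ccod t)"
  by (induction t) auto

lemma well_typed_erase [simp]: "well_typed t \<Longrightarrow> well_typed (erase_term n t)"
  by (induction t) auto

lemma letters_preserved:
  assumes "well_typed t"
  shows "set (letters (ccod t)) = set (letters (cdom t))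
    \<and> distinct (letters (ccod t)) = distinct (letters (cdom t))"
  using assms by (induction t) auto

lemma erase_term_absent:
  assumes "well_typed t" "n \<notin> set (letters (cdom t))"
  shows "erase_term n t = t"
  using assms by (induction t) (auto simp: erase_absent letters_preserved)

context symmetric_monoidal_category
begin

fun word_obj :: "(nat \<Rightarrow> 'o) \<Rightarrow> cword \<Rightarrow> 'o" where
  "word_obj v U = \<one>"
| "word_obj v (V n) = v n"
| "word_obj v (T x y) = word_obj v x \<boxtimes> word_obj v y"

fun term_arr :: "(nat \<Rightarrow> 'o) \<Rightarrow> cterm \<Rightarrow> 'a" where
  "term_arr v (Idt w) = \<i>\<d> (word_obj v w)"
| "term_arr v (Cmp t s) = term_arr v t \<cdot> term_arr v s"
| "term_arr v (Tns s t) = term_arr v s \<otimes> term_arr v t"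
| "term_arr v (Al x y z) = \<alpha> (word_obj v x) (word_obj v y) (word_obj v z)"
| "term_arr v (La x) = \<ll> (word_obj v x)"
| "term_arr v (Rh x) = \<rr> (word_obj v x)"
| "term_arr v (Br x y) = \<tau> (word_obj v x) (word_obj v y)"
| "term_arr v (Inv t) = iv (term_arr v t)"

lemma word_obj_obj [simp]: "range v \<subseteq> obj C \<Longrightarrow> word_obj v w \<in> obj C"
  by (induction w) auto

lemma term_arr_arr:
  assumes "range v \<subseteq> obj C" "well_typed t"
  shows "iso C (term_arr v t) \<and> term_arr v t \<in> arr C \<and>
    src C (term_arr v t) = word_obj v (cdom t) \<and> tgt C (term_arr v t) = word_obj v (ccod t)"
  using assms(2) by (induction t) (use assms(1) in auto)

lemma term_arr_simps [simp]:
  assumes "range v \<subseteq> obj C" "well_typed t"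
  shows "iso C (term_arr v t)" "term_arr v t \<in> arr C"
    "src C (term_arr v t) = word_obj v (cdom t)" "tgt C (term_arr v t) = word_obj v (ccod t)"
  using term_arr_arr[OF assms] by auto

text \<open>
  The canonical isomorphism from a word to \<open>n \<otimes> w'\<close>, where \<open>w'\<close>
  is the word with \<open>n\<close> erased. The value on \<open>U\<close> is a dummy: the map is
  used only for words that contain \<open>n\<close>.
\<close>

fun pull :: "(nat \<Rightarrow> 'o) \<Rightarrow> nat \<Rightarrow> cword \<Rightarrow> 'a" where
  "pull v n U = \<i>\<d> \<one>"
| "pull v n (V m) = iv (\<rr> (v m))"
| "pull v n (T x y) =
     (if n \<in> set (letters x)
      then \<alpha> (v n) (word_obj v (erase n x)) (word_obj v y) \<cdot> (pull v n x \<otimes> \<i>\<d> (word_obj v y))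
      else swap (word_obj v x) (v n) (word_obj v (erase n y)) \<cdot> (\<i>\<d> (word_obj v x) \<otimes> pull v n y))"

lemma v_obj [simp]: "range v \<subseteq> obj C \<Longrightarrow> v n \<in> obj C"
  by auto

lemma pull_arr:
  assumes "range v \<subseteq> obj C" "distinct (letters w)" "n \<in> set (letters w)"
  shows "iso C (pull v n w) \<and> pull v n w \<in> arr C \<and> src C (pull v n w) = word_obj v w
    \<and> tgt C (pull v n w) = v n \<boxtimes> word_obj v (erase n w)"
  using assms(2,3) by (induction w) (use assms(1) in \<open>auto simp: erase_absent disjoint_iff\<close>)

lemma pull_simps [simp]:
  assumes "range v \<subseteq> obj C" "distinct (letters w)" "n \<in> set (letters w)"
  shows "iso C (pull v n w)" "pull v n w \<in> arr C" "src C (pull v n w) = word_obj v w"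
    "tgt C (pull v n w) = v n \<boxtimes> word_obj v (erase n w)"
  using pull_arr[OF assms] by auto

text \<open>
  Erasing the letter from a canonical morphism and applying it behind the extracted letter is the
  same as applying the morphism first. Each constraint is a case distinction on the factor in
  which the letter occurs; the letter occurs in one factor only, so erasing it leaves the others
  alone.
\<close>

lemma pull_natural:
  assumes v: "range v \<subseteq> obj C"
    and "well_typed t" "distinct (letters (cdom t))" "n \<in> set (letters (cdom t))"
  shows "pull v n (ccod t) \<cdot> term_arr v t
    = (\<i>\<d> (v n) \<otimes> term_arr v (erase_term n t)) \<cdot> pull v n (cdom t)"
  using assms(2-)
proof (induction t)
  case (Idt w)
  then show ?case using v by simp
next
  case (Cmp t s)
  let ?e = "\<lambda>t. term_arr v (erase_term n t)"
  have s: "well_typed s" "well_typed t" "cdom t = ccod s" using Cmp.prems by auto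
  have d: "distinct (letters (ccod s))" "n \<in> set (letters (ccod s))"
    using letters_preserved[OF s(1)] Cmp.prems by auto
  have d': "distinct (letters (ccod t))" "n \<in> set (letters (ccod t))"
    using letters_preserved[OF s(2)] s d by auto
  have "pull v n (ccod t) \<cdot> term_arr v t \<cdot> term_arr v s
      = (\<i>\<d> (v n) \<otimes> ?e t) \<cdot> pull v n (ccod s) \<cdot> term_arr v s"
    using cmp_square[OF Cmp.IH(1), of "term_arr v s"] s d d' Cmp.prems v by simp
  also have "\<dots> = (\<i>\<d> (v n) \<otimes> ?e t) \<cdot> (\<i>\<d> (v n) \<otimes> ?e s) \<cdot> pull v n (cdom s)"
    using Cmp.IH(2) s Cmp.prems by simp
  also have "\<dots> = (\<i>\<d> (v n) \<otimes> (?e t \<cdot> ?e s)) \<cdot> pull v n (cdom s)"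
    using s Cmp.prems v by (simp add: tensor_cmp'')
  finally show ?case by simp
next
  case (Tns s t)
  let ?e = "\<lambda>t. term_arr v (erase_term n t)"
  have wt: "well_typed s" "well_typed t" using Tns.prems by auto
  note p = letters_preserved[OF wt(1)] letters_preserved[OF wt(2)]
  show ?case
  proof (cases "n \<in> set (letters (cdom s))")
    case True
    then have n: "n \<notin> set (letters (cdom t))" "n \<notin> set (letters (ccod t))" "n \<in> set (letters (ccod s))"
      "distinct (letters (ccod s))" "distinct (letters (cdom s))"
      using Tns.prems p by auto
    have IH: "pull v n (ccod s) \<cdot> term_arr v s = (\<i>\<d> (v n) \<otimes> ?e s) \<cdot> pull v n (cdom s)"
      using Tns.IH(1) wt True n by simp
    have "pull v n (ccod (Tns s t)) \<cdot> term_arr v (Tns s t)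
        = \<alpha> (v n) (word_obj v (erase n (ccod s))) (word_obj v (ccod t))
            \<cdot> ((pull v n (ccod s) \<cdot> term_arr v s) \<otimes> term_arr v t)"
      using v wt n by (simp add: tensor_cmp')
    also have "\<dots> = \<alpha> (v n) (word_obj v (erase n (ccod s))) (word_obj v (ccod t))
            \<cdot> (((\<i>\<d> (v n) \<otimes> ?e s) \<otimes> term_arr v t) \<cdot> (pull v n (cdom s) \<otimes> \<i>\<d> (word_obj v (cdom t))))"
      using v wt n True by (simp add: IH tensor_cmp')
    also have "\<dots> = (\<i>\<d> (v n) \<otimes> ?e (Tns s t)) \<cdot> pull v n (cdom (Tns s t))"
      using v wt n True by (simp add: assoc_natural'' erase_term_absent erase_absent)
    finally show ?thesis .
  next
    case False
    then have n: "n \<in> set (letters (cdom t))" "n \<in> set (letters (ccod t))" "n \<notin> set (letters (ccod s))"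
      "distinct (letters (ccod t))" "distinct (letters (cdom t))"
      using Tns.prems p by auto
    have IH: "pull v n (ccod t) \<cdot> term_arr v t = (\<i>\<d> (v n) \<otimes> ?e t) \<cdot> pull v n (cdom t)"
      using Tns.IH(2) wt n by simp
    have "pull v n (ccod (Tns s t)) \<cdot> term_arr v (Tns s t)
        = swap (word_obj v (ccod s)) (v n) (word_obj v (erase n (ccod t)))
            \<cdot> (term_arr v s \<otimes> (pull v n (ccod t) \<cdot> term_arr v t))"
      using v wt n by (simp add: tensor_cmp')
    also have "\<dots> = swap (word_obj v (ccod s)) (v n) (word_obj v (erase n (ccod t)))
            \<cdot> ((term_arr v s \<otimes> (\<i>\<d> (v n) \<otimes> ?e t)) \<cdot> (\<i>\<d> (word_obj v (cdom s)) \<otimes> pull v n (cdom t)))"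
      using v wt n False by (simp add: IH tensor_cmp')
    also have "\<dots> = (\<i>\<d> (v n) \<otimes> ?e (Tns s t)) \<cdot> pull v n (cdom (Tns s t))"
      using v wt n False by (simp add: swap_natural' erase_term_absent erase_absent)
    finally show ?thesis .
  qed
next
  case (Al x y z)
  let ?w = "word_obj v" and ?p = "pull v n"
  consider (x) "n \<in> set (letters x)" "n \<notin> set (letters y)" "n \<notin> set (letters z)"
    | (y) "n \<notin> set (letters x)" "n \<in> set (letters y)" "n \<notin> set (letters z)"
    | (z) "n \<notin> set (letters x)" "n \<notin> set (letters y)" "n \<in> set (letters z)"
    using Al.prems by auto
  then show ?case
  proof cases
    case x
    let ?x = "?w (erase n x)"
    have "\<alpha> (v n) ?x (?w y \<boxtimes> ?w z) \<cdot> (?p x \<otimes> \<i>\<d> (?w y \<boxtimes> ?w z)) \<cdot> \<alpha> (?w x) (?w y) (?w z)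
        = \<alpha> (v n) ?x (?w y \<boxtimes> ?w z) \<cdot> \<alpha> (v n \<boxtimes> ?x) (?w y) (?w z) \<cdot> ((?p x \<otimes> \<i>\<d> (?w y)) \<otimes> \<i>\<d> (?w z))"
      using v x Al.prems by (simp add: assoc_natural')
    also have "\<dots> = (\<i>\<d> (v n) \<otimes> \<alpha> ?x (?w y) (?w z)) \<cdot> \<alpha> (v n) (?x \<boxtimes> ?w y) (?w z)
        \<cdot> (\<alpha> (v n) ?x (?w y) \<otimes> \<i>\<d> (?w z)) \<cdot> ((?p x \<otimes> \<i>\<d> (?w y)) \<otimes> \<i>\<d> (?w z))"
      using v x Al.prems by (simp add: pentagon')
    finally show ?thesis
      using v x Al.prems by (simp add: tensor_cmp' erase_absent)
  next
    case y
    let ?y = "?w (erase n y)"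
    have "swap (?w x) (v n) (?y \<boxtimes> ?w z) \<cdot> (\<i>\<d> (?w x) \<otimes> (\<alpha> (v n) ?y (?w z) \<cdot> (?p y \<otimes> \<i>\<d> (?w z))))
          \<cdot> \<alpha> (?w x) (?w y) (?w z)
        = swap (?w x) (v n) (?y \<boxtimes> ?w z) \<cdot> (\<i>\<d> (?w x) \<otimes> \<alpha> (v n) ?y (?w z))
          \<cdot> (\<i>\<d> (?w x) \<otimes> (?p y \<otimes> \<i>\<d> (?w z))) \<cdot> \<alpha> (?w x) (?w y) (?w z)"
      using v y Al.prems by (simp add: tensor_cmp'')
    also have "\<dots> = (swap (?w x) (v n) (?y \<boxtimes> ?w z) \<cdot> (\<i>\<d> (?w x) \<otimes> \<alpha> (v n) ?y (?w z))
          \<cdot> \<alpha> (?w x) (v n \<boxtimes> ?y) (?w z)) \<cdot> ((\<i>\<d> (?w x) \<otimes> ?p y) \<otimes> \<i>\<d> (?w z))"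
      using v y Al.prems by (simp add: assoc_natural')
    also have "\<dots> = ((\<i>\<d> (v n) \<otimes> \<alpha> (?w x) ?y (?w z)) \<cdot> \<alpha> (v n) (?w x \<boxtimes> ?y) (?w z)
          \<cdot> (swap (?w x) (v n) ?y \<otimes> \<i>\<d> (?w z))) \<cdot> ((\<i>\<d> (?w x) \<otimes> ?p y) \<otimes> \<i>\<d> (?w z))"
      using v by (simp only: swap_assoc_left word_obj_obj v_obj)
    finally show ?thesis
      using v y Al.prems by (simp add: tensor_cmp' erase_absent)
  next
    case z
    let ?z = "?w (erase n z)"
    have "swap (?w x) (v n) (?w y \<boxtimes> ?z) \<cdot> (\<i>\<d> (?w x) \<otimes> (swap (?w y) (v n) ?z \<cdot> (\<i>\<d> (?w y) \<otimes> ?p z)))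
          \<cdot> \<alpha> (?w x) (?w y) (?w z)
        = swap (?w x) (v n) (?w y \<boxtimes> ?z) \<cdot> (\<i>\<d> (?w x) \<otimes> swap (?w y) (v n) ?z)
          \<cdot> (\<i>\<d> (?w x) \<otimes> (\<i>\<d> (?w y) \<otimes> ?p z)) \<cdot> \<alpha> (?w x) (?w y) (?w z)"
      using v z Al.prems by (simp add: tensor_cmp'')
    also have "\<dots> = (swap (?w x) (v n) (?w y \<boxtimes> ?z) \<cdot> (\<i>\<d> (?w x) \<otimes> swap (?w y) (v n) ?z)
          \<cdot> \<alpha> (?w x) (?w y) (v n \<boxtimes> ?z)) \<cdot> (\<i>\<d> (?w x \<boxtimes> ?w y) \<otimes> ?p z)"
      using v z Al.prems assoc_natural'[of "\<i>\<d> (?w x)" "\<i>\<d> (?w y)" "?p z" "?w x" "?w y" "v n \<boxtimes> ?z"]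
      by simp
    also have "\<dots> = ((\<i>\<d> (v n) \<otimes> \<alpha> (?w x) (?w y) ?z) \<cdot> swap (?w x \<boxtimes> ?w y) (v n) ?z)
          \<cdot> (\<i>\<d> (?w x \<boxtimes> ?w y) \<otimes> ?p z)"
      using v by (simp only: swap_assoc_right word_obj_obj v_obj)
    finally show ?thesis
      using v z Al.prems by (simp add: erase_absent)
  qed
next
  case (La x)
  let ?w = "word_obj v" and ?p = "pull v n"
  let ?x = "?w (erase n x)"
  have "?p x \<cdot> \<ll> (?w x) = \<ll> (v n \<boxtimes> ?x) \<cdot> (\<i>\<d> \<one> \<otimes> ?p x)"
    using v La.prems by (simp add: lunit_natural')
  also have "\<dots> = ((\<i>\<d> (v n) \<otimes> \<ll> ?x) \<cdot> swap \<one> (v n) ?x) \<cdot> (\<i>\<d> \<one> \<otimes> ?p x)"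
    using v by (simp only: swap_unit word_obj_obj v_obj)
  finally show ?case using v La.prems by simp
next
  case (Rh x)
  let ?w = "word_obj v" and ?p = "pull v n"
  let ?x = "?w (erase n x)"
  have "?p x \<cdot> \<rr> (?w x) = \<rr> (v n \<boxtimes> ?x) \<cdot> (?p x \<otimes> \<i>\<d> \<one>)"
    using v Rh.prems by (simp add: runit_natural')
  then show ?case using v Rh.prems by (simp add: runit_tensor)
next
  case (Br x y)
  let ?w = "word_obj v" and ?p = "pull v n"
  consider (x) "n \<in> set (letters x)" "n \<notin> set (letters y)"
    | (y) "n \<notin> set (letters x)" "n \<in> set (letters y)"
    using Br.prems by auto
  then show ?case
  proof cases
    case x
    let ?x = "?w (erase n x)"
    have "swap (?w y) (v n) ?x \<cdot> (\<i>\<d> (?w y) \<otimes> ?p x) \<cdot> \<tau> (?w x) (?w y)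
        = (swap (?w y) (v n) ?x \<cdot> \<tau> (v n \<boxtimes> ?x) (?w y)) \<cdot> (?p x \<otimes> \<i>\<d> (?w y))"
      using v x Br.prems by (simp add: braid_natural')
    also have "\<dots> = ((\<i>\<d> (v n) \<otimes> \<tau> ?x (?w y)) \<cdot> \<alpha> (v n) ?x (?w y)) \<cdot> (?p x \<otimes> \<i>\<d> (?w y))"
      using v by (simp only: swap_braid word_obj_obj v_obj)
    finally show ?thesis using v x Br.prems by (simp add: erase_absent)
  next
    case y
    let ?y = "?w (erase n y)"
    have "\<alpha> (v n) ?y (?w x) \<cdot> (?p y \<otimes> \<i>\<d> (?w x)) \<cdot> \<tau> (?w x) (?w y)
        = (\<alpha> (v n) ?y (?w x) \<cdot> \<tau> (?w x) (v n \<boxtimes> ?y)) \<cdot> (\<i>\<d> (?w x) \<otimes> ?p y)"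
      using v y Br.prems by (simp add: braid_natural')
    also have "\<dots> = ((\<i>\<d> (v n) \<otimes> \<tau> (?w x) ?y) \<cdot> swap (?w x) (v n) ?y) \<cdot> (\<i>\<d> (?w x) \<otimes> ?p y)"
      using v by (simp only: braid_tensor_right word_obj_obj v_obj)
    finally show ?thesis using v y Br.prems by (simp add: erase_absent)
  qed
next
  case (Inv t)
  have wt: "well_typed t" using Inv.prems by auto
  have d: "distinct (letters (cdom t))" "n \<in> set (letters (cdom t))"
    "distinct (letters (ccod t))" "n \<in> set (letters (ccod t))"
    using letters_preserved[OF wt] Inv.prems by auto
  let ?e = "\<i>\<d> (v n) \<otimes> term_arr v (erase_term n t)"
  have "iv ?e \<cdot> pull v n (ccod t) = pull v n (cdom t) \<cdot> iv (term_arr v t)"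
    by (rule iso_square_flip) (use v wt d Inv.IH in simp_all)
  then show ?case using v wt by simp
qed

text \<open>
  The canonical isomorphism from a word without letters to the unit; the value at a letter is a
  dummy.
\<close>

fun collapse :: "(nat \<Rightarrow> 'o) \<Rightarrow> cword \<Rightarrow> 'a" where
  "collapse v U = \<i>\<d> \<one>"
| "collapse v (V m) = \<i>\<d> (v m)"
| "collapse v (T x y) = \<ll> \<one> \<cdot> (collapse v x \<otimes> collapse v y)"

lemma collapse_arr [simp]:
  assumes "letters w = []"
  shows "iso C (collapse v w)" "collapse v w \<in> arr C" "src C (collapse v w) = word_obj v w"
    "tgt C (collapse v w) = \<one>" "word_obj v w \<in> obj C"
proof -
  have "iso C (collapse v w) \<and> collapse v w \<in> arr C \<and> src C (collapse v w) = word_obj v w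
    \<and> tgt C (collapse v w) = \<one> \<and> word_obj v w \<in> obj C"
    using assms by (induction w) auto
  then show "iso C (collapse v w)" "collapse v w \<in> arr C" "src C (collapse v w) = word_obj v w"
    "tgt C (collapse v w) = \<one>" "word_obj v w \<in> obj C" by auto
qed

lemma collapse_natural:
  assumes v: "range v \<subseteq> obj C" and "well_typed t" "letters (cdom t) = []"
  shows "collapse v (ccod t) \<cdot> term_arr v t = collapse v (cdom t)"
  using assms(2-)
proof (induction t)
  case (Idt w)
  then show ?case by simp
next
  case (Cmp t s)
  have s: "well_typed s" "well_typed t" "cdom t = ccod s" "letters (cdom s) = []" using Cmp.prems by auto
  have d: "letters (ccod s) = []" "letters (ccod t) = []"
    using letters_preserved[OF s(1)] letters_preserved[OF s(2)] s by auto
  have "collapse v (ccod t) \<cdot> term_arr v t \<cdot> term_arr v s = (collapse v (ccod t) \<cdot> term_arr v t) \<cdot> term_arr v s"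
    using s d v by simp
  then show ?case using Cmp.IH s d by simp
next
  case (Tns s t)
  have s: "well_typed s" "well_typed t" "letters (cdom s) = []" "letters (cdom t) = []" using Tns.prems by auto
  have d: "letters (ccod s) = []" "letters (ccod t) = []"
    using letters_preserved[OF s(1)] letters_preserved[OF s(2)] s by auto
  show ?case using Tns.IH s d v by (simp add: tensor_cmp')
next
  case (Al x y z)
  then have l: "letters x = []" "letters y = []" "letters z = []" by auto
  let ?c = "collapse v"
  have "\<ll> \<one> \<cdot> (?c x \<otimes> (\<ll> \<one> \<cdot> (?c y \<otimes> ?c z))) \<cdot> \<alpha> (word_obj v x) (word_obj v y) (word_obj v z)
      = \<ll> \<one> \<cdot> (\<i>\<d> \<one> \<otimes> \<ll> \<one>) \<cdot> (?c x \<otimes> (?c y \<otimes> ?c z)) \<cdot> \<alpha> (word_obj v x) (word_obj v y) (word_obj v z)"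
    using l by (simp add: tensor_cmp'')
  also have "\<dots> = \<ll> \<one> \<cdot> ((\<i>\<d> \<one> \<otimes> \<ll> \<one>) \<cdot> \<alpha> \<one> \<one> \<one>) \<cdot> ((?c x \<otimes> ?c y) \<otimes> ?c z)"
    using l by (simp add: assoc_natural')
  also have "\<dots> = \<ll> \<one> \<cdot> (\<ll> \<one> \<otimes> \<i>\<d> \<one>) \<cdot> ((?c x \<otimes> ?c y) \<otimes> ?c z)"
    using triangle[of \<one> \<one>] by (simp only: unit_obj unitors_agree)
  also have "\<dots> = \<ll> \<one> \<cdot> ((\<ll> \<one> \<cdot> (?c x \<otimes> ?c y)) \<otimes> ?c z)"
    using l by (simp add: tensor_cmp')
  finally show ?case using l by simp
next
  case (La x)
  then have l: "letters x = []" by simp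
  show ?case using l lunit_natural'[of "collapse v x" \<one>] by simp
next
  case (Rh x)
  then have l: "letters x = []" by simp
  show ?case using l runit_natural'[of "collapse v x" \<one>] by (simp add: unitors_agree)
next
  case (Br x y)
  then have l: "letters x = []" "letters y = []" by auto
  show ?case
    using l braid_natural'[of "collapse v x" "collapse v y" \<one> \<one>] by (simp add: braid_unit_unit)
next
  case (Inv t)
  have wt: "well_typed t" using Inv.prems by auto
  have d: "letters (ccod t) = []" "letters (cdom t) = []"
    using letters_preserved[OF wt] Inv.prems by auto
  have e: "collapse v (ccod t) \<cdot> term_arr v t = collapse v (cdom t)"
    using Inv.IH wt d by simp
  have "collapse v (cdom t) \<cdot> iv (term_arr v t)
      = (collapse v (ccod t) \<cdot> term_arr v t) \<cdot> iv (term_arr v t)"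
    by (simp only: e)
  also have "\<dots> = collapse v (ccod t)" using d v wt by simp
  finally show ?case by simp
qed

text \<open>
  Letters are pulled out until none is left. Both morphisms then end in the same isomorphism to
  the unit. Words with repeated letters are excluded, as \<open>\<tau>\<close> and the identity
  may differ on \<open>X \<otimes> X\<close>; the valuation, however, may send different letters
  to the same object.
\<close>

theorem coherence:
  assumes v: "range v \<subseteq> obj C"
    and "well_typed s" "well_typed t" "cdom s = cdom t" "ccod s = ccod t" "distinct (letters (cdom s))"
  shows "term_arr v s = term_arr v t"
  using assms(2-)
proof (induction "length (letters (cdom s))" arbitrary: s t rule: less_induct)
  case less
  note st = less.prems
  note p = letters_preserved[OF st(1)] letters_preserved[OF st(2)]
  show ?case
  proof (cases "letters (cdom s)")
    case Nil
    show ?thesis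
    proof (rule iso_cancel_left[of "collapse v (ccod s)"])
      show "collapse v (ccod s) \<cdot> term_arr v s = collapse v (ccod s) \<cdot> term_arr v t"
        using collapse_natural[OF v, of s] collapse_natural[OF v, of t] st Nil by simp
    qed (use v st Nil p in simp_all)
  next
    case (Cons n ns)
    then have n: "n \<in> set (letters (cdom s))" by simp
    have "length (letters (cdom (erase_term n s))) < length (letters (cdom s))"
      using n by (simp add: letters_erase length_filter_less)
    then have IH: "term_arr v (erase_term n s) = term_arr v (erase_term n t)"
      by (rule less.hyps) (use st in \<open>simp_all add: letters_erase\<close>)
    show ?thesis
    proof (rule iso_cancel_left[of "pull v n (ccod s)"])
      show "pull v n (ccod s) \<cdot> term_arr v s = pull v n (ccod s) \<cdot> term_arr v t"
        using pull_natural[OF v, of s n] pull_natural[OF v, of t n] st n IH by simp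
    qed (use v st n p in simp_all)
  qed
qed

end

section \<open>The middle-four interchange\<close>

definition interchange_term :: "cword \<Rightarrow> cword \<Rightarrow> cword \<Rightarrow> cword \<Rightarrow> cterm" where
  "interchange_term w x y z =
     Cmp (Inv (Al w y (T x z)))
       (Cmp (Tns (Idt w) (Cmp (Al y x z) (Cmp (Tns (Br x y) (Idt z)) (Inv (Al x y z)))))
         (Al w x (T y z)))"

lemma interchange_term_type [simp]:
  "cdom (interchange_term w x y z) = T (T w x) (T y z)"
  "ccod (interchange_term w x y z) = T (T w y) (T x z)"
  "well_typed (interchange_term w x y z)"
  by (simp_all add: interchange_term_def)

context symmetric_monoidal_category
begin

lemma term_arr_interchange [simp]:
  "term_arr v (interchange_term w x y z)
   = interchange C (word_obj v w) (word_obj v x) (word_obj v y) (word_obj v z)"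
  by (simp add: interchange_term_def interchange_def)

text \<open>
  The default value for letters beyond the list has to be some object; the unit is at hand.
\<close>

fun valuation :: "'o list \<Rightarrow> nat \<Rightarrow> 'o" where
  "valuation [] i = \<one>"
| "valuation (X # Xs) 0 = X"
| "valuation (X # Xs) (Suc i) = valuation Xs i"

lemma valuation_numeral [simp]: "valuation (X # Xs) (numeral k) = valuation Xs (pred_numeral k)"
  by (simp add: numeral_eq_Suc)

lemma valuation_obj: "set Xs \<subseteq> obj C \<Longrightarrow> range (valuation Xs) \<subseteq> obj C"
proof -
  have "valuation Xs i \<in> obj C" if "set Xs \<subseteq> obj C" for i
    using that by (induction Xs i rule: valuation.induct) auto
  then show "set Xs \<subseteq> obj C \<Longrightarrow> range (valuation Xs) \<subseteq> obj C" by auto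
qed

lemma coherence_at:
  assumes "set Xs \<subseteq> obj C" "well_typed s" "well_typed t" "cdom s = cdom t" "ccod s = ccod t"
    "distinct (letters (cdom s))"
  shows "term_arr (valuation Xs) s = term_arr (valuation Xs) t"
  using coherence[OF valuation_obj] assms by blast

lemma interchange_arr [simp]:
  assumes "W \<in> obj C" "X \<in> obj C" "Y \<in> obj C" "Z \<in> obj C"
  shows "interchange C W X Y Z \<in> arr C" "src C (interchange C W X Y Z) = (W \<boxtimes> X) \<boxtimes> (Y \<boxtimes> Z)"
    "tgt C (interchange C W X Y Z) = (W \<boxtimes> Y) \<boxtimes> (X \<boxtimes> Z)" "iso C (interchange C W X Y Z)"
  using assms by (simp_all add: interchange_def)

lemma interchange_inverse [simp]:
  assumes "W \<in> obj C" "X \<in> obj C" "Y \<in> obj C" "Z \<in> obj C"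
  shows "iv (interchange C W X Y Z) = interchange C W Y X Z"
  using coherence_at[of "[W, X, Y, Z]" "Inv (interchange_term (V 0) (V 1) (V 2) (V 3))"
      "interchange_term (V 0) (V 2) (V 1) (V 3)"] assms by simp

text \<open>
  The coherence theorem speaks of constraints only; naturality in arbitrary arrows comes from that
  of \<open>swap\<close> and \<open>\<alpha>\<close>.
\<close>

lemma interchange_natural:
  assumes "f \<in> arr C" "g \<in> arr C" "h \<in> arr C" "k \<in> arr C"
    "tgt C f = W" "tgt C g = X" "tgt C h = Y" "tgt C k = Z"
  shows "interchange C W X Y Z \<cdot> ((f \<otimes> g) \<otimes> (h \<otimes> k))
    = ((f \<otimes> h) \<otimes> (g \<otimes> k)) \<cdot> interchange C (src C f) (src C g) (src C h) (src C k)"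
proof -
  have o: "W \<in> obj C" "X \<in> obj C" "Y \<in> obj C" "Z \<in> obj C" using assms by auto
  have i: "interchange C W X Y Z = iv (\<alpha> W Y (X \<boxtimes> Z)) \<cdot> (\<i>\<d> W \<otimes> swap X Y Z) \<cdot> \<alpha> W X (Y \<boxtimes> Z)" for W X Y Z
    by (simp add: interchange_def swap_def)
  have "interchange C W X Y Z \<cdot> ((f \<otimes> g) \<otimes> (h \<otimes> k))
      = iv (\<alpha> W Y (X \<boxtimes> Z)) \<cdot> (\<i>\<d> W \<otimes> swap X Y Z) \<cdot> (f \<otimes> (g \<otimes> (h \<otimes> k)))
        \<cdot> \<alpha> (src C f) (src C g) (src C h \<boxtimes> src C k)"
    using assms o by (simp add: i assoc_natural')
  also have "\<dots> = iv (\<alpha> W Y (X \<boxtimes> Z)) \<cdot> (f \<otimes> (h \<otimes> (g \<otimes> k)))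
        \<cdot> (\<i>\<d> (src C f) \<otimes> swap (src C g) (src C h) (src C k)) \<cdot> \<alpha> (src C f) (src C g) (src C h \<boxtimes> src C k)"
    using assms o by (simp add: tensor_cmp'' swap_natural)
  also have "\<dots> = ((f \<otimes> h) \<otimes> (g \<otimes> k)) \<cdot> interchange C (src C f) (src C g) (src C h) (src C k)"
    using assms o by (simp add: i assoc_inv_natural')
  finally show ?thesis .
qed

lemma interchange_natural':
  assumes "f \<in> arr C" "g \<in> arr C" "h \<in> arr C" "k \<in> arr C"
    "tgt C f = W" "tgt C g = X" "tgt C h = Y" "tgt C k = Z"
    "l \<in> arr C" "tgt C l = (src C f \<boxtimes> src C g) \<boxtimes> (src C h \<boxtimes> src C k)"
  shows "interchange C W X Y Z \<cdot> ((f \<otimes> g) \<otimes> (h \<otimes> k)) \<cdot> l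
    = ((f \<otimes> h) \<otimes> (g \<otimes> k)) \<cdot> interchange C (src C f) (src C g) (src C h) (src C k) \<cdot> l"
  by (rule cmp_square) (use assms in \<open>auto simp: interchange_natural\<close>)

text \<open>
  The identities from here on say that \<open>\<otimes> : C \<times> C \<rightarrow> C\<close>,
  with the interchange as its structure map, is a symmetric monoidal functor, and that the
  constraints of \<open>C\<close> are monoidal transformations between composites of
  \<open>\<otimes>\<close>. Each is the coherence theorem for the two displayed formal morphisms.
\<close>

lemma interchange_assoc:
  assumes "X \<in> obj C" "Y \<in> obj C" "Z \<in> obj C" "X' \<in> obj C" "Y' \<in> obj C" "Z' \<in> obj C"
  shows "(\<alpha> X Y Z \<otimes> \<alpha> X' Y' Z') \<cdot> interchange C (X \<boxtimes> Y) (X' \<boxtimes> Y') Z Z' \<cdot> (interchange C X X' Y Y' \<otimes> \<i>\<d> (Z \<boxtimes> Z'))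
    = interchange C X X' (Y \<boxtimes> Z) (Y' \<boxtimes> Z') \<cdot> (\<i>\<d> (X \<boxtimes> X') \<otimes> interchange C Y Y' Z Z') \<cdot> \<alpha> (X \<boxtimes> X') (Y \<boxtimes> Y') (Z \<boxtimes> Z')"
proof -
  let ?x = "V 0" and ?y = "V 1" and ?z = "V 2" and ?x' = "V 3" and ?y' = "V 4" and ?z' = "V 5"
  show ?thesis
    using coherence_at[of "[X, Y, Z, X', Y', Z']"
      "Cmp (Tns (Al ?x ?y ?z) (Al ?x' ?y' ?z')) (Cmp (interchange_term (T ?x ?y) (T ?x' ?y') ?z ?z')
         (Tns (interchange_term ?x ?x' ?y ?y') (Idt (T ?z ?z'))))"
      "Cmp (interchange_term ?x ?x' (T ?y ?z) (T ?y' ?z')) (Cmp (Tns (Idt (T ?x ?x')) (interchange_term ?y ?y' ?z ?z'))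
         (Al (T ?x ?x') (T ?y ?y') (T ?z ?z')))"] assms
    by simp
qed

lemma interchange_unit:
  assumes "X \<in> obj C" "X' \<in> obj C"
  shows "(\<ll> X \<otimes> \<ll> X') \<cdot> interchange C \<one> \<one> X X' \<cdot> (iv (\<ll> \<one>) \<otimes> \<i>\<d> (X \<boxtimes> X')) = \<ll> (X \<boxtimes> X')"
    and "(\<rr> X \<otimes> \<rr> X') \<cdot> interchange C X X' \<one> \<one> \<cdot> (\<i>\<d> (X \<boxtimes> X') \<otimes> iv (\<ll> \<one>)) = \<rr> (X \<boxtimes> X')"
    and "\<ll> (X \<boxtimes> X') \<cdot> (\<ll> \<one> \<otimes> \<i>\<d> (X \<boxtimes> X')) \<cdot> interchange C \<one> X \<one> X' = \<ll> X \<otimes> \<ll> X'"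
    and "\<rr> (X \<boxtimes> X') \<cdot> (\<i>\<d> (X \<boxtimes> X') \<otimes> \<ll> \<one>) \<cdot> interchange C X \<one> X' \<one> = \<rr> X \<otimes> \<rr> X'"
proof -
  let ?x = "V 0" and ?y = "V 1"
  show "(\<ll> X \<otimes> \<ll> X') \<cdot> interchange C \<one> \<one> X X' \<cdot> (iv (\<ll> \<one>) \<otimes> \<i>\<d> (X \<boxtimes> X')) = \<ll> (X \<boxtimes> X')"
    using coherence_at[of "[X, X']" "Cmp (Tns (La ?x) (La ?y)) (Cmp (interchange_term U U ?x ?y)
      (Tns (Inv (La U)) (Idt (T ?x ?y))))" "La (T ?x ?y)"] assms by simp
  show "(\<rr> X \<otimes> \<rr> X') \<cdot> interchange C X X' \<one> \<one> \<cdot> (\<i>\<d> (X \<boxtimes> X') \<otimes> iv (\<ll> \<one>)) = \<rr> (X \<boxtimes> X')"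
    using coherence_at[of "[X, X']" "Cmp (Tns (Rh ?x) (Rh ?y)) (Cmp (interchange_term ?x ?y U U)
      (Tns (Idt (T ?x ?y)) (Inv (La U))))" "Rh (T ?x ?y)"] assms by simp
  show "\<ll> (X \<boxtimes> X') \<cdot> (\<ll> \<one> \<otimes> \<i>\<d> (X \<boxtimes> X')) \<cdot> interchange C \<one> X \<one> X' = \<ll> X \<otimes> \<ll> X'"
    using coherence_at[of "[X, X']" "Cmp (La (T ?x ?y)) (Cmp (Tns (La U) (Idt (T ?x ?y)))
      (interchange_term U ?x U ?y))" "Tns (La ?x) (La ?y)"] assms by simp
  show "\<rr> (X \<boxtimes> X') \<cdot> (\<i>\<d> (X \<boxtimes> X') \<otimes> \<ll> \<one>) \<cdot> interchange C X \<one> X' \<one> = \<rr> X \<otimes> \<rr> X'"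
    using coherence_at[of "[X, X']" "Cmp (Rh (T ?x ?y)) (Cmp (Tns (Idt (T ?x ?y)) (La U))
      (interchange_term ?x U ?y U))" "Tns (Rh ?x) (Rh ?y)"] assms by simp
qed

lemma interchange_braid:
  assumes "X \<in> obj C" "X' \<in> obj C" "Y \<in> obj C" "Y' \<in> obj C"
  shows "interchange C Y Y' X X' \<cdot> \<tau> (X \<boxtimes> X') (Y \<boxtimes> Y') = (\<tau> X Y \<otimes> \<tau> X' Y') \<cdot> interchange C X X' Y Y'"
    and "\<tau> (X \<boxtimes> Y) (X' \<boxtimes> Y') \<cdot> interchange C X X' Y Y' = interchange C X' X Y' Y \<cdot> (\<tau> X X' \<otimes> \<tau> Y Y')"
proof -
  let ?x = "V 0" and ?x' = "V 1" and ?y = "V 2" and ?y' = "V 3"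
  show "interchange C Y Y' X X' \<cdot> \<tau> (X \<boxtimes> X') (Y \<boxtimes> Y') = (\<tau> X Y \<otimes> \<tau> X' Y') \<cdot> interchange C X X' Y Y'"
    using coherence_at[of "[X, X', Y, Y']" "Cmp (interchange_term ?y ?y' ?x ?x') (Br (T ?x ?x') (T ?y ?y'))"
      "Cmp (Tns (Br ?x ?y) (Br ?x' ?y')) (interchange_term ?x ?x' ?y ?y')"] assms by simp
  show "\<tau> (X \<boxtimes> Y) (X' \<boxtimes> Y') \<cdot> interchange C X X' Y Y' = interchange C X' X Y' Y \<cdot> (\<tau> X X' \<otimes> \<tau> Y Y')"
    using coherence_at[of "[X, X', Y, Y']" "Cmp (Br (T ?x ?y) (T ?x' ?y')) (interchange_term ?x ?x' ?y ?y')"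
      "Cmp (interchange_term ?x' ?x ?y' ?y) (Tns (Br ?x ?x') (Br ?y ?y'))"] assms by simp
qed

lemma assoc_interchange:
  assumes "X \<in> obj C" "Y \<in> obj C" "Z \<in> obj C" "X' \<in> obj C" "Y' \<in> obj C" "Z' \<in> obj C"
  shows "\<alpha> (X \<boxtimes> X') (Y \<boxtimes> Y') (Z \<boxtimes> Z') \<cdot> (interchange C X Y X' Y' \<otimes> \<i>\<d> (Z \<boxtimes> Z')) \<cdot> interchange C (X \<boxtimes> Y) Z (X' \<boxtimes> Y') Z'
    = (\<i>\<d> (X \<boxtimes> X') \<otimes> interchange C Y Z Y' Z') \<cdot> interchange C X (Y \<boxtimes> Z) X' (Y' \<boxtimes> Z') \<cdot> (\<alpha> X Y Z \<otimes> \<alpha> X' Y' Z')"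
proof -
  let ?x = "V 0" and ?y = "V 1" and ?z = "V 2" and ?x' = "V 3" and ?y' = "V 4" and ?z' = "V 5"
  show ?thesis
    using coherence_at[of "[X, Y, Z, X', Y', Z']"
      "Cmp (Al (T ?x ?x') (T ?y ?y') (T ?z ?z')) (Cmp (Tns (interchange_term ?x ?y ?x' ?y') (Idt (T ?z ?z')))
         (interchange_term (T ?x ?y) ?z (T ?x' ?y') ?z'))"
      "Cmp (Tns (Idt (T ?x ?x')) (interchange_term ?y ?z ?y' ?z')) (Cmp (interchange_term ?x (T ?y ?z) ?x' (T ?y' ?z'))
         (Tns (Al ?x ?y ?z) (Al ?x' ?y' ?z')))"] assms
    by simp
qed

lemma unit_coherence:
  "\<ll> \<one> \<cdot> (\<ll> \<one> \<otimes> \<i>\<d> \<one>) = \<ll> \<one> \<cdot> (\<i>\<d> \<one> \<otimes> \<ll> \<one>) \<cdot> \<alpha> \<one> \<one> \<one>"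
  "\<alpha> \<one> \<one> \<one> \<cdot> (iv (\<ll> \<one>) \<otimes> \<i>\<d> \<one>) \<cdot> iv (\<ll> \<one>) = (\<i>\<d> \<one> \<otimes> iv (\<ll> \<one>)) \<cdot> iv (\<ll> \<one>)"
  using coherence_at[of "[]" "Cmp (La U) (Tns (La U) (Idt U))" "Cmp (La U) (Cmp (Tns (Idt U) (La U)) (Al U U U))"]
    coherence_at[of "[]" "Cmp (Al U U U) (Cmp (Tns (Inv (La U)) (Idt U)) (Inv (La U)))"
      "Cmp (Tns (Idt U) (Inv (La U))) (Inv (La U))"]
  by simp_all

end

section \<open>Symmetric monoidal functors\<close>

context symmetric_monoidal_functor
begin

lemma functor_obj [simp]: "X \<in> obj D \<Longrightarrow> fobj F X \<in> obj C"
  by (rule fobj_obj)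

lemma functor_arr [simp]:
  assumes "f \<in> arr D"
  shows "farr F f \<in> arr C" "src C (farr F f) = fobj F (src D f)" "tgt C (farr F f) = fobj F (tgt D f)"
  using farr_hom[of f "src D f" "tgt D f"] assms by (simp_all add: hom_iff)

lemma functor_id [simp]: "X \<in> obj D \<Longrightarrow> farr F (\<i>\<d>\<^bsub>D\<^esub> X) = \<i>\<d>\<^bsub>C\<^esub> (fobj F X)"
  by (rule farr_id)

lemma functor_cmp:
  "\<lbrakk>f \<in> arr D; g \<in> arr D; src D g = tgt D f\<rbrakk> \<Longrightarrow> farr F (g \<cdot>\<^bsub>D\<^esub> f) = farr F g \<cdot>\<^bsub>C\<^esub> farr F f"
  by (rule farr_cmp) (auto simp: hom_iff)

lemma ften_arr [simp]:
  assumes "X \<in> obj D" "Y \<in> obj D"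
  shows "ften F X Y \<in> arr C" "src C (ften F X Y) = fobj F X \<boxtimes>\<^bsub>C\<^esub> fobj F Y"
    "tgt C (ften F X Y) = fobj F (X \<boxtimes>\<^bsub>D\<^esub> Y)" "iso C (ften F X Y)"
  using ften_hom[OF assms] by (simp_all add: hom_iff)

lemma funit_arr [simp]:
  "funit F \<in> arr C" "src C (funit F) = \<one>\<^bsub>C\<^esub>" "tgt C (funit F) = fobj F \<one>\<^bsub>D\<^esub>" "iso C (funit F)"
  using funit_hom by (simp_all add: hom_iff)

lemma ften_natural':
  assumes "f \<in> arr D" "g \<in> arr D"
  shows "ften F (tgt D f) (tgt D g) \<cdot>\<^bsub>C\<^esub> (farr F f \<otimes>\<^bsub>C\<^esub> farr F g)
    = farr F (f \<otimes>\<^bsub>D\<^esub> g) \<cdot>\<^bsub>C\<^esub> ften F (src D f) (src D g)"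
  by (rule ften_natural) (use assms in \<open>auto simp: hom_iff\<close>)

lemma functor_iso:
  assumes "iso D f"
  shows "iso C (farr F f)" "inverse_arrow C (farr F f) = farr F (inverse_arrow D f)"
proof -
  have f: "f \<in> arr D" by (rule D.iso_arr[OF assms])
  have "iso C (farr F f) \<and> inverse_arrow C (farr F f) = farr F (inverse_arrow D f)"
    by (rule C.isoI) (use f assms functor_cmp[of f "inverse_arrow D f"] functor_cmp[of "inverse_arrow D f" f] in simp_all)
  then show "iso C (farr F f)" "inverse_arrow C (farr F f) = farr F (inverse_arrow D f)" by simp_all
qed

end

context monoidal_transformation
begin

lemma component_arr [simp]:
  assumes "X \<in> obj D"
  shows "\<theta> X \<in> arr C" "src C (\<theta> X) = fobj F X" "tgt C (\<theta> X) = fobj G X"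
  using component_hom[OF assms] by (simp_all add: hom_iff)

lemma naturality':
  "f \<in> arr D \<Longrightarrow> \<theta> (tgt D f) \<cdot>\<^bsub>C\<^esub> farr F f = farr G f \<cdot>\<^bsub>C\<^esub> \<theta> (src D f)"
  by (rule naturality) (auto simp: hom_iff)

end

lemma symmetric_monoidal_functorI:
  assumes "symmetric_monoidal_category D" "symmetric_monoidal_category C"
    and "\<And>X. X \<in> obj D \<Longrightarrow> fobj F X \<in> obj C"
    and "\<And>f. f \<in> arr D \<Longrightarrow> farr F f \<in> arr C \<and> src C (farr F f) = fobj F (src D f)
           \<and> tgt C (farr F f) = fobj F (tgt D f)"
    and "\<And>X. X \<in> obj D \<Longrightarrow> farr F (\<i>\<d>\<^bsub>D\<^esub> X) = \<i>\<d>\<^bsub>C\<^esub> (fobj F X)"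
    and "\<And>f g. \<lbrakk>f \<in> arr D; g \<in> arr D; src D g = tgt D f\<rbrakk>
           \<Longrightarrow> farr F (g \<cdot>\<^bsub>D\<^esub> f) = farr F g \<cdot>\<^bsub>C\<^esub> farr F f"
    and "\<And>X Y. \<lbrakk>X \<in> obj D; Y \<in> obj D\<rbrakk> \<Longrightarrow> ften F X Y \<in> arr C \<and> src C (ften F X Y) = fobj F X \<boxtimes>\<^bsub>C\<^esub> fobj F Y
           \<and> tgt C (ften F X Y) = fobj F (X \<boxtimes>\<^bsub>D\<^esub> Y) \<and> iso C (ften F X Y)"
    and "funit F \<in> arr C \<and> src C (funit F) = \<one>\<^bsub>C\<^esub> \<and> tgt C (funit F) = fobj F \<one>\<^bsub>D\<^esub> \<and> iso C (funit F)"
    and "\<And>f g. \<lbrakk>f \<in> arr D; g \<in> arr D\<rbrakk> \<Longrightarrow>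
           ften F (tgt D f) (tgt D g) \<cdot>\<^bsub>C\<^esub> (farr F f \<otimes>\<^bsub>C\<^esub> farr F g)
           = farr F (f \<otimes>\<^bsub>D\<^esub> g) \<cdot>\<^bsub>C\<^esub> ften F (src D f) (src D g)"
    and "\<And>X Y Z. \<lbrakk>X \<in> obj D; Y \<in> obj D; Z \<in> obj D\<rbrakk>
         \<Longrightarrow> farr F (\<alpha>\<^bsub>D\<^esub> X Y Z) \<cdot>\<^bsub>C\<^esub> ften F (X \<boxtimes>\<^bsub>D\<^esub> Y) Z \<cdot>\<^bsub>C\<^esub> (ften F X Y \<otimes>\<^bsub>C\<^esub> \<i>\<d>\<^bsub>C\<^esub> (fobj F Z))
           = ften F X (Y \<boxtimes>\<^bsub>D\<^esub> Z) \<cdot>\<^bsub>C\<^esub> (\<i>\<d>\<^bsub>C\<^esub> (fobj F X) \<otimes>\<^bsub>C\<^esub> ften F Y Z)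
               \<cdot>\<^bsub>C\<^esub> \<alpha>\<^bsub>C\<^esub> (fobj F X) (fobj F Y) (fobj F Z)"
    and "\<And>X. X \<in> obj D \<Longrightarrow>
         farr F (\<ll>\<^bsub>D\<^esub> X) \<cdot>\<^bsub>C\<^esub> ften F \<one>\<^bsub>D\<^esub> X \<cdot>\<^bsub>C\<^esub> (funit F \<otimes>\<^bsub>C\<^esub> \<i>\<d>\<^bsub>C\<^esub> (fobj F X)) = \<ll>\<^bsub>C\<^esub> (fobj F X)"
    and "\<And>X. X \<in> obj D \<Longrightarrow>
         farr F (\<rr>\<^bsub>D\<^esub> X) \<cdot>\<^bsub>C\<^esub> ften F X \<one>\<^bsub>D\<^esub> \<cdot>\<^bsub>C\<^esub> (\<i>\<d>\<^bsub>C\<^esub> (fobj F X) \<otimes>\<^bsub>C\<^esub> funit F) = \<rr>\<^bsub>C\<^esub> (fobj F X)"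
    and "\<And>X Y. \<lbrakk>X \<in> obj D; Y \<in> obj D\<rbrakk>
         \<Longrightarrow> ften F Y X \<cdot>\<^bsub>C\<^esub> \<tau>\<^bsub>C\<^esub> (fobj F X) (fobj F Y) = farr F (\<tau>\<^bsub>D\<^esub> X Y) \<cdot>\<^bsub>C\<^esub> ften F X Y"
  shows "symmetric_monoidal_functor D C F"
proof -
  interpret D: symmetric_monoidal_category D by fact
  interpret C: symmetric_monoidal_category C by fact
  show ?thesis
    by (intro symmetric_monoidal_functor.intro cat_functor.intro cat_functor_axioms.intro
        symmetric_monoidal_functor_axioms.intro)
      (use assms in \<open>auto simp: hom_iff D.category_axioms C.category_axioms\<close>)
qed

lemma monoidal_transformationI:
  assumes "symmetric_monoidal_functor D C F" "symmetric_monoidal_functor D C G"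
    and "\<And>X. X \<in> obj D \<Longrightarrow> \<theta> X \<in> arr C \<and> src C (\<theta> X) = fobj F X \<and> tgt C (\<theta> X) = fobj G X"
    and "\<And>f. f \<in> arr D \<Longrightarrow> \<theta> (tgt D f) \<cdot>\<^bsub>C\<^esub> farr F f = farr G f \<cdot>\<^bsub>C\<^esub> \<theta> (src D f)"
    and "\<And>X Y. \<lbrakk>X \<in> obj D; Y \<in> obj D\<rbrakk>
           \<Longrightarrow> \<theta> (X \<boxtimes>\<^bsub>D\<^esub> Y) \<cdot>\<^bsub>C\<^esub> ften F X Y = ften G X Y \<cdot>\<^bsub>C\<^esub> (\<theta> X \<otimes>\<^bsub>C\<^esub> \<theta> Y)"
    and "\<theta> \<one>\<^bsub>D\<^esub> \<cdot>\<^bsub>C\<^esub> funit F = funit G"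
  shows "monoidal_transformation D C F G \<theta>"
proof -
  interpret F: symmetric_monoidal_functor D C F by fact
  interpret G: symmetric_monoidal_functor D C G by fact
  show ?thesis
    by (intro monoidal_transformation.intro natural_transformation.intro
        natural_transformation_axioms.intro monoidal_transformation_axioms.intro
        F.symmetric_monoidal_functor_axioms G.symmetric_monoidal_functor_axioms
        F.cat_functor_axioms G.cat_functor_axioms)
      (use assms in \<open>auto simp: hom_iff\<close>)
qed

lemma (in symmetric_monoidal_category) identity_functor:
  "symmetric_monoidal_functor C C (mon_functor_id C)"
  by (rule symmetric_monoidal_functorI[OF symmetric_monoidal_category_axioms symmetric_monoidal_category_axioms])
    (simp_all add: mon_functor_id_def)

text \<open>
  The structure maps of \<open>F\<close>, transported by \<open>G\<close>, are moved past those of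
  \<open>G\<close> by naturality; what is left is the condition for \<open>F\<close> under
  \<open>G\<close> followed by the condition for \<open>G\<close>.
\<close>

lemma (in symmetric_monoidal_category) composite_functor:
  assumes "symmetric_monoidal_functor A B F" "symmetric_monoidal_functor B C G"
  shows "symmetric_monoidal_functor A C (mon_functor_comp C G F)"
proof -
  interpret F: symmetric_monoidal_functor A B F by fact
  interpret G: symmetric_monoidal_functor B C G by fact
  note [simp] = mon_functor_comp_def
  let ?GF = "mon_functor_comp C G F"
  have nat: "ften G (tgt B f) (tgt B g) \<cdot> (farr G f \<otimes> farr G g) \<cdot> k
      = farr G (f \<otimes>\<^bsub>B\<^esub> g) \<cdot> ften G (src B f) (src B g) \<cdot> k"
    if "f \<in> arr B" "g \<in> arr B" "k \<in> arr C" "tgt C k = fobj G (src B f) \<boxtimes> fobj G (src B g)" for f g k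
    using cmp_square[OF G.ften_natural'] that by simp
  have gcmp: "farr G g \<cdot> farr G f \<cdot> k = farr G (g \<cdot>\<^bsub>B\<^esub> f) \<cdot> k"
    if "f \<in> arr B" "g \<in> arr B" "src B g = tgt B f" "k \<in> arr C" "tgt C k = fobj G (src B f)" for f g k
    using that by (simp add: G.functor_cmp)
  show ?thesis
  proof (rule symmetric_monoidal_functorI[OF F.D.symmetric_monoidal_category_axioms symmetric_monoidal_category_axioms], goal_cases)
    case (4 f g)
    then show ?case by (simp add: F.functor_cmp G.functor_cmp)
  next
    case (5 X Y)
    then show ?case by (simp add: G.functor_iso)
  next
    case 6
    show ?case by (simp add: G.functor_iso)
  next
    case (7 f g)
    have "farr G (ften F (tgt A f) (tgt A g)) \<cdot> farr G (farr F f \<otimes>\<^bsub>B\<^esub> farr F g)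
          \<cdot> ften G (fobj F (src A f)) (fobj F (src A g))
        = farr G (farr F (f \<otimes>\<^bsub>A\<^esub> g)) \<cdot> farr G (ften F (src A f) (src A g))
          \<cdot> ften G (fobj F (src A f)) (fobj F (src A g))"
      using 7 by (simp add: gcmp F.ften_natural' del: cmp_assoc')
    then show ?case using 7 G.ften_natural'[of "farr F f" "farr F g"] by simp
  next
    case (8 X Y Z)
    let ?X = "fobj F X" and ?Y = "fobj F Y" and ?Z = "fobj F Z" and ?i = "\<lambda>X. \<i>\<d>\<^bsub>B\<^esub> (fobj F X)"
    have "farr ?GF (\<alpha>\<^bsub>A\<^esub> X Y Z) \<cdot> ften ?GF (X \<boxtimes>\<^bsub>A\<^esub> Y) Z \<cdot> (ften ?GF X Y \<otimes> \<i>\<d> (fobj ?GF Z))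
        = farr G (farr F (\<alpha>\<^bsub>A\<^esub> X Y Z)) \<cdot> farr G (ften F (X \<boxtimes>\<^bsub>A\<^esub> Y) Z) \<cdot> ften G (fobj F (X \<boxtimes>\<^bsub>A\<^esub> Y)) ?Z
          \<cdot> (farr G (ften F X Y) \<otimes> farr G (?i Z)) \<cdot> (ften G ?X ?Y \<otimes> \<i>\<d> (fobj G ?Z))"
      using 8 by (simp add: tensor_cmp')
    also have "\<dots> = farr G (farr F (\<alpha>\<^bsub>A\<^esub> X Y Z) \<cdot>\<^bsub>B\<^esub> ften F (X \<boxtimes>\<^bsub>A\<^esub> Y) Z \<cdot>\<^bsub>B\<^esub> (ften F X Y \<otimes>\<^bsub>B\<^esub> ?i Z))
          \<cdot> ften G (?X \<boxtimes>\<^bsub>B\<^esub> ?Y) ?Z \<cdot> (ften G ?X ?Y \<otimes> \<i>\<d> (fobj G ?Z))"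
      using 8 nat[of "ften F X Y" "?i Z"] by (simp add: G.functor_cmp)
    also have "\<dots> = farr G (ften F X (Y \<boxtimes>\<^bsub>A\<^esub> Z)) \<cdot> farr G (?i X \<otimes>\<^bsub>B\<^esub> ften F Y Z)
          \<cdot> (farr G (\<alpha>\<^bsub>B\<^esub> ?X ?Y ?Z) \<cdot> ften G (?X \<boxtimes>\<^bsub>B\<^esub> ?Y) ?Z \<cdot> (ften G ?X ?Y \<otimes> \<i>\<d> (fobj G ?Z)))"
      using 8 by (simp add: F.ften_assoc G.functor_cmp)
    also have "\<dots> = farr G (ften F X (Y \<boxtimes>\<^bsub>A\<^esub> Z)) \<cdot> farr G (?i X \<otimes>\<^bsub>B\<^esub> ften F Y Z)
          \<cdot> ften G ?X (?Y \<boxtimes>\<^bsub>B\<^esub> ?Z) \<cdot> (\<i>\<d> (fobj G ?X) \<otimes> ften G ?Y ?Z) \<cdot> \<alpha> (fobj G ?X) (fobj G ?Y) (fobj G ?Z)"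
      using 8 by (simp add: G.ften_assoc)
    also have "\<dots> = farr G (ften F X (Y \<boxtimes>\<^bsub>A\<^esub> Z)) \<cdot> ften G ?X (fobj F (Y \<boxtimes>\<^bsub>A\<^esub> Z))
          \<cdot> (farr G (?i X) \<otimes> farr G (ften F Y Z)) \<cdot> (\<i>\<d> (fobj G ?X) \<otimes> ften G ?Y ?Z) \<cdot> \<alpha> (fobj G ?X) (fobj G ?Y) (fobj G ?Z)"
      using 8 nat[of "?i X" "ften F Y Z"] by simp
    also have "\<dots> = ften ?GF X (Y \<boxtimes>\<^bsub>A\<^esub> Z) \<cdot> (\<i>\<d> (fobj ?GF X) \<otimes> ften ?GF Y Z)
          \<cdot> \<alpha> (fobj ?GF X) (fobj ?GF Y) (fobj ?GF Z)"
      using 8 by (simp add: tensor_cmp'')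
    finally show ?case .
  next
    case (9 X)
    let ?X = "fobj F X" and ?i = "\<i>\<d>\<^bsub>B\<^esub> (fobj F X)"
    have "farr ?GF (\<ll>\<^bsub>A\<^esub> X) \<cdot> ften ?GF \<one>\<^bsub>A\<^esub> X \<cdot> (funit ?GF \<otimes> \<i>\<d> (fobj ?GF X))
        = farr G (farr F (\<ll>\<^bsub>A\<^esub> X)) \<cdot> farr G (ften F \<one>\<^bsub>A\<^esub> X) \<cdot> ften G (fobj F \<one>\<^bsub>A\<^esub>) ?X
          \<cdot> (farr G (funit F) \<otimes> farr G ?i) \<cdot> (funit G \<otimes> \<i>\<d> (fobj G ?X))"
      using 9 by (simp add: tensor_cmp')
    also have "\<dots> = farr G (farr F (\<ll>\<^bsub>A\<^esub> X) \<cdot>\<^bsub>B\<^esub> ften F \<one>\<^bsub>A\<^esub> X \<cdot>\<^bsub>B\<^esub> (funit F \<otimes>\<^bsub>B\<^esub> ?i))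
          \<cdot> ften G \<one>\<^bsub>B\<^esub> ?X \<cdot> (funit G \<otimes> \<i>\<d> (fobj G ?X))"
      using 9 nat[of "funit F" ?i] by (simp add: G.functor_cmp)
    also have "\<dots> = \<ll> (fobj ?GF X)" using 9 by (simp add: F.ften_lunit G.ften_lunit)
    finally show ?case .
  next
    case (10 X)
    let ?X = "fobj F X" and ?i = "\<i>\<d>\<^bsub>B\<^esub> (fobj F X)"
    have "farr ?GF (\<rr>\<^bsub>A\<^esub> X) \<cdot> ften ?GF X \<one>\<^bsub>A\<^esub> \<cdot> (\<i>\<d> (fobj ?GF X) \<otimes> funit ?GF)
        = farr G (farr F (\<rr>\<^bsub>A\<^esub> X)) \<cdot> farr G (ften F X \<one>\<^bsub>A\<^esub>) \<cdot> ften G ?X (fobj F \<one>\<^bsub>A\<^esub>)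
          \<cdot> (farr G ?i \<otimes> farr G (funit F)) \<cdot> (\<i>\<d> (fobj G ?X) \<otimes> funit G)"
      using 10 by (simp add: tensor_cmp')
    also have "\<dots> = farr G (farr F (\<rr>\<^bsub>A\<^esub> X) \<cdot>\<^bsub>B\<^esub> ften F X \<one>\<^bsub>A\<^esub> \<cdot>\<^bsub>B\<^esub> (?i \<otimes>\<^bsub>B\<^esub> funit F))
          \<cdot> ften G ?X \<one>\<^bsub>B\<^esub> \<cdot> (\<i>\<d> (fobj G ?X) \<otimes> funit G)"
      using 10 nat[of ?i "funit F"] by (simp add: G.functor_cmp)
    also have "\<dots> = \<rr> (fobj ?GF X)" using 10 by (simp add: F.ften_runit G.ften_runit)
    finally show ?case .
  next
    case (11 X Y)
    have "farr G (ften F Y X) \<cdot> farr G (\<tau>\<^bsub>B\<^esub> (fobj F X) (fobj F Y)) \<cdot> ften G (fobj F X) (fobj F Y)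
        = farr G (farr F (\<tau>\<^bsub>A\<^esub> X Y)) \<cdot> farr G (ften F X Y) \<cdot> ften G (fobj F X) (fobj F Y)"
      using 11 by (simp add: gcmp F.ften_braid)
    then show ?case using 11 by (simp add: G.ften_braid)
  qed simp_all
qed

lemma mon_functor_tensor_simps:
  "X \<in> obj D \<Longrightarrow> fobj (mon_functor_tensor D C F G) X = fobj F X \<boxtimes>\<^bsub>C\<^esub> fobj G X"
  "f \<in> arr D \<Longrightarrow> farr (mon_functor_tensor D C F G) f = farr F f \<otimes>\<^bsub>C\<^esub> farr G f"
  "\<lbrakk>X \<in> obj D; Y \<in> obj D\<rbrakk> \<Longrightarrow> ften (mon_functor_tensor D C F G) X Y =
     (ften F X Y \<otimes>\<^bsub>C\<^esub> ften G X Y) \<cdot>\<^bsub>C\<^esub> interchange C (fobj F X) (fobj G X) (fobj F Y) (fobj G Y)"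
  "funit (mon_functor_tensor D C F G) = (funit F \<otimes>\<^bsub>C\<^esub> funit G) \<cdot>\<^bsub>C\<^esub> inverse_arrow C (\<ll>\<^bsub>C\<^esub> \<one>\<^bsub>C\<^esub>)"
  by (simp_all add: mon_functor_tensor_def)

lemma mon_functor_unit_simps:
  "X \<in> obj D \<Longrightarrow> fobj (mon_functor_unit D C) X = \<one>\<^bsub>C\<^esub>"
  "f \<in> arr D \<Longrightarrow> farr (mon_functor_unit D C) f = \<i>\<d>\<^bsub>C\<^esub> \<one>\<^bsub>C\<^esub>"
  "\<lbrakk>X \<in> obj D; Y \<in> obj D\<rbrakk> \<Longrightarrow> ften (mon_functor_unit D C) X Y = \<ll>\<^bsub>C\<^esub> \<one>\<^bsub>C\<^esub>"
  "funit (mon_functor_unit D C) = \<i>\<d>\<^bsub>C\<^esub> \<one>\<^bsub>C\<^esub>"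
  by (simp_all add: mon_functor_unit_def)

text \<open>
  Every coherence condition splits into the ones for \<open>F\<close> and \<open>G\<close>,
  tensored together, once the interchanges are collected on one side by naturality; the
  interchanges themselves are then related by the corresponding identity of the previous part.
\<close>

lemma (in symmetric_monoidal_category) tensor_functor:
  assumes F: "symmetric_monoidal_functor D C F" and G: "symmetric_monoidal_functor D C G"
  shows "symmetric_monoidal_functor D C (mon_functor_tensor D C F G)"
proof -
  interpret F: symmetric_monoidal_functor D C F by fact
  interpret G: symmetric_monoidal_functor D C G by fact
  note [simp] = mon_functor_tensor_simps
  let ?T = "mon_functor_tensor D C F G" and ?F = "fobj F" and ?G = "fobj G"
  show ?thesis
  proof (rule symmetric_monoidal_functorI[OF F.D.symmetric_monoidal_category_axioms symmetric_monoidal_category_axioms],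
      goal_cases)
    case (4 f g)
    then show ?case by (simp add: F.functor_cmp G.functor_cmp tensor_cmp')
  next
    case (7 f g)
    have "(ften F (tgt D f) (tgt D g) \<otimes> ften G (tgt D f) (tgt D g))
        \<cdot> ((farr F f \<otimes> farr F g) \<otimes> (farr G f \<otimes> farr G g))
        = (farr F (f \<otimes>\<^bsub>D\<^esub> g) \<otimes> farr G (f \<otimes>\<^bsub>D\<^esub> g)) \<cdot> (ften F (src D f) (src D g) \<otimes> ften G (src D f) (src D g))"
      using 7 by (simp add: tensor_cmp' F.ften_natural' G.ften_natural')
    note sq = cmp_square[OF this]
    show ?case using 7 by (simp add: interchange_natural sq)
  next
    case (8 X Y Z)
    have "farr (?T) (\<alpha>\<^bsub>D\<^esub> X Y Z) \<cdot> ften (?T) (X \<boxtimes>\<^bsub>D\<^esub> Y) Z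
          \<cdot> (ften (?T) X Y \<otimes> \<i>\<d> (fobj (?T) Z))
        = (farr F (\<alpha>\<^bsub>D\<^esub> X Y Z) \<otimes> farr G (\<alpha>\<^bsub>D\<^esub> X Y Z)) \<cdot> (ften F (X \<boxtimes>\<^bsub>D\<^esub> Y) Z \<otimes> ften G (X \<boxtimes>\<^bsub>D\<^esub> Y) Z)
          \<cdot> interchange C (?F (X \<boxtimes>\<^bsub>D\<^esub> Y)) (?G (X \<boxtimes>\<^bsub>D\<^esub> Y)) (?F Z) (?G Z)
          \<cdot> ((ften F X Y \<otimes> ften G X Y) \<otimes> (\<i>\<d> (?F Z) \<otimes> \<i>\<d> (?G Z)))
          \<cdot> (interchange C (?F X) (?G X) (?F Y) (?G Y) \<otimes> \<i>\<d> (?F Z \<boxtimes> ?G Z))"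
      using 8 by (simp add: tensor_cmp')
    also have "\<dots> = ((farr F (\<alpha>\<^bsub>D\<^esub> X Y Z) \<cdot> ften F (X \<boxtimes>\<^bsub>D\<^esub> Y) Z \<cdot> (ften F X Y \<otimes> \<i>\<d> (?F Z)))
          \<otimes> (farr G (\<alpha>\<^bsub>D\<^esub> X Y Z) \<cdot> ften G (X \<boxtimes>\<^bsub>D\<^esub> Y) Z \<cdot> (ften G X Y \<otimes> \<i>\<d> (?G Z))))
          \<cdot> interchange C (?F X \<boxtimes> ?F Y) (?G X \<boxtimes> ?G Y) (?F Z) (?G Z)
          \<cdot> (interchange C (?F X) (?G X) (?F Y) (?G Y) \<otimes> \<i>\<d> (?F Z \<boxtimes> ?G Z))"
      using 8 by (simp add: interchange_natural' tensor_cmp'' del: tensor_id')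
    also have "\<dots> = (ften F X (Y \<boxtimes>\<^bsub>D\<^esub> Z) \<otimes> ften G X (Y \<boxtimes>\<^bsub>D\<^esub> Z))
          \<cdot> ((\<i>\<d> (?F X) \<otimes> ften F Y Z) \<otimes> (\<i>\<d> (?G X) \<otimes> ften G Y Z))
          \<cdot> ((\<alpha> (?F X) (?F Y) (?F Z) \<otimes> \<alpha> (?G X) (?G Y) (?G Z))
            \<cdot> interchange C (?F X \<boxtimes> ?F Y) (?G X \<boxtimes> ?G Y) (?F Z) (?G Z)
            \<cdot> (interchange C (?F X) (?G X) (?F Y) (?G Y) \<otimes> \<i>\<d> (?F Z \<boxtimes> ?G Z)))"
      using 8 by (simp add: F.ften_assoc G.ften_assoc tensor_cmp'')
    also have "\<dots> = (ften F X (Y \<boxtimes>\<^bsub>D\<^esub> Z) \<otimes> ften G X (Y \<boxtimes>\<^bsub>D\<^esub> Z))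
          \<cdot> ((\<i>\<d> (?F X) \<otimes> ften F Y Z) \<otimes> (\<i>\<d> (?G X) \<otimes> ften G Y Z))
          \<cdot> (interchange C (?F X) (?G X) (?F Y \<boxtimes> ?F Z) (?G Y \<boxtimes> ?G Z)
            \<cdot> (\<i>\<d> (?F X \<boxtimes> ?G X) \<otimes> interchange C (?F Y) (?G Y) (?F Z) (?G Z))
            \<cdot> \<alpha> (?F X \<boxtimes> ?G X) (?F Y \<boxtimes> ?G Y) (?F Z \<boxtimes> ?G Z))"
      using 8 by (simp only: interchange_assoc F.functor_obj G.functor_obj)
    also have "\<dots> = ften (?T) X (Y \<boxtimes>\<^bsub>D\<^esub> Z)
          \<cdot> (\<i>\<d> (fobj (?T) X) \<otimes> ften (?T) Y Z)
          \<cdot> \<alpha> (fobj (?T) X) (fobj (?T) Y) (fobj (?T) Z)"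
    proof -
      have "interchange C (?F X) (?G X) (?F (Y \<boxtimes>\<^bsub>D\<^esub> Z)) (?G (Y \<boxtimes>\<^bsub>D\<^esub> Z))
          \<cdot> ((\<i>\<d> (?F X) \<otimes> \<i>\<d> (?G X)) \<otimes> (ften F Y Z \<otimes> ften G Y Z)) \<cdot> k
        = ((\<i>\<d> (?F X) \<otimes> ften F Y Z) \<otimes> (\<i>\<d> (?G X) \<otimes> ften G Y Z))
          \<cdot> interchange C (?F X) (?G X) (?F Y \<boxtimes> ?F Z) (?G Y \<boxtimes> ?G Z) \<cdot> k"
        if "k \<in> arr C" "tgt C k = (?F X \<boxtimes> ?G X) \<boxtimes> ((?F Y \<boxtimes> ?F Z) \<boxtimes> (?G Y \<boxtimes> ?G Z))" for k
        using 8 that by (simp add: interchange_natural' del: tensor_id')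
      moreover have "\<i>\<d> (?F X \<boxtimes> ?G X) \<otimes> ((ften F Y Z \<otimes> ften G Y Z) \<cdot> interchange C (?F Y) (?G Y) (?F Z) (?G Z))
        = (\<i>\<d> (?F X \<boxtimes> ?G X) \<otimes> (ften F Y Z \<otimes> ften G Y Z))
          \<cdot> (\<i>\<d> (?F X \<boxtimes> ?G X) \<otimes> interchange C (?F Y) (?G Y) (?F Z) (?G Z))"
        using 8 by (simp add: tensor_cmp')
      ultimately show ?thesis using 8 by simp
    qed
    finally show ?case .
  next
    case (9 X)
    let ?a = "funit F \<otimes> funit G" and ?i = "\<i>\<d> (?F X) \<otimes> \<i>\<d> (?G X)"
    have "farr (?T) (\<ll>\<^bsub>D\<^esub> X) \<cdot> ften (?T) \<one>\<^bsub>D\<^esub> X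
          \<cdot> (funit (?T) \<otimes> \<i>\<d> (fobj (?T) X))
        = (farr F (\<ll>\<^bsub>D\<^esub> X) \<otimes> farr G (\<ll>\<^bsub>D\<^esub> X)) \<cdot> (ften F \<one>\<^bsub>D\<^esub> X \<otimes> ften G \<one>\<^bsub>D\<^esub> X)
          \<cdot> interchange C (?F \<one>\<^bsub>D\<^esub>) (?G \<one>\<^bsub>D\<^esub>) (?F X) (?G X)
          \<cdot> (?a \<otimes> ?i) \<cdot> (iv (\<ll> \<one>) \<otimes> \<i>\<d> (?F X \<boxtimes> ?G X))"
      using 9 by (simp add: tensor_cmp')
    also have "\<dots> = ((farr F (\<ll>\<^bsub>D\<^esub> X) \<cdot> ften F \<one>\<^bsub>D\<^esub> X \<cdot> (funit F \<otimes> \<i>\<d> (?F X)))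
          \<otimes> (farr G (\<ll>\<^bsub>D\<^esub> X) \<cdot> ften G \<one>\<^bsub>D\<^esub> X \<cdot> (funit G \<otimes> \<i>\<d> (?G X))))
          \<cdot> interchange C \<one> \<one> (?F X) (?G X) \<cdot> (iv (\<ll> \<one>) \<otimes> \<i>\<d> (?F X \<boxtimes> ?G X))"
      using 9 by (simp add: interchange_natural' tensor_cmp'' del: tensor_id')
    also have "\<dots> = \<ll> (fobj (?T) X)"
      using 9 by (simp add: F.ften_lunit G.ften_lunit interchange_unit)
    finally show ?case .
  next
    case (10 X)
    let ?a = "funit F \<otimes> funit G" and ?i = "\<i>\<d> (?F X) \<otimes> \<i>\<d> (?G X)"
    have "farr (?T) (\<rr>\<^bsub>D\<^esub> X) \<cdot> ften (?T) X \<one>\<^bsub>D\<^esub>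
          \<cdot> (\<i>\<d> (fobj (?T) X) \<otimes> funit (?T))
        = (farr F (\<rr>\<^bsub>D\<^esub> X) \<otimes> farr G (\<rr>\<^bsub>D\<^esub> X)) \<cdot> (ften F X \<one>\<^bsub>D\<^esub> \<otimes> ften G X \<one>\<^bsub>D\<^esub>)
          \<cdot> interchange C (?F X) (?G X) (?F \<one>\<^bsub>D\<^esub>) (?G \<one>\<^bsub>D\<^esub>)
          \<cdot> (?i \<otimes> ?a) \<cdot> (\<i>\<d> (?F X \<boxtimes> ?G X) \<otimes> iv (\<ll> \<one>))"
      using 10 by (simp add: tensor_cmp')
    also have "\<dots> = ((farr F (\<rr>\<^bsub>D\<^esub> X) \<cdot> ften F X \<one>\<^bsub>D\<^esub> \<cdot> (\<i>\<d> (?F X) \<otimes> funit F))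
          \<otimes> (farr G (\<rr>\<^bsub>D\<^esub> X) \<cdot> ften G X \<one>\<^bsub>D\<^esub> \<cdot> (\<i>\<d> (?G X) \<otimes> funit G)))
          \<cdot> interchange C (?F X) (?G X) \<one> \<one> \<cdot> (\<i>\<d> (?F X \<boxtimes> ?G X) \<otimes> iv (\<ll> \<one>))"
      using 10 by (simp add: interchange_natural' tensor_cmp'' del: tensor_id')
    also have "\<dots> = \<rr> (fobj (?T) X)"
      using 10 by (simp add: F.ften_runit G.ften_runit interchange_unit)
    finally show ?case .
  next
    case (11 X Y)
    have "(ften F Y X \<otimes> ften G Y X) \<cdot> interchange C (?F Y) (?G Y) (?F X) (?G X)
          \<cdot> \<tau> (?F X \<boxtimes> ?G X) (?F Y \<boxtimes> ?G Y)
        = ((ften F Y X \<cdot> \<tau> (?F X) (?F Y)) \<otimes> (ften G Y X \<cdot> \<tau> (?G X) (?G Y)))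
          \<cdot> interchange C (?F X) (?G X) (?F Y) (?G Y)"
      using 11 by (simp add: interchange_braid tensor_cmp'')
    then show ?case using 11 by (simp add: F.ften_braid G.ften_braid tensor_cmp'')
  qed simp_all
qed

lemma (in symmetric_monoidal_category) unit_functor:
  assumes "symmetric_monoidal_category D"
  shows "symmetric_monoidal_functor D C (mon_functor_unit D C)"
proof -
  interpret D: symmetric_monoidal_category D by fact
  show ?thesis
    by (rule symmetric_monoidal_functorI[OF assms symmetric_monoidal_category_axioms])
      (simp_all add: mon_functor_unit_def unit_coherence braid_unit_unit unitors_agree[symmetric])
qed

section \<open>The symmetric monoidal category of symmetric monoidal functors\<close>

definition transf ::
    "('o1, 'a1) sm_data \<Rightarrow> ('o1, 'a1, 'o2, 'a2) mon_functor \<Rightarrow> ('o1, 'a1, 'o2, 'a2) mon_functor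
     \<Rightarrow> ('o1 \<Rightarrow> 'a2) \<Rightarrow> ('o1, 'a1, 'o2, 'a2) mon_trans" where
  "transf D F G \<theta> = \<lparr>tr_src = F, tr_tgt = G, tr_cmp = (\<lambda>X\<in>obj D. \<theta> X)\<rparr>"

lemma transf_simps [simp]:
  "tr_src (transf D F G \<theta>) = F" "tr_tgt (transf D F G \<theta>) = G"
  "X \<in> obj D \<Longrightarrow> tr_cmp (transf D F G \<theta>) X = \<theta> X"
  by (simp_all add: transf_def)

lemma transf_cong:
  "(\<And>X. X \<in> obj D \<Longrightarrow> \<theta> X = \<theta>' X) \<Longrightarrow> transf D F G \<theta> = transf D F G \<theta>'"
  by (auto simp: transf_def intro: restrict_ext)

text \<open>
  Extensionality of the components makes pointwise equality enough.
\<close>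

lemma transf_eqI:
  assumes "\<theta> \<in> arr (Symm_Mon D C)" "\<phi> \<in> arr (Symm_Mon D C)" "tr_src \<theta> = tr_src \<phi>" "tr_tgt \<theta> = tr_tgt \<phi>"
    "\<And>X. X \<in> obj D \<Longrightarrow> tr_cmp \<theta> X = tr_cmp \<phi> X"
  shows "\<theta> = \<phi>"
proof -
  have "tr_cmp \<theta> = tr_cmp \<phi>"
    using assms by (intro extensionalityI[of _ "obj D"]) (auto simp: Symm_Mon_def Let_def)
  then show ?thesis using assms by (intro mon_trans.equality) auto
qed

lemma Symm_Mon_simps:
  "obj (Symm_Mon D C) = Symm_Mon_obj D C"
  "src (Symm_Mon D C) = tr_src"
  "tgt (Symm_Mon D C) = tr_tgt"
  "\<i>\<d>\<^bsub>Symm_Mon D C\<^esub> F = transf D F F (\<lambda>X. \<i>\<d>\<^bsub>C\<^esub> (fobj F X))"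
  "\<phi> \<cdot>\<^bsub>Symm_Mon D C\<^esub> \<theta> = transf D (tr_src \<theta>) (tr_tgt \<phi>) (\<lambda>X. tr_cmp \<phi> X \<cdot>\<^bsub>C\<^esub> tr_cmp \<theta> X)"
  "F \<boxtimes>\<^bsub>Symm_Mon D C\<^esub> G = mon_functor_tensor D C F G"
  "\<theta> \<otimes>\<^bsub>Symm_Mon D C\<^esub> \<phi> = transf D (mon_functor_tensor D C (tr_src \<theta>) (tr_src \<phi>))
     (mon_functor_tensor D C (tr_tgt \<theta>) (tr_tgt \<phi>)) (\<lambda>X. tr_cmp \<theta> X \<otimes>\<^bsub>C\<^esub> tr_cmp \<phi> X)"
  "\<one>\<^bsub>Symm_Mon D C\<^esub> = mon_functor_unit D C"
  "\<alpha>\<^bsub>Symm_Mon D C\<^esub> F G H = transf D (mon_functor_tensor D C (mon_functor_tensor D C F G) H)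
     (mon_functor_tensor D C F (mon_functor_tensor D C G H)) (\<lambda>X. \<alpha>\<^bsub>C\<^esub> (fobj F X) (fobj G X) (fobj H X))"
  "\<ll>\<^bsub>Symm_Mon D C\<^esub> F = transf D (mon_functor_tensor D C (mon_functor_unit D C) F) F (\<lambda>X. \<ll>\<^bsub>C\<^esub> (fobj F X))"
  "\<rr>\<^bsub>Symm_Mon D C\<^esub> F = transf D (mon_functor_tensor D C F (mon_functor_unit D C)) F (\<lambda>X. \<rr>\<^bsub>C\<^esub> (fobj F X))"
  "\<tau>\<^bsub>Symm_Mon D C\<^esub> F G = transf D (mon_functor_tensor D C F G) (mon_functor_tensor D C G F)
     (\<lambda>X. \<tau>\<^bsub>C\<^esub> (fobj F X) (fobj G X))"
  by (simp_all add: Symm_Mon_def Let_def transf_def)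

locale functor_category =
  D: symmetric_monoidal_category D + symmetric_monoidal_category C
  for D :: "('o1, 'a1) sm_data" and C :: "('o, 'a) sm_data" (structure)
begin

abbreviation SM where "SM \<equiv> Symm_Mon D C"
abbreviation ten where "ten \<equiv> mon_functor_tensor D C"
abbreviation e where "e \<equiv> mon_functor_unit D C"

lemma functor_of: "F \<in> Symm_Mon_obj D C \<Longrightarrow> symmetric_monoidal_functor D C F"
  by (simp add: Symm_Mon_obj_def)

lemma fobj_SM [simp]: "\<lbrakk>F \<in> Symm_Mon_obj D C; X \<in> obj D\<rbrakk> \<Longrightarrow> fobj F X \<in> obj C"
  using symmetric_monoidal_functor.functor_obj[OF functor_of] by blast

lemma ten_SM [simp]:
  assumes "F \<in> Symm_Mon_obj D C" "G \<in> Symm_Mon_obj D C"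
  shows "ten F G \<in> Symm_Mon_obj D C"
  using tensor_functor[OF functor_of functor_of] assms
  by (auto simp: Symm_Mon_obj_def extensional_mon_functor_def mon_functor_tensor_def)

lemma e_SM [simp]: "e \<in> Symm_Mon_obj D C"
  using unit_functor[OF D.symmetric_monoidal_category_axioms]
  by (auto simp: Symm_Mon_obj_def extensional_mon_functor_def mon_functor_unit_def)

lemma fobj_ten [simp]:
  "X \<in> obj D \<Longrightarrow> fobj (ten F G) X = fobj F X \<boxtimes> fobj G X" "X \<in> obj D \<Longrightarrow> fobj e X = \<one>"
  by (simp_all add: mon_functor_tensor_def mon_functor_unit_def)

lemma SM_arr_iff:
  "\<theta> \<in> arr SM \<longleftrightarrow> tr_src \<theta> \<in> Symm_Mon_obj D C \<and> tr_tgt \<theta> \<in> Symm_Mon_obj D C \<and>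
     tr_cmp \<theta> \<in> extensional (obj D) \<and> monoidal_transformation D C (tr_src \<theta>) (tr_tgt \<theta>) (tr_cmp \<theta>)"
  by (simp add: Symm_Mon_def Let_def)

lemma arr_SM:
  assumes "\<theta> \<in> arr SM"
  shows "monoidal_transformation D C (tr_src \<theta>) (tr_tgt \<theta>) (tr_cmp \<theta>)"
    "tr_src \<theta> \<in> Symm_Mon_obj D C" "tr_tgt \<theta> \<in> Symm_Mon_obj D C"
  using assms by (simp_all add: SM_arr_iff)

lemma component_SM [simp]:
  assumes "\<theta> \<in> arr SM" "X \<in> obj D"
  shows "tr_cmp \<theta> X \<in> arr C" "src C (tr_cmp \<theta> X) = fobj (tr_src \<theta>) X" "tgt C (tr_cmp \<theta> X) = fobj (tr_tgt \<theta>) X"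
  using monoidal_transformation.component_arr[OF arr_SM(1)[OF assms(1)] assms(2)] by auto

lemma transf_arr:
  assumes "F \<in> Symm_Mon_obj D C" "G \<in> Symm_Mon_obj D C" "monoidal_transformation D C F G \<theta>"
  shows "transf D F G \<theta> \<in> arr SM"
proof -
  interpret monoidal_transformation D C F G \<theta> by fact
  have "monoidal_transformation D C F G (\<lambda>X\<in>obj D. \<theta> X)"
    by (rule monoidal_transformationI)
      (use functor_of assms in \<open>auto simp: naturality' component_tensor component_unit\<close>)
  then show ?thesis using assms by (simp add: SM_arr_iff transf_def)
qed

lemma id_transformation:
  assumes "F \<in> Symm_Mon_obj D C"
  shows "monoidal_transformation D C F F (\<lambda>X. \<i>\<d> (fobj F X))"
proof -
  interpret symmetric_monoidal_functor D C F using assms by (rule functor_of)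
  show ?thesis
    by (rule monoidal_transformationI[OF functor_of functor_of]) (use assms in auto)
qed

lemma comp_transformation:
  assumes "\<theta> \<in> arr SM" "\<phi> \<in> arr SM" "tr_tgt \<theta> = tr_src \<phi>"
  shows "monoidal_transformation D C (tr_src \<theta>) (tr_tgt \<phi>) (\<lambda>X. tr_cmp \<phi> X \<cdot> tr_cmp \<theta> X)"
proof -
  interpret t: monoidal_transformation D C "tr_src \<theta>" "tr_src \<phi>" "tr_cmp \<theta>"
    using arr_SM(1)[OF assms(1)] assms(3) by simp
  interpret p: monoidal_transformation D C "tr_src \<phi>" "tr_tgt \<phi>" "tr_cmp \<phi>"
    using arr_SM(1)[OF assms(2)] by simp
  show ?thesis
  proof (rule monoidal_transformationI, goal_cases)
    case (4 f)
    then show ?case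
      using cmp_square[OF p.naturality', of f "tr_cmp \<theta> (src D f)"] by (simp add: t.naturality')
  next
    case (5 X Y)
    have "tr_cmp \<phi> (X \<boxtimes>\<^bsub>D\<^esub> Y) \<cdot> ften (tr_src \<phi>) X Y \<cdot> (tr_cmp \<theta> X \<otimes> tr_cmp \<theta> Y)
        = ften (tr_tgt \<phi>) X Y \<cdot> (tr_cmp \<phi> X \<otimes> tr_cmp \<phi> Y) \<cdot> (tr_cmp \<theta> X \<otimes> tr_cmp \<theta> Y)"
      by (rule cmp_square) (use 5 in \<open>simp_all add: p.component_tensor\<close>)
    with 5 show ?case by (simp add: t.component_tensor tensor_cmp')
  next
    case 6
    then show ?case by (simp add: t.component_unit p.component_unit)
  qed (use arr_SM[OF assms(1)] arr_SM[OF assms(2)] functor_of in auto)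
qed

lemma tensor_transformation:
  assumes "\<theta> \<in> arr SM" "\<phi> \<in> arr SM"
  shows "monoidal_transformation D C (ten (tr_src \<theta>) (tr_src \<phi>)) (ten (tr_tgt \<theta>) (tr_tgt \<phi>))
    (\<lambda>X. tr_cmp \<theta> X \<otimes> tr_cmp \<phi> X)"
proof -
  interpret t: monoidal_transformation D C "tr_src \<theta>" "tr_tgt \<theta>" "tr_cmp \<theta>"
    by (rule arr_SM(1)[OF assms(1)])
  interpret p: monoidal_transformation D C "tr_src \<phi>" "tr_tgt \<phi>" "tr_cmp \<phi>"
    by (rule arr_SM(1)[OF assms(2)])
  have F: "symmetric_monoidal_functor D C (ten (tr_src \<theta>) (tr_src \<phi>))"
      "symmetric_monoidal_functor D C (ten (tr_tgt \<theta>) (tr_tgt \<phi>))"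
    using assms[THEN arr_SM(2)] assms[THEN arr_SM(3)] by (blast intro: tensor_functor functor_of)+
  note [simp] = mon_functor_tensor_simps
  show ?thesis
  proof (rule monoidal_transformationI[OF F], goal_cases)
    case (2 f)
    then show ?case by (simp add: tensor_cmp' t.naturality' p.naturality')
  next
    case (3 X Y)
    then show ?case
      by (simp add: tensor_cmp'' t.component_tensor p.component_tensor interchange_natural)
  next
    case 4
    then show ?case by (simp add: tensor_cmp'' t.component_unit p.component_unit)
  qed auto
qed

lemma assoc_transformation:
  assumes "F \<in> Symm_Mon_obj D C" "G \<in> Symm_Mon_obj D C" "H \<in> Symm_Mon_obj D C"
  shows "monoidal_transformation D C (ten (ten F G) H) (ten F (ten G H))
    (\<lambda>X. \<alpha> (fobj F X) (fobj G X) (fobj H X))"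
proof -
  interpret F: symmetric_monoidal_functor D C F using assms(1) by (rule functor_of)
  interpret G: symmetric_monoidal_functor D C G using assms(2) by (rule functor_of)
  interpret H: symmetric_monoidal_functor D C H using assms(3) by (rule functor_of)
  note [simp] = mon_functor_tensor_simps
  show ?thesis
  proof (rule monoidal_transformationI[OF functor_of functor_of], goal_cases)
    case (4 f)
    then show ?case by (simp add: assoc_natural')
  next
    case (5 X Y)
    let ?F = "fobj F" and ?G = "fobj G" and ?H = "fobj H"
    have "\<alpha> (?F (X \<boxtimes>\<^bsub>D\<^esub> Y)) (?G (X \<boxtimes>\<^bsub>D\<^esub> Y)) (?H (X \<boxtimes>\<^bsub>D\<^esub> Y))
        \<cdot> (((ften F X Y \<otimes> ften G X Y) \<cdot> interchange C (?F X) (?G X) (?F Y) (?G Y)) \<otimes> ften H X Y)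
        \<cdot> interchange C (?F X \<boxtimes> ?G X) (?H X) (?F Y \<boxtimes> ?G Y) (?H Y)
      = \<alpha> (?F (X \<boxtimes>\<^bsub>D\<^esub> Y)) (?G (X \<boxtimes>\<^bsub>D\<^esub> Y)) (?H (X \<boxtimes>\<^bsub>D\<^esub> Y))
        \<cdot> ((ften F X Y \<otimes> ften G X Y) \<otimes> ften H X Y)
        \<cdot> (interchange C (?F X) (?G X) (?F Y) (?G Y) \<otimes> \<i>\<d> (?H X \<boxtimes> ?H Y))
        \<cdot> interchange C (?F X \<boxtimes> ?G X) (?H X) (?F Y \<boxtimes> ?G Y) (?H Y)"
      using 5 by (simp add: tensor_cmp'')
    also have "\<dots> = (ften F X Y \<otimes> (ften G X Y \<otimes> ften H X Y))
        \<cdot> (\<alpha> (?F X \<boxtimes> ?F Y) (?G X \<boxtimes> ?G Y) (?H X \<boxtimes> ?H Y)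
        \<cdot> (interchange C (?F X) (?G X) (?F Y) (?G Y) \<otimes> \<i>\<d> (?H X \<boxtimes> ?H Y))
        \<cdot> interchange C (?F X \<boxtimes> ?G X) (?H X) (?F Y \<boxtimes> ?G Y) (?H Y))"
      using 5 by (simp add: assoc_natural'')
    also have "\<dots> = (ften F X Y \<otimes> (ften G X Y \<otimes> ften H X Y))
        \<cdot> ((\<i>\<d> (?F X \<boxtimes> ?F Y) \<otimes> interchange C (?G X) (?H X) (?G Y) (?H Y))
        \<cdot> interchange C (?F X) (?G X \<boxtimes> ?H X) (?F Y) (?G Y \<boxtimes> ?H Y)
        \<cdot> (\<alpha> (?F X) (?G X) (?H X) \<otimes> \<alpha> (?F Y) (?G Y) (?H Y)))"
      using 5 by (simp only: assoc_interchange F.functor_obj G.functor_obj H.functor_obj)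
    finally show ?case using 5 by (simp add: tensor_cmp'')
  next
    case 6
    have "\<alpha> (fobj F \<one>\<^bsub>D\<^esub>) (fobj G \<one>\<^bsub>D\<^esub>) (fobj H \<one>\<^bsub>D\<^esub>)
        \<cdot> ((funit F \<otimes> funit G) \<otimes> funit H) \<cdot> (iv (\<ll> \<one>) \<otimes> \<i>\<d> \<one>) \<cdot> iv (\<ll> \<one>)
      = (funit F \<otimes> (funit G \<otimes> funit H)) \<cdot> (\<i>\<d> \<one> \<otimes> iv (\<ll> \<one>)) \<cdot> iv (\<ll> \<one>)"
      by (simp add: assoc_natural'' unit_coherence)
    then show ?case by (simp add: tensor_cmp'')
  qed (use assms in auto)
qed

lemma unitor_transformation:
  assumes "F \<in> Symm_Mon_obj D C"
  shows "monoidal_transformation D C (ten e F) F (\<lambda>X. \<ll> (fobj F X))"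
    and "monoidal_transformation D C (ten F e) F (\<lambda>X. \<rr> (fobj F X))"
proof -
  interpret F: symmetric_monoidal_functor D C F using assms(1) by (rule functor_of)
  note [simp] = mon_functor_tensor_simps mon_functor_unit_simps
  show "monoidal_transformation D C (ten e F) F (\<lambda>X. \<ll> (fobj F X))"
  proof (rule monoidal_transformationI[OF functor_of functor_of], goal_cases)
    case (5 X Y)
    have "\<ll> (fobj F (X \<boxtimes>\<^bsub>D\<^esub> Y)) \<cdot> (\<ll> \<one> \<otimes> ften F X Y) \<cdot> interchange C \<one> (fobj F X) \<one> (fobj F Y)
      = \<ll> (fobj F (X \<boxtimes>\<^bsub>D\<^esub> Y)) \<cdot> (\<i>\<d> \<one> \<otimes> ften F X Y) \<cdot> (\<ll> \<one> \<otimes> \<i>\<d> (fobj F X \<boxtimes> fobj F Y))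
        \<cdot> interchange C \<one> (fobj F X) \<one> (fobj F Y)"
      using 5 by (simp add: tensor_cmp'')
    then show ?case using 5 by (simp add: lunit_natural'' interchange_unit)
  next
    case 6
    show ?case by (simp add: lunit_natural'')
  qed (use assms in \<open>auto simp: lunit_natural'\<close>)
  show "monoidal_transformation D C (ten F e) F (\<lambda>X. \<rr> (fobj F X))"
  proof (rule monoidal_transformationI[OF functor_of functor_of], goal_cases)
    case (5 X Y)
    have "\<rr> (fobj F (X \<boxtimes>\<^bsub>D\<^esub> Y)) \<cdot> (ften F X Y \<otimes> \<ll> \<one>) \<cdot> interchange C (fobj F X) \<one> (fobj F Y) \<one>
      = \<rr> (fobj F (X \<boxtimes>\<^bsub>D\<^esub> Y)) \<cdot> (ften F X Y \<otimes> \<i>\<d> \<one>) \<cdot> (\<i>\<d> (fobj F X \<boxtimes> fobj F Y) \<otimes> \<ll> \<one>)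
        \<cdot> interchange C (fobj F X) \<one> (fobj F Y) \<one>"
      using 5 by (simp add: tensor_cmp'')
    then show ?case using 5 by (simp add: runit_natural'' interchange_unit)
  next
    case 6
    show ?case by (simp add: runit_natural'' unitors_agree)
  qed (use assms in \<open>auto simp: runit_natural'\<close>)
qed

lemma braid_transformation:
  assumes "F \<in> Symm_Mon_obj D C" "G \<in> Symm_Mon_obj D C"
  shows "monoidal_transformation D C (ten F G) (ten G F) (\<lambda>X. \<tau> (fobj F X) (fobj G X))"
proof -
  interpret F: symmetric_monoidal_functor D C F using assms(1) by (rule functor_of)
  interpret G: symmetric_monoidal_functor D C G using assms(2) by (rule functor_of)
  note [simp] = mon_functor_tensor_simps
  show ?thesis
  proof (rule monoidal_transformationI[OF functor_of functor_of], goal_cases)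
    case (5 X Y)
    then show ?case by (simp add: braid_natural'' interchange_braid)
  next
    case 6
    then show ?case by (simp add: braid_natural'' braid_unit_unit)
  qed (use assms in \<open>auto simp: braid_natural'\<close>)
qed

text \<open>
  Pointwise inverses of a monoidal transformation are again monoidal, by flipping the squares.
\<close>

lemma SM_iso:
  assumes "\<theta> \<in> arr SM" "\<And>X. X \<in> obj D \<Longrightarrow> iso C (tr_cmp \<theta> X)"
  shows "iso SM \<theta>"
proof -
  interpret t: monoidal_transformation D C "tr_src \<theta>" "tr_tgt \<theta>" "tr_cmp \<theta>"
    by (rule arr_SM(1)[OF assms(1)])
  let ?F = "tr_src \<theta>" and ?G = "tr_tgt \<theta>" and ?i = "\<lambda>X. iv (tr_cmp \<theta> X)"
  have "monoidal_transformation D C ?G ?F ?i"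
  proof (rule monoidal_transformationI, goal_cases)
    case (4 f)
    show ?case by (rule iso_square_flip) (use 4 assms(2) in \<open>simp_all add: t.naturality'\<close>)
  next
    case (5 X Y)
    have "?i (X \<boxtimes>\<^bsub>D\<^esub> Y) \<cdot> ften ?G X Y = ften ?F X Y \<cdot> iv (tr_cmp \<theta> X \<otimes> tr_cmp \<theta> Y)"
      by (rule iso_square_flip) (use 5 assms(2) in \<open>simp_all add: t.component_tensor\<close>)
    then show ?case using 5 assms(2) by simp
  next
    case 6
    show ?case using assms(2)[of "\<one>\<^bsub>D\<^esub>"] by (simp flip: t.component_unit)
  qed (use assms functor_of arr_SM[OF assms(1)] in auto)
  then have i: "transf D ?G ?F ?i \<in> arr SM"
    using arr_SM[OF assms(1)] transf_arr by blast
  have "inverse_arrows SM \<theta> (transf D ?G ?F ?i)"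
    using assms i by (auto simp: inverse_arrows_def hom_iff Symm_Mon_simps intro!: transf_cong)
  then show ?thesis by (auto simp: iso_def)
qed

lemma transf_eq_arr:
  assumes "\<theta> \<in> arr SM" "tr_src \<theta> = F" "tr_tgt \<theta> = G" "\<And>X. X \<in> obj D \<Longrightarrow> \<phi> X = tr_cmp \<theta> X"
  shows "transf D F G \<phi> = \<theta>"
proof -
  have "transf D F G \<phi> = transf D F G (tr_cmp \<theta>)" using assms by (intro transf_cong)
  also have "\<dots> = \<theta>"
  proof (rule transf_eqI)
    show "transf D F G (tr_cmp \<theta>) \<in> arr SM"
      using transf_arr[of "tr_src \<theta>" "tr_tgt \<theta>"] arr_SM[OF assms(1)] assms(2,3) by simp
  qed (use assms in simp_all)
  finally show ?thesis .
qed

lemma structure_arr [simp]: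
  "F \<in> Symm_Mon_obj D C \<Longrightarrow> transf D F F (\<lambda>X. \<i>\<d> (fobj F X)) \<in> arr SM"
  "\<lbrakk>\<theta> \<in> arr SM; \<phi> \<in> arr SM; tr_tgt \<theta> = tr_src \<phi>\<rbrakk>
   \<Longrightarrow> transf D (tr_src \<theta>) (tr_tgt \<phi>) (\<lambda>X. tr_cmp \<phi> X \<cdot> tr_cmp \<theta> X) \<in> arr SM"
  "\<lbrakk>\<theta> \<in> arr SM; \<phi> \<in> arr SM\<rbrakk> \<Longrightarrow> transf D (ten (tr_src \<theta>) (tr_src \<phi>)) (ten (tr_tgt \<theta>) (tr_tgt \<phi>))
      (\<lambda>X. tr_cmp \<theta> X \<otimes> tr_cmp \<phi> X) \<in> arr SM"
  "\<lbrakk>F \<in> Symm_Mon_obj D C; G \<in> Symm_Mon_obj D C; H \<in> Symm_Mon_obj D C\<rbrakk>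
   \<Longrightarrow> transf D (ten (ten F G) H) (ten F (ten G H)) (\<lambda>X. \<alpha> (fobj F X) (fobj G X) (fobj H X)) \<in> arr SM"
  "F \<in> Symm_Mon_obj D C \<Longrightarrow> transf D (ten e F) F (\<lambda>X. \<ll> (fobj F X)) \<in> arr SM"
  "F \<in> Symm_Mon_obj D C \<Longrightarrow> transf D (ten F e) F (\<lambda>X. \<rr> (fobj F X)) \<in> arr SM"
  "\<lbrakk>F \<in> Symm_Mon_obj D C; G \<in> Symm_Mon_obj D C\<rbrakk>
   \<Longrightarrow> transf D (ten F G) (ten G F) (\<lambda>X. \<tau> (fobj F X) (fobj G X)) \<in> arr SM"
  by (simp_all add: transf_arr id_transformation comp_transformation tensor_transformation
      assoc_transformation unitor_transformation braid_transformation arr_SM)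

lemma arr_SM_obj [simp]:
  "\<theta> \<in> arr SM \<Longrightarrow> tr_src \<theta> \<in> Symm_Mon_obj D C" "\<theta> \<in> arr SM \<Longrightarrow> tr_tgt \<theta> \<in> Symm_Mon_obj D C"
  by (simp_all add: arr_SM)

text \<open>
  Each axiom holds pointwise, as an axiom of \<open>C\<close>; the content lies in the preceding
  lemmas, by which the pointwise constraints are monoidal transformations.
\<close>

theorem symmetric_monoidal_category_SM: "symmetric_monoidal_category SM"
\<comment> \<open>The cases are numbered in the order of the axioms in the two locale definitions.\<close>
proof (unfold_locales, goal_cases)
  case (5 f X Y)
  then show ?case by (auto simp: hom_iff Symm_Mon_simps intro!: transf_eq_arr)
next
  case (6 f X Y)
  then show ?case by (auto simp: hom_iff Symm_Mon_simps intro!: transf_eq_arr)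
next
  case (12 f X Y g Z f' X' Y' g' Z')
  then show ?case
    by (auto simp: hom_iff Symm_Mon_simps tensor_cmp' intro!: transf_cong)
next
  case (13 X Y Z)
  then show ?case by (auto simp: hom_iff Symm_Mon_simps intro!: SM_iso)
next
  case (14 X)
  then show ?case by (auto simp: hom_iff Symm_Mon_simps intro!: SM_iso)
next
  case (15 X)
  then show ?case by (auto simp: hom_iff Symm_Mon_simps intro!: SM_iso)
next
  case (17 f X X' g Y Y' h Z Z')
  then show ?case by (auto simp: hom_iff Symm_Mon_simps assoc_natural' intro!: transf_cong)
next
  case (18 f X X')
  then show ?case by (auto simp: hom_iff Symm_Mon_simps lunit_natural' intro!: transf_cong)
next
  case (19 f X X')
  then show ?case by (auto simp: hom_iff Symm_Mon_simps runit_natural' intro!: transf_cong)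
next
  case (20 f X X' g Y Y')
  then show ?case by (auto simp: hom_iff Symm_Mon_simps braid_natural' intro!: transf_cong)
next
  case (21 W X Y Z)
  then show ?case by (auto simp: Symm_Mon_simps pentagon intro!: transf_cong)
next
  case (22 X Y)
  then show ?case by (auto simp: Symm_Mon_simps triangle intro!: transf_cong)
next
  case (23 X Y)
  then show ?case by (auto simp: Symm_Mon_simps braid_symmetric intro!: transf_cong)
next
  case (24 X)
  then show ?case by (auto simp: Symm_Mon_simps braid_unit intro!: transf_cong)
next
  case (25 X Y Z)
  then show ?case by (auto simp: Symm_Mon_simps hexagon intro!: transf_cong)
qed (auto simp: hom_iff Symm_Mon_simps intro!: transf_cong)

end

section \<open>The theory as a symmetric monoidal category\<close>

lemma chain_append: "chain X (es @ fs) \<longleftrightarrow> chain X es \<and> chain (chain_end X es) fs"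
  by (induction X es rule: chain.induct) auto

lemma chain_end_append: "chain_end X (es @ fs) = chain_end (chain_end X es) fs"
  by (induction X es rule: chain_end.induct) auto

lemma chain_tensor [simp]:
  "chain (Z \<otimes>\<^sub>w X) (map (TenL Z) es) \<longleftrightarrow> chain X es"
  "chain_end (Z \<otimes>\<^sub>w X) (map (TenL Z) es) = Z \<otimes>\<^sub>w chain_end X es"
  "chain (X \<otimes>\<^sub>w Z) (map (\<lambda>e. TenR e Z) es) \<longleftrightarrow> chain X es"
  "chain_end (X \<otimes>\<^sub>w Z) (map (\<lambda>e. TenR e Z) es) = chain_end X es \<otimes>\<^sub>w Z"
  by (induction X es rule: chain.induct) auto

lemma path_type [simp]:
  "pid X \<in> paths" "psrc (pid X) = X" "ptgt (pid X) = X"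
  "\<langle>e\<rangle> \<in> paths" "psrc \<langle>e\<rangle> = esrc e" "ptgt \<langle>e\<rangle> = etgt e"
  "p \<in> paths \<Longrightarrow> X \<rhd> p \<in> paths" "psrc (X \<rhd> p) = X \<otimes>\<^sub>w psrc p" "ptgt (X \<rhd> p) = X \<otimes>\<^sub>w ptgt p"
  "p \<in> paths \<Longrightarrow> p \<lhd> X \<in> paths" "psrc (p \<lhd> X) = psrc p \<otimes>\<^sub>w X" "ptgt (p \<lhd> X) = ptgt p \<otimes>\<^sub>w X"
  by (simp_all add: paths_def pid_def pedge_def psrc_def ptgt_def tenl_def tenr_def)

lemma pcmp_type [simp]:
  "psrc (q \<bullet> p) = psrc p"
  "psrc q = ptgt p \<Longrightarrow> ptgt (q \<bullet> p) = ptgt q"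
  "\<lbrakk>p \<in> paths; q \<in> paths; psrc q = ptgt p\<rbrakk> \<Longrightarrow> q \<bullet> p \<in> paths"
  by (simp_all add: paths_def pcmp_def psrc_def ptgt_def chain_append chain_end_append)

lemma pten_type [simp]:
  "psrc (p \<otimes>\<^sub>p q) = psrc p \<otimes>\<^sub>w psrc q"
  "ptgt (p \<otimes>\<^sub>p q) = ptgt p \<otimes>\<^sub>w ptgt q"
  "\<lbrakk>p \<in> paths; q \<in> paths\<rbrakk> \<Longrightarrow> p \<otimes>\<^sub>p q \<in> paths"
  by (simp_all add: pten_def)

lemma pcmp_assoc: "(r \<bullet> q) \<bullet> p = r \<bullet> (q \<bullet> p)"
  by (simp add: pcmp_def)

lemma pcmp_pid [simp]: "p \<bullet> pid (psrc p) = p" "pid X \<bullet> p = p"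
  by (simp_all add: pcmp_def pid_def psrc_def)

lemma pten_pid [simp]: "pid X \<otimes>\<^sub>p p = X \<rhd> p" "p \<otimes>\<^sub>p pid X = p \<lhd> X"
  by (simp_all add: pten_def pcmp_def pid_def psrc_def tenl_def tenr_def ptgt_def)

lemma th_rel_type:
  "p \<approx> q \<Longrightarrow> p \<in> paths \<and> q \<in> paths \<and> psrc p = psrc q \<and> ptgt p = ptgt q"
  by (induction rule: th_rel.induct) auto

lemma th_cong_type:
  "p \<sim> q \<Longrightarrow> p \<in> paths \<and> q \<in> paths \<and> psrc p = psrc q \<and> ptgt p = ptgt q"
  by (induction rule: th_cong.induct) (auto dest: th_rel_type)

lemma th_cong_tenl: "p \<sim> q \<Longrightarrow> X \<rhd> p \<sim> X \<rhd> q"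
proof (induction rule: th_cong.induct)
  case (comp p p' q q')
  then show ?case using th_cong.comp[of "X \<rhd> p" "X \<rhd> p'" "X \<rhd> q" "X \<rhd> q'"] by (simp add: tenl_pcmp)
qed (auto intro: th_cong.intros th_rel.tensor_left)

lemma th_cong_tenr: "p \<sim> q \<Longrightarrow> p \<lhd> X \<sim> q \<lhd> X"
proof (induction rule: th_cong.induct)
  case (comp p p' q q')
  then show ?case using th_cong.comp[of "p \<lhd> X" "p' \<lhd> X" "q \<lhd> X" "q' \<lhd> X"] by (simp add: tenr_pcmp)
qed (auto intro: th_cong.intros th_rel.tensor_right)

lemma th_cong_pten: "\<lbrakk>p \<sim> p'; q \<sim> q'\<rbrakk> \<Longrightarrow> p \<otimes>\<^sub>p q \<sim> p' \<otimes>\<^sub>p q'"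
  using th_cong_type[of p p'] th_cong_type[of q q']
  by (auto simp: pten_def intro!: th_cong.comp th_cong_tenl th_cong_tenr)

text \<open>
  The two middle factors act on different sides of the tensor product, so the interchange relation
  swaps them.
\<close>

lemma pten_pcmp:
  assumes "p \<in> paths" "q \<in> paths" "psrc q = ptgt p" "p' \<in> paths" "q' \<in> paths" "psrc q' = ptgt p'"
  shows "(q \<bullet> p) \<otimes>\<^sub>p (q' \<bullet> p') \<sim> (q \<otimes>\<^sub>p q') \<bullet> (p \<otimes>\<^sub>p p')"
proof -
  have "(q \<bullet> p) \<otimes>\<^sub>p (q' \<bullet> p')
      = (q \<lhd> ptgt q') \<bullet> ((p \<lhd> ptgt q') \<bullet> (psrc p \<rhd> q')) \<bullet> (psrc p \<rhd> p')"
    using assms by (simp add: pten_def tenl_pcmp[symmetric] tenr_pcmp[symmetric] pcmp_assoc)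
  also have "\<dots> \<sim> (q \<lhd> ptgt q') \<bullet> ((ptgt p \<rhd> q') \<bullet> (p \<lhd> psrc q')) \<bullet> (psrc p \<rhd> p')"
    by (intro th_cong.comp th_cong.refl th_cong.base th_rel.interchange) (use assms in simp_all)
  also have "\<dots> = (q \<otimes>\<^sub>p q') \<bullet> (p \<otimes>\<^sub>p p')"
    using assms by (simp add: pten_def pcmp_assoc)
  finally show ?thesis .
qed

lemma th_class_eq_iff: "p \<in> paths \<Longrightarrow> th_class p = th_class q \<longleftrightarrow> p \<sim> q"
  unfolding th_class_def using th_cong.refl th_cong.sym th_cong.trans by blast

lemma th_class_eqI: "p \<sim> q \<Longrightarrow> th_class p = th_class q"
  using th_class_eq_iff th_cong_type by blast

lemma th_class_relI: "p \<approx> q \<Longrightarrow> th_class p = th_class q"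
  by (intro th_class_eqI th_cong.base)

text \<open>
  Operations on classes are defined through chosen representatives; this makes them computable on
  any representative.
\<close>

lemma th_rep_cong: "p \<in> paths \<Longrightarrow> th_rep (th_class p) \<sim> p"
  unfolding th_rep_def
  by (rule someI2[of _ p]) (auto simp: th_class_def intro: th_cong.refl th_cong.sym)

abbreviation (input) Th where "Th \<equiv> Th_K_Frob"

lemma Th_simps [simp]:
  "obj Th = UNIV" "X \<boxtimes>\<^bsub>Th\<^esub> Y = X \<otimes>\<^sub>w Y" "\<one>\<^bsub>Th\<^esub> = One" "\<i>\<d>\<^bsub>Th\<^esub> X = th_class (pid X)"
  "\<alpha>\<^bsub>Th\<^esub> X Y Z = th_class \<langle>Alpha X Y Z\<rangle>" "\<ll>\<^bsub>Th\<^esub> X = th_class \<langle>Lam X\<rangle>" "\<rr>\<^bsub>Th\<^esub> X = th_class \<langle>Rho X\<rangle>"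
  "\<tau>\<^bsub>Th\<^esub> X Y = th_class \<langle>Tau X Y\<rangle>"
  by (simp_all add: Th_K_Frob_def)

lemma Th_arr [simp]:
  assumes "p \<in> paths"
  shows "th_class p \<in> arr Th" "src Th (th_class p) = psrc p" "tgt Th (th_class p) = ptgt p"
  using assms th_cong_type[OF th_rep_cong[OF assms]] by (auto simp: Th_K_Frob_def)

lemma Th_cmp [simp]:
  assumes "p \<in> paths" "q \<in> paths" "psrc q = ptgt p"
  shows "th_class q \<cdot>\<^bsub>Th\<^esub> th_class p = th_class (q \<bullet> p)"
proof -
  have "th_rep (th_class q) \<bullet> th_rep (th_class p) \<sim> q \<bullet> p"
    using assms th_rep_cong th_cong_type by (intro th_cong.comp) metis+
  then show ?thesis by (simp add: Th_K_Frob_def th_class_eqI)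
qed

lemma Th_tensor [simp]:
  assumes "p \<in> paths" "q \<in> paths"
  shows "th_class p \<otimes>\<^bsub>Th\<^esub> th_class q = th_class (p \<otimes>\<^sub>p q)"
proof -
  have "th_rep (th_class p) \<otimes>\<^sub>p th_rep (th_class q) \<sim> p \<otimes>\<^sub>p q"
    using assms th_rep_cong by (intro th_cong_pten)
  then show ?thesis by (simp add: Th_K_Frob_def th_class_eqI)
qed

lemma Th_arrE:
  assumes "f \<in> arr Th"
  obtains p where "p \<in> paths" "f = th_class p"
  using assms by (auto simp: Th_K_Frob_def)

lemma Th_homE:
  assumes "f \<in> hom Th X Y"
  obtains p where "p \<in> paths" "f = th_class p" "X = psrc p" "Y = ptgt p"
  using assms by (auto simp: hom_iff elim!: Th_arrE)

lemma Th_isoI: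
  assumes "p \<in> paths" "q \<in> paths" "psrc q = ptgt p" "ptgt q = psrc p"
    "q \<bullet> p \<approx> pid (psrc p)" "p \<bullet> q \<approx> pid (ptgt p)"
  shows "inverse_arrows Th (th_class p) (th_class q)" "iso Th (th_class p)"
proof -
  show "inverse_arrows Th (th_class p) (th_class q)"
    using assms by (simp add: inverse_arrows_def hom_iff th_class_relI)
  then show "iso Th (th_class p)" by (auto simp: iso_def)
qed

lemma Th_inverse:
  "inverse_arrows Th (th_class \<langle>Alpha X Y Z\<rangle>) (th_class \<langle>AlphaBar X Y Z\<rangle>)"
  "inverse_arrows Th (th_class \<langle>Lam X\<rangle>) (th_class \<langle>LamBar X\<rangle>)"
  "inverse_arrows Th (th_class \<langle>Rho X\<rangle>) (th_class \<langle>RhoBar X\<rangle>)"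
  "inverse_arrows Th (th_class \<langle>Tau X Y\<rangle>) (th_class \<langle>TauBar X Y\<rangle>)"
  by (intro Th_isoI; simp add: th_rel.intros)+

text \<open>
  The relations are the axioms, read on classes.
\<close>

theorem symmetric_monoidal_category_Th: "symmetric_monoidal_category Th"
\<comment> \<open>The cases are numbered in the order of the axioms in the two locale definitions.\<close>
proof (unfold_locales, goal_cases)
  case (1 f) then show ?case by simp
next
  case (2 f) then show ?case by simp
next
  case (3 X) then show ?case by (simp add: hom_iff)
next
  case (4 f X Y g Z) then show ?case by - (elim Th_homE, auto simp: hom_iff)
next
  case (5 f X Y) then show ?case by (auto elim!: Th_homE)
next
  case (6 f X Y) then show ?case by (auto elim!: Th_homE)
next
  case (7 f W X g Y h Z) then show ?case by (auto elim!: Th_homE simp: pcmp_assoc)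
next
  case (10 f X Y g X' Y') then show ?case by - (elim Th_homE, auto simp: hom_iff)
next
  case (11 X Y) then show ?case by (simp add: tenl_pid tenr_pid)
next
  case (12 f X Y g Z f' X' Y' g' Z')
  then show ?case by - (elim Th_homE, simp, rule th_class_eqI, rule pten_pcmp, simp_all)
next
  case (13 X Y Z) then show ?case using Th_inverse(1) by (auto simp: hom_iff iso_def)
next
  case (14 X) then show ?case using Th_inverse(2) by (auto simp: hom_iff iso_def)
next
  case (15 X) then show ?case using Th_inverse(3) by (auto simp: hom_iff iso_def)
next
  case (17 f X X' g Y Y' h Z Z')
  then show ?case by - (elim Th_homE, simp, rule th_class_relI, rule th_rel.alpha_natural, simp_all)
next
  case (18 f X X') then show ?case by - (elim Th_homE, simp, rule th_class_relI, rule th_rel.lam_natural, simp_all)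
next
  case (19 f X X') then show ?case by - (elim Th_homE, simp, rule th_class_relI, rule th_rel.rho_natural, simp_all)
next
  case (20 f X X' g Y Y') then show ?case by - (elim Th_homE, simp, rule th_class_relI, rule th_rel.tau_natural, simp_all)
next
  case (21 W X Y Z) then show ?case by (simp add: th_class_relI th_rel.pentagon)
next
  case (22 X Y) then show ?case by (simp add: th_class_relI th_rel.triangle)
next
  case (23 X Y) then show ?case by (simp add: th_class_relI th_rel.braid_symmetric)
next
  case (24 X) then show ?case by (simp add: th_class_relI th_rel.braid_unit)
next
  case (25 X Y Z) then show ?case by (simp add: th_class_relI th_rel.hexagon)
qed (simp_all add: hom_iff)

section \<open>Interpreting paths in a symmetric monoidal category\<close>

text \<open>
  The relations that are common to both algebras are indexed by a colour; so are their
  interpretations.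
\<close>

fun coloured_alg :: "('o, 'a) kfrob \<Rightarrow> colour \<Rightarrow> ('o, 'a) frobenius" where
  "coloured_alg K Op = open_alg K"
| "coloured_alg K Cl = closed_alg K"

text \<open>
  Structure maps of the right types, with no equations assumed. Paths are interpreted at this
  generality because the axioms of the algebra obtained from a functor are derived from its
  interpretation of paths.
\<close>

locale kfrob_data = symmetric_monoidal_category C
  for C :: "('o, 'a) sm_data" (structure) +
  fixes K :: "('o, 'a) kfrob"
  assumes car_obj: "car (coloured_alg K c) \<in> obj C"
    and mu_hom: "mu (coloured_alg K c) \<in> hom C (car (coloured_alg K c) \<boxtimes> car (coloured_alg K c)) (car (coloured_alg K c))"
    and eta_hom: "eta (coloured_alg K c) \<in> hom C \<one> (car (coloured_alg K c))"
    and delta_hom: "delta (coloured_alg K c) \<in> hom C (car (coloured_alg K c)) (car (coloured_alg K c) \<boxtimes> car (coloured_alg K c))"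
    and eps_hom: "eps (coloured_alg K c) \<in> hom C (car (coloured_alg K c)) \<one>"
    and iota_data: "iota K \<in> hom C (carC K) (carA K)"
    and iota_star_data: "iota_star K \<in> hom C (carA K) (carC K)"

context symmetric_monoidal_category
begin

fun word_int :: "('o, 'a) kfrob \<Rightarrow> word \<Rightarrow> 'o" where
  "word_int K One = \<one>"
| "word_int K (Gen c) = car (coloured_alg K c)"
| "word_int K (X \<otimes>\<^sub>w Y) = word_int K X \<boxtimes> word_int K Y"

fun edge_int :: "('o, 'a) kfrob \<Rightarrow> edge \<Rightarrow> 'a" where
  "edge_int K (Mu c) = mu (coloured_alg K c)"
| "edge_int K (Eta c) = eta (coloured_alg K c)"
| "edge_int K (Delta c) = delta (coloured_alg K c)"
| "edge_int K (Eps c) = eps (coloured_alg K c)"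
| "edge_int K Iota = iota K"
| "edge_int K IotaStar = iota_star K"
| "edge_int K (Alpha X Y Z) = \<alpha> (word_int K X) (word_int K Y) (word_int K Z)"
| "edge_int K (AlphaBar X Y Z) = iv (\<alpha> (word_int K X) (word_int K Y) (word_int K Z))"
| "edge_int K (Tau X Y) = \<tau> (word_int K X) (word_int K Y)"
| "edge_int K (TauBar X Y) = \<tau> (word_int K Y) (word_int K X)"
| "edge_int K (Lam X) = \<ll> (word_int K X)"
| "edge_int K (LamBar X) = iv (\<ll> (word_int K X))"
| "edge_int K (Rho X) = \<rr> (word_int K X)"
| "edge_int K (RhoBar X) = iv (\<rr> (word_int K X))"
| "edge_int K (TenL Z f) = \<i>\<d> (word_int K Z) \<otimes> edge_int K f"
| "edge_int K (TenR f Z) = edge_int K f \<otimes> \<i>\<d> (word_int K Z)"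

fun chain_int :: "('o, 'a) kfrob \<Rightarrow> word \<Rightarrow> edge list \<Rightarrow> 'a" where
  "chain_int K X [] = \<i>\<d> (word_int K X)"
| "chain_int K X (e # es) = chain_int K (etgt e) es \<cdot> edge_int K e"

definition path_int :: "('o, 'a) kfrob \<Rightarrow> path \<Rightarrow> 'a" where
  "path_int K p = chain_int K (fst p) (snd p)"

end

context kfrob_data
begin

lemma data_arr [simp]:
  "car (coloured_alg K c) \<in> obj C"
  "mu (coloured_alg K c) \<in> arr C" "src C (mu (coloured_alg K c)) = car (coloured_alg K c) \<boxtimes> car (coloured_alg K c)"
  "tgt C (mu (coloured_alg K c)) = car (coloured_alg K c)"
  "eta (coloured_alg K c) \<in> arr C" "src C (eta (coloured_alg K c)) = \<one>" "tgt C (eta (coloured_alg K c)) = car (coloured_alg K c)"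
  "delta (coloured_alg K c) \<in> arr C" "src C (delta (coloured_alg K c)) = car (coloured_alg K c)"
  "tgt C (delta (coloured_alg K c)) = car (coloured_alg K c) \<boxtimes> car (coloured_alg K c)"
  "eps (coloured_alg K c) \<in> arr C" "src C (eps (coloured_alg K c)) = car (coloured_alg K c)" "tgt C (eps (coloured_alg K c)) = \<one>"
  "iota K \<in> arr C" "src C (iota K) = carC K" "tgt C (iota K) = carA K"
  "iota_star K \<in> arr C" "src C (iota_star K) = carA K" "tgt C (iota_star K) = carC K"
  using car_obj[of c] mu_hom[of c] eta_hom[of c] delta_hom[of c] eps_hom[of c] iota_data iota_star_data
  by (simp_all add: hom_iff)

lemmas data_arr_open [simp] = data_arr(1-13)[of Op, simplified]
lemmas data_arr_closed [simp] = data_arr(1-13)[of Cl, simplified]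

lemma word_int_obj [simp]: "word_int K X \<in> obj C"
  by (induction X) auto

lemma edge_int_arr [simp]:
  "edge_int K e \<in> arr C" "src C (edge_int K e) = word_int K (esrc e)" "tgt C (edge_int K e) = word_int K (etgt e)"
  by (induction e) auto

lemma chain_int_arr [simp]:
  assumes "chain X es"
  shows "chain_int K X es \<in> arr C" "src C (chain_int K X es) = word_int K X"
    "tgt C (chain_int K X es) = word_int K (chain_end X es)"
  using assms by (induction X es rule: chain.induct) auto

lemma path_int_arr [simp]:
  assumes "p \<in> paths"
  shows "path_int K p \<in> arr C" "src C (path_int K p) = word_int K (psrc p)" "tgt C (path_int K p) = word_int K (ptgt p)"
  using assms by (auto simp: path_int_def paths_def psrc_def ptgt_def)

lemma path_int_pid [simp]: "path_int K (pid X) = \<i>\<d> (word_int K X)"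
  by (simp add: path_int_def pid_def)

lemma path_int_edge [simp]: "path_int K \<langle>e\<rangle> = edge_int K e"
  by (simp add: path_int_def pedge_def)

lemma chain_int_append:
  "chain X es \<Longrightarrow> chain (chain_end X es) fs \<Longrightarrow>
   chain_int K X (es @ fs) = chain_int K (chain_end X es) fs \<cdot> chain_int K X es"
  by (induction X es rule: chain.induct) auto

lemma path_int_pcmp [simp]:
  "\<lbrakk>p \<in> paths; q \<in> paths; psrc q = ptgt p\<rbrakk> \<Longrightarrow> path_int K (q \<bullet> p) = path_int K q \<cdot> path_int K p"
  by (auto simp: path_int_def pcmp_def paths_def psrc_def ptgt_def chain_int_append)

lemma chain_int_tensor:
  assumes "chain X es"
  shows "chain_int K (Z \<otimes>\<^sub>w X) (map (TenL Z) es) = \<i>\<d> (word_int K Z) \<otimes> chain_int K X es"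
    "chain_int K (X \<otimes>\<^sub>w Z) (map (\<lambda>e. TenR e Z) es) = chain_int K X es \<otimes> \<i>\<d> (word_int K Z)"
  using assms by (induction X es rule: chain.induct) (auto simp: tensor_cmp')

lemma path_int_tensor [simp]:
  assumes "p \<in> paths"
  shows "path_int K (X \<rhd> p) = \<i>\<d> (word_int K X) \<otimes> path_int K p"
    "path_int K (p \<lhd> X) = path_int K p \<otimes> \<i>\<d> (word_int K X)"
  using assms by (auto simp: path_int_def tenl_def tenr_def paths_def chain_int_tensor)

lemma path_int_pten [simp]:
  assumes "p \<in> paths" "q \<in> paths"
  shows "path_int K (p \<otimes>\<^sub>p q) = path_int K p \<otimes> path_int K q"
  using assms by (simp add: pten_def tensor_cmp')

end

lemma knowledgeable_data:
  assumes "knowledgeable_frobenius_algebra C K"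
  shows "kfrob_data C K"
proof -
  interpret knowledgeable_frobenius_algebra C K by fact
  show ?thesis
  proof (unfold_locales, goal_cases)
    case (1 c) show ?case by (cases c) (simp_all add: A.alg_obj C.alg_obj)
  next
    case (2 c) show ?case by (cases c) (simp_all add: A.mult_hom C.mult_hom)
  next
    case (3 c) show ?case by (cases c) (simp_all add: A.unit_hom C.unit_hom)
  next
    case (4 c) show ?case by (cases c) (simp_all add: A.comult_hom C.comult_hom)
  next
    case (5 c) show ?case by (cases c) (simp_all add: A.counit_hom C.counit_hom)
  qed (use iota_hom iota_star_hom in \<open>auto simp: algebra_hom_def\<close>)
qed

text \<open>
  Each relation becomes an axiom of the algebra, an axiom or a naturality square of
  \<open>C\<close>, or the fact that two constraints are inverse; tensoring a relation with a word
  becomes tensoring an equation with an identity.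
\<close>

lemma path_int_sound:
  assumes "knowledgeable_frobenius_algebra C K" "p \<approx> q"
  shows "symmetric_monoidal_category.path_int C K p = symmetric_monoidal_category.path_int C K q"
proof -
  interpret knowledgeable_frobenius_algebra C K by fact
  interpret kfrob_data C K using assms(1) by (rule knowledgeable_data)
  interpret alg: frobenius_algebra C "coloured_alg K c" for c
    by (cases c) (simp_all add: A.frobenius_algebra_axioms C.frobenius_algebra_axioms)
  note iota_laws = knowledge duality cardy
  show ?thesis using assms(2)
  proof (induction rule: th_rel.induct)
    case (mult_assoc c) show ?case using alg.mult_assoc[of c] by simp
  next
    case (mult_lunit c) show ?case using alg.mult_lunit[of c] by simp
  next
    case (mult_runit c) show ?case using alg.mult_runit[of c] by simp
  next
    case (comult_coassoc c) show ?case using alg.comult_coassoc[of c] by simp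
  next
    case (comult_lcounit c) show ?case using alg.comult_lcounit[of c] by simp
  next
    case (comult_rcounit c) show ?case using alg.comult_rcounit[of c] by simp
  next
    case (frobenius_left c) show ?case using alg.frobenius_left[of c] by simp
  next
    case (frobenius_right c) show ?case using alg.frobenius_right[of c] by simp
  next
    case symmetric show ?case using A.symmetric by simp
  next
    case commutative show ?case using C.commutative by simp
  next
    case iota_mult show ?case using iota_hom by (simp add: algebra_hom_def)
  next
    case iota_unit show ?case using iota_hom by (simp add: algebra_hom_def)
  next
    case knowledge show ?case using iota_laws by simp
  next
    case duality show ?case using iota_laws by simp
  next
    case cardy show ?case using iota_laws by simp
  next
    case (pentagon W X Y Z) show ?case by (simp add: A.pentagon)
  next
    case (triangle X Y) show ?case by (simp add: A.triangle)
  next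
    case (braid_symmetric Y X) show ?case by (simp add: A.braid_symmetric)
  next
    case (braid_unit X) show ?case by (simp add: A.braid_unit)
  next
    case (hexagon Y Z X) show ?case by (simp add: A.hexagon)
  next
    case (interchange t s) then show ?case by (simp add: A.tensor_cmp')
  next
    case (alpha_natural p q r) then show ?case by (simp add: A.assoc_natural')
  next
    case (alphabar_natural p q r) then show ?case by (simp add: A.assoc_inv_natural)
  next
    case (tau_natural p q) then show ?case by (simp add: A.braid_natural')
  next
    case (taubar_natural p q) then show ?case by (simp add: A.braid_natural')
  next
    case (lam_natural p) then show ?case by (simp add: A.lunit_natural')
  next
    case (lambar_natural p) then show ?case by (simp add: A.lunit_inv_natural)
  next
    case (rho_natural p) then show ?case by (simp add: A.runit_natural')
  next
    case (rhobar_natural p) then show ?case by (simp add: A.runit_inv_natural)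
  next
    case (tau_inv1 X Y) show ?case by (simp add: A.braid_symmetric)
  next
    case (tau_inv2 X Y) show ?case by (simp add: A.braid_symmetric)
  next
    case (tensor_left p q X) then show ?case using th_rel_type[of p q] by simp
  next
    case (tensor_right p q X) then show ?case using th_rel_type[of p q] by simp
  qed simp_all
qed

text \<open>
  The axioms of the algebra are among the interpreted relations.
\<close>

lemma path_int_complete:
  assumes "kfrob_data C K"
    and rel: "\<And>p q. p \<approx> q \<Longrightarrow> symmetric_monoidal_category.path_int C K p = symmetric_monoidal_category.path_int C K q"
  shows "knowledgeable_frobenius_algebra C K"
proof -
  interpret kfrob_data C K by fact
  \<comment> \<open>The equational axioms; the remaining ones are the typing assumptions.\<close>
  have "frobenius_algebra C (coloured_alg K c)" for c
  proof (unfold_locales, goal_cases)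
    case 4 show ?case using rel[OF th_rel.mult_assoc[of c]] by simp
  next
    case 5 show ?case using rel[OF th_rel.mult_lunit[of c]] by simp
  next
    case 6 show ?case using rel[OF th_rel.mult_runit[of c]] by simp
  next
    case 9 show ?case using rel[OF th_rel.comult_coassoc[of c]] by simp
  next
    case 10 show ?case using rel[OF th_rel.comult_lcounit[of c]] by simp
  next
    case 11 show ?case using rel[OF th_rel.comult_rcounit[of c]] by simp
  next
    case 12 show ?case using rel[OF th_rel.frobenius_left[of c]] by simp
  next
    case 13 show ?case using rel[OF th_rel.frobenius_right[of c]] by simp
  qed (simp_all add: hom_iff)
  from this[of Op] this[of Cl]
  interpret A: frobenius_algebra C "open_alg K" + C: frobenius_algebra C "closed_alg K" by simp_all
  show ?thesis
  proof (unfold_locales, goal_cases)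
    case 1 show ?case using rel[OF th_rel.symmetric] by simp
  next
    case 2 show ?case using rel[OF th_rel.commutative] by simp
  next
    case 3 show ?case using rel[OF th_rel.iota_mult] rel[OF th_rel.iota_unit] by (simp add: algebra_hom_def hom_iff)
  next
    case 4 show ?case by (simp add: hom_iff)
  next
    case 5 show ?case using rel[OF th_rel.knowledge] by simp
  next
    case 6 show ?case using rel[OF th_rel.duality] by simp
  next
    case 7 show ?case using rel[OF th_rel.cardy] by simp
  qed
qed

section \<open>Strict equivalences\<close>

text \<open>
  A map that preserves all the structure strictly, onto on objects and on each hom set. The target
  is bare data whose arrows end in its objects; that it is a symmetric monoidal category is a
  conclusion.
\<close>

locale strict_full_surjection = symmetric_monoidal_category D
  for D :: "('o1, 'a1) sm_data" (structure) +
  fixes E :: "('o2, 'a2) sm_data" and Fo :: "'o1 \<Rightarrow> 'o2" and Fa :: "'a1 \<Rightarrow> 'a2"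
  assumes obj_onto: "obj E = Fo ` obj D"
    and arr_ends: "h \<in> arr E \<Longrightarrow> src E h \<in> obj E \<and> tgt E h \<in> obj E"
    and hom_onto: "\<lbrakk>X \<in> obj D; Y \<in> obj D\<rbrakk> \<Longrightarrow> hom E (Fo X) (Fo Y) = Fa ` hom D X Y"
    and strict_id: "X \<in> obj D \<Longrightarrow> \<i>\<d>\<^bsub>E\<^esub> (Fo X) = Fa (\<i>\<d> X)"
    and strict_cmp: "\<lbrakk>f \<in> arr D; g \<in> arr D; src D g = tgt D f\<rbrakk> \<Longrightarrow> Fa g \<cdot>\<^bsub>E\<^esub> Fa f = Fa (g \<cdot> f)"
    and strict_tensor_obj: "\<lbrakk>X \<in> obj D; Y \<in> obj D\<rbrakk> \<Longrightarrow> Fo X \<boxtimes>\<^bsub>E\<^esub> Fo Y = Fo (X \<boxtimes> Y)"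
    and strict_unit_obj: "\<one>\<^bsub>E\<^esub> = Fo \<one>"
    and strict_tensor_arr: "\<lbrakk>f \<in> arr D; g \<in> arr D\<rbrakk> \<Longrightarrow> Fa f \<otimes>\<^bsub>E\<^esub> Fa g = Fa (f \<otimes> g)"
    and strict_assoc: "\<lbrakk>X \<in> obj D; Y \<in> obj D; Z \<in> obj D\<rbrakk> \<Longrightarrow> \<alpha>\<^bsub>E\<^esub> (Fo X) (Fo Y) (Fo Z) = Fa (\<alpha> X Y Z)"
    and strict_lunit: "X \<in> obj D \<Longrightarrow> \<ll>\<^bsub>E\<^esub> (Fo X) = Fa (\<ll> X)"
    and strict_runit: "X \<in> obj D \<Longrightarrow> \<rr>\<^bsub>E\<^esub> (Fo X) = Fa (\<rr> X)"
    and strict_braid: "\<lbrakk>X \<in> obj D; Y \<in> obj D\<rbrakk> \<Longrightarrow> \<tau>\<^bsub>E\<^esub> (Fo X) (Fo Y) = Fa (\<tau> X Y)"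
begin

lemmas strict = strict_id strict_cmp strict_tensor_obj strict_unit_obj strict_tensor_arr
  strict_assoc strict_lunit strict_runit strict_braid

lemma Fo_obj [simp]: "X \<in> obj D \<Longrightarrow> Fo X \<in> obj E"
  by (simp add: obj_onto)

lemma Fa_arr [simp]:
  assumes "f \<in> arr D"
  shows "Fa f \<in> arr E" "src E (Fa f) = Fo (src D f)" "tgt E (Fa f) = Fo (tgt D f)"
proof -
  have "Fa f \<in> hom E (Fo (src D f)) (Fo (tgt D f))"
    using assms by (simp add: hom_onto hom_iff)
  then show "Fa f \<in> arr E" "src E (Fa f) = Fo (src D f)" "tgt E (Fa f) = Fo (tgt D f)"
    by (simp_all add: hom_iff)
qed

definition sec :: "'o2 \<Rightarrow> 'o1" where
  "sec Y = (SOME X. X \<in> obj D \<and> Fo X = Y)"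

lemma sec [simp]:
  assumes "Y \<in> obj E"
  shows "sec Y \<in> obj D" "Fo (sec Y) = Y"
proof -
  have "\<exists>X. X \<in> obj D \<and> Fo X = Y" using assms by (auto simp: obj_onto)
  from someI_ex[OF this] show "sec Y \<in> obj D" "Fo (sec Y) = Y"
    by (simp_all add: sec_def)
qed

text \<open>
  On a hom set this picks some preimage; it is the inverse of \<open>Fa\<close> there once
  \<open>Fa\<close> is faithful.
\<close>

definition lift :: "'o1 \<Rightarrow> 'o1 \<Rightarrow> 'a2 \<Rightarrow> 'a1" where
  "lift X Y f = (SOME f'. f' \<in> hom D X Y \<and> Fa f' = f)"

lemma lift [simp]:
  assumes "X \<in> obj D" "Y \<in> obj D" "f \<in> arr E" "src E f = Fo X" "tgt E f = Fo Y"
  shows "lift X Y f \<in> arr D" "src D (lift X Y f) = X" "tgt D (lift X Y f) = Y" "Fa (lift X Y f) = f"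
proof -
  have "f \<in> hom E (Fo X) (Fo Y)" using assms by (simp add: hom_iff)
  then have "f \<in> Fa ` hom D X Y" using assms(1,2) by (simp only: hom_onto)
  then have "\<exists>f'. f' \<in> hom D X Y \<and> Fa f' = f" by blast
  from someI_ex[OF this] show "lift X Y f \<in> arr D" "src D (lift X Y f) = X" "tgt D (lift X Y f) = Y"
    "Fa (lift X Y f) = f"
    by (simp_all add: lift_def hom_iff)
qed

definition sec_arr :: "'a2 \<Rightarrow> 'a1" where
  "sec_arr f = lift (sec (src E f)) (sec (tgt E f)) f"

lemma sec_arr:
  assumes "f \<in> hom E X Y"
  shows "sec_arr f \<in> arr D" "src D (sec_arr f) = sec X" "tgt D (sec_arr f) = sec Y"
    "sec X \<in> obj D" "sec Y \<in> obj D" "Fo (sec X) = X" "Fo (sec Y) = Y" "Fa (sec_arr f) = f"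
proof -
  have "f \<in> arr E" "src E f = X" "tgt E f = Y" "X \<in> obj E" "Y \<in> obj E"
    using assms arr_ends[of f] by (auto simp: hom_iff)
  then show "sec_arr f \<in> arr D" "src D (sec_arr f) = sec X" "tgt D (sec_arr f) = sec Y"
    "sec X \<in> obj D" "sec Y \<in> obj D" "Fo (sec X) = X" "Fo (sec Y) = Y" "Fa (sec_arr f) = f"
    by (simp_all add: sec_arr_def)
qed

lemma obj_lift:
  assumes "X \<in> obj E"
  obtains X' where "X' \<in> obj D" "X = Fo X'"
  using assms by (auto simp: obj_onto)

lemma hom_lift:
  assumes "f \<in> hom E X Y"
  obtains f' where "f' \<in> arr D" "f = Fa f'" "X = Fo (src D f')" "Y = Fo (tgt D f')"
  using that[of "sec_arr f"] sec_arr[OF assms] by metis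

lemma Fa_iso: "iso D f \<Longrightarrow> iso E (Fa f)"
  using iso_arr[of f] unfolding iso_def[of E] inverse_arrows_def
  by (intro exI[of _ "Fa (iv f)"]) (simp add: hom_iff strict)

text \<open>
  Each object is lifted once, by \<open>sec\<close>, and each arrow to an arrow between the lifted
  end points; the lifts of composable arrows are then composable, and the equation to be shown is
  the image of an axiom of \<open>D\<close>.
\<close>

theorem symmetric_monoidal_category_image: "symmetric_monoidal_category E"
\<comment> \<open>The cases are numbered in the order of the axioms in the two locale definitions.\<close>
proof (unfold_locales, goal_cases)
  case (1 f) then show ?case using arr_ends by blast
next
  case (2 f) then show ?case using arr_ends by blast
next
  case (3 X) then show ?case using strict_id[of "sec X"] by (simp add: hom_iff)
next
  case (4 f X Y g Z)
  note f = sec_arr[OF 4(1)]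
  note g = sec_arr[OF 4(2)]
  have "Fa (sec_arr g) \<cdot>\<^bsub>E\<^esub> Fa (sec_arr f) \<in> hom E (Fo (sec X)) (Fo (sec Z))"
    using f(1-5) g(1-5) by (simp add: hom_iff strict)
  then show ?case using 4 by (simp add: f(6-8) g(6-8))
next
  case (5 f X Y) then show ?case by - (elim hom_lift, simp add: strict)
next
  case (6 f X Y) then show ?case by - (elim hom_lift, simp add: strict)
next
  case (7 f W X g Y h Z)
  note f = sec_arr[OF 7(1)]
  note g = sec_arr[OF 7(2)]
  note h = sec_arr[OF 7(3)]
  have "(Fa (sec_arr h) \<cdot>\<^bsub>E\<^esub> Fa (sec_arr g)) \<cdot>\<^bsub>E\<^esub> Fa (sec_arr f) = Fa (sec_arr h) \<cdot>\<^bsub>E\<^esub> Fa (sec_arr g) \<cdot>\<^bsub>E\<^esub> Fa (sec_arr f)"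
    using f(1-5) g(1-5) h(1-5) by (simp add: strict)
  then show ?case using 7 by (simp add: f(6-8) g(6-8) h(6-8))
next
  case (8 X Y) then show ?case
    using strict_tensor_obj[of "sec X" "sec Y"] Fo_obj[of "sec X \<boxtimes> sec Y"] by simp
next
  case 9 then show ?case by (simp add: strict)
next
  case (10 f X Y g X1 Y1) then show ?case by - (elim hom_lift, simp add: strict hom_iff)
next
  case (11 X Y) then show ?case by - (elim obj_lift, simp add: strict)
next
  case (12 f X Y g Z f1 X1 Y1 g1 Z1)
  note f = sec_arr[OF 12(1)]
  note g = sec_arr[OF 12(2)]
  note f1 = sec_arr[OF 12(3)]
  note g1 = sec_arr[OF 12(4)]
  have "(Fa (sec_arr g) \<cdot>\<^bsub>E\<^esub> Fa (sec_arr f)) \<otimes>\<^bsub>E\<^esub> (Fa (sec_arr g1) \<cdot>\<^bsub>E\<^esub> Fa (sec_arr f1)) = (Fa (sec_arr g) \<otimes>\<^bsub>E\<^esub> Fa (sec_arr g1)) \<cdot>\<^bsub>E\<^esub> (Fa (sec_arr f) \<otimes>\<^bsub>E\<^esub> Fa (sec_arr f1))"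
    using f(1-5) g(1-5) f1(1-5) g1(1-5) by (simp add: strict tensor_cmp')
  then show ?case using 12 by (simp add: f(6-8) g(6-8) f1(6-8) g1(6-8))
next
  case (13 X Y Z) then show ?case by - (elim obj_lift, simp add: strict Fa_iso hom_iff)
next
  case (14 X) then show ?case by - (elim obj_lift, simp add: strict Fa_iso hom_iff)
next
  case (15 X) then show ?case by - (elim obj_lift, simp add: strict Fa_iso hom_iff)
next
  case (16 X Y) then show ?case by - (elim obj_lift, simp add: strict hom_iff)
next
  case (17 f X X1 g Y Y1 h Z Z1) then show ?case by - (elim hom_lift, simp add: strict assoc_natural')
next
  case (18 f X Y) then show ?case by - (elim hom_lift, simp add: strict lunit_natural')
next
  case (19 f X Y) then show ?case by - (elim hom_lift, simp add: strict runit_natural')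
next
  case (20 f X X1 g Y Y1) then show ?case by - (elim hom_lift, simp add: strict braid_natural')
next
  case (21 W X Y Z) then show ?case by - (elim obj_lift, simp add: strict pentagon)
next
  case (22 X Y) then show ?case by - (elim obj_lift, simp add: strict triangle)
next
  case (23 X Y) then show ?case by - (elim obj_lift, simp add: strict braid_symmetric)
next
  case (24 X) then show ?case by - (elim obj_lift, simp add: strict braid_unit)
next
  case (25 X Y Z) then show ?case by - (elim obj_lift, simp add: strict hexagon)
qed

end

locale strict_equivalence = strict_full_surjection D E Fo Fa
  for D :: "('o1, 'a1) sm_data" (structure) and E :: "('o2, 'a2) sm_data"
    and Fo :: "'o1 \<Rightarrow> 'o2" and Fa :: "'a1 \<Rightarrow> 'a2" +
  assumes faithful: "\<lbrakk>f \<in> arr D; g \<in> arr D; src D f = src D g; tgt D f = tgt D g; Fa f = Fa g\<rbrakk> \<Longrightarrow> f = g"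
begin

interpretation E: symmetric_monoidal_category E
  by (rule symmetric_monoidal_category_image)

text \<open>
  Objects with the same image are canonically isomorphic, by the lift of the identity; these lifts
  make up all structure maps and both natural isomorphisms of the equivalence.
\<close>

lemma lift_id_iso:
  assumes "X \<in> obj D" "Y \<in> obj D" "Fo X = Fo Y" "Z = Fo X"
  shows "iso D (lift X Y (\<i>\<d>\<^bsub>E\<^esub> Z))"
proof -
  have "iso D (lift X Y (\<i>\<d>\<^bsub>E\<^esub> Z)) \<and> iv (lift X Y (\<i>\<d>\<^bsub>E\<^esub> Z)) = lift Y X (\<i>\<d>\<^bsub>E\<^esub> Z)"
    by (rule isoI) (use assms in \<open>simp_all, auto intro!: faithful simp: strict_cmp[symmetric] strict_id[symmetric]\<close>)
  then show ?thesis ..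
qed

definition strict_functor :: "('o1, 'a1, 'o2, 'a2) mon_functor" where
  "strict_functor = \<lparr>fobj = Fo, farr = Fa, ften = (\<lambda>X Y. \<i>\<d>\<^bsub>E\<^esub> (Fo (X \<boxtimes> Y))), funit = \<i>\<d>\<^bsub>E\<^esub> (Fo \<one>)\<rparr>"

definition section_functor :: "('o2, 'a2, 'o1, 'a1) mon_functor" where
  "section_functor =
     \<lparr>fobj = sec,
      farr = (\<lambda>f. lift (sec (src E f)) (sec (tgt E f)) f),
      ften = (\<lambda>X Y. lift (sec X \<boxtimes> sec Y) (sec (X \<boxtimes>\<^bsub>E\<^esub> Y)) (\<i>\<d>\<^bsub>E\<^esub> (X \<boxtimes>\<^bsub>E\<^esub> Y))),
      funit = lift \<one> (sec \<one>\<^bsub>E\<^esub>) (\<i>\<d>\<^bsub>E\<^esub> \<one>\<^bsub>E\<^esub>)\<rparr>"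

text \<open>
  Read from right to left, strictness pushes \<open>Fa\<close> inwards to the lifts, where it
  cancels.
\<close>

lemmas image = strict_id[symmetric] strict_cmp[symmetric] strict_tensor_obj[symmetric]
  strict_tensor_arr[symmetric] strict_unit_obj[symmetric]
  strict_assoc[symmetric] strict_lunit[symmetric] strict_runit[symmetric] strict_braid[symmetric]

lemma strict_functor: "symmetric_monoidal_functor D E strict_functor"
  by (rule symmetric_monoidal_functorI[OF symmetric_monoidal_category_axioms symmetric_monoidal_category_image])
    (simp_all add: strict_functor_def image)

text \<open>
  By faithfulness every equation may be checked after applying \<open>Fa\<close>, where all
  structure maps of the section become identities.
\<close>

lemma section_functor: "symmetric_monoidal_functor E D section_functor"
proof (rule symmetric_monoidal_functorI[OF symmetric_monoidal_category_image symmetric_monoidal_category_axioms], goal_cases)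
  case (5 X Y)
  then show ?case by (simp add: section_functor_def image lift_id_iso)
next
  case 6
  then show ?case by (simp add: section_functor_def image lift_id_iso)
qed (auto intro!: faithful simp: section_functor_def image)

lemma unit_transformation:
  "monoidal_transformation D D (mon_functor_id D) (mon_functor_comp D section_functor strict_functor)
     (\<lambda>X. lift X (sec (Fo X)) (\<i>\<d>\<^bsub>E\<^esub> (Fo X)))"
  by (rule monoidal_transformationI[OF identity_functor composite_functor[OF strict_functor section_functor]])
    (auto intro!: faithful
      simp: mon_functor_id_def mon_functor_comp_def strict_functor_def section_functor_def image)

lemma counit_transformation:
  "monoidal_transformation E E (mon_functor_comp E strict_functor section_functor) (mon_functor_id E)
     (\<lambda>Y. \<i>\<d>\<^bsub>E\<^esub> Y)"
  by (rule monoidal_transformationI[OF E.composite_functor[OF section_functor strict_functor] E.identity_functor])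
    (simp_all add: mon_functor_id_def mon_functor_comp_def strict_functor_def section_functor_def image)

theorem symmetric_monoidal_equivalence: "symmetric_monoidal_equivalent D E"
  unfolding symmetric_monoidal_equivalent_def
proof (intro conjI exI)
  show "\<forall>X\<in>obj D. iso D (lift X (sec (Fo X)) (\<i>\<d>\<^bsub>E\<^esub> (Fo X)))" by (simp add: lift_id_iso)
  show "\<forall>Y\<in>obj E. iso E (\<i>\<d>\<^bsub>E\<^esub> Y)" by simp
qed (rule symmetric_monoidal_category_axioms symmetric_monoidal_category_image strict_functor section_functor
    unit_transformation counit_transformation)+

end

section \<open>Evaluating functors at the generic algebra\<close>

text \<open>
  The image of an algebra under a strong monoidal functor: the operations are composed with the
  structure maps, or with their inverses where the functor's values have to be split.
\<close>

definition eval_alg :: "('o, 'a) sm_data \<Rightarrow> (word, path set, 'o, 'a) mon_functor \<Rightarrow> colour \<Rightarrow> ('o, 'a) frobenius" where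
  "eval_alg C F c =
     \<lparr>car = fobj F (Gen c),
      mu = farr F (th_class \<langle>Mu c\<rangle>) \<cdot>\<^bsub>C\<^esub> ften F (Gen c) (Gen c),
      eta = farr F (th_class \<langle>Eta c\<rangle>) \<cdot>\<^bsub>C\<^esub> funit F,
      delta = inverse_arrow C (ften F (Gen c) (Gen c)) \<cdot>\<^bsub>C\<^esub> farr F (th_class \<langle>Delta c\<rangle>),
      eps = inverse_arrow C (funit F) \<cdot>\<^bsub>C\<^esub> farr F (th_class \<langle>Eps c\<rangle>)\<rparr>"

definition eval :: "('o, 'a) sm_data \<Rightarrow> (word, path set, 'o, 'a) mon_functor \<Rightarrow> ('o, 'a) kfrob" where
  "eval C F =
     \<lparr>open_alg = eval_alg C F Op, closed_alg = eval_alg C F Cl,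
      iota = farr F (th_class \<langle>Iota\<rangle>), iota_star = farr F (th_class \<langle>IotaStar\<rangle>)\<rparr>"

lemma eval_simps [simp]:
  "coloured_alg (eval C F) c = eval_alg C F c"
  "open_alg (eval C F) = eval_alg C F Op" "closed_alg (eval C F) = eval_alg C F Cl"
  "iota (eval C F) = farr F (th_class \<langle>Iota\<rangle>)" "iota_star (eval C F) = farr F (th_class \<langle>IotaStar\<rangle>)"
  by (cases c; simp add: eval_def)+

lemma eval_alg_simps [simp]:
  "car (eval_alg C F c) = fobj F (Gen c)"
  "mu (eval_alg C F c) = farr F (th_class \<langle>Mu c\<rangle>) \<cdot>\<^bsub>C\<^esub> ften F (Gen c) (Gen c)"
  "eta (eval_alg C F c) = farr F (th_class \<langle>Eta c\<rangle>) \<cdot>\<^bsub>C\<^esub> funit F"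
  "delta (eval_alg C F c) = inverse_arrow C (ften F (Gen c) (Gen c)) \<cdot>\<^bsub>C\<^esub> farr F (th_class \<langle>Delta c\<rangle>)"
  "eps (eval_alg C F c) = inverse_arrow C (funit F) \<cdot>\<^bsub>C\<^esub> farr F (th_class \<langle>Eps c\<rangle>)"
  by (simp_all add: eval_alg_def)

locale theory_functor = symmetric_monoidal_category C + F: symmetric_monoidal_functor Th C F
  for C :: "('o, 'a) sm_data" (structure) and F :: "(word, path set, 'o, 'a) mon_functor"
begin

lemma F_simps [simp]:
  "fobj F X \<in> obj C"
  "ften F X Y \<in> arr C" "src C (ften F X Y) = fobj F X \<boxtimes> fobj F Y" "tgt C (ften F X Y) = fobj F (X \<otimes>\<^sub>w Y)"
  "iso C (ften F X Y)" "tgt C (funit F) = fobj F One" "farr F (th_class (pid X)) = \<i>\<d> (fobj F X)"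
  using F.functor_obj[of X] F.ften_arr[of X Y] F.funit_arr F.functor_id[of X] by simp_all

lemma F_path [simp]:
  assumes "p \<in> paths"
  shows "farr F (th_class p) \<in> arr C" "src C (farr F (th_class p)) = fobj F (psrc p)"
    "tgt C (farr F (th_class p)) = fobj F (ptgt p)"
  using F.functor_arr[of "th_class p"] assms by simp_all

lemma F_pcmp:
  "\<lbrakk>p \<in> paths; q \<in> paths; psrc q = ptgt p\<rbrakk>
   \<Longrightarrow> farr F (th_class (q \<bullet> p)) = farr F (th_class q) \<cdot> farr F (th_class p)"
  using F.functor_cmp[of "th_class p" "th_class q"] by simp

lemma F_pten:
  "\<lbrakk>p \<in> paths; q \<in> paths\<rbrakk> \<Longrightarrow> farr F (th_class (p \<otimes>\<^sub>p q)) \<cdot> ften F (psrc p) (psrc q)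
     = ften F (ptgt p) (ptgt q) \<cdot> (farr F (th_class p) \<otimes> farr F (th_class q))"
  using F.ften_natural'[of "th_class p" "th_class q"] by simp

lemma F_iso:
  assumes "inverse_arrows Th f g"
  shows "iso C (farr F f)" "iv (farr F f) = farr F g"
  using F.functor_iso[of f] F.D.inverse_arrow_eqI[OF assms] assms by (auto simp: iso_def)

sublocale K: kfrob_data C "eval C F"
  by unfold_locales (simp_all add: hom_iff)

text \<open>
  The structure maps of the functor, composed along the word: from the interpretation in
  \<open>eval C F\<close> to the value of \<open>F\<close>.
\<close>

fun compare :: "word \<Rightarrow> 'a" where
  "compare One = funit F"
| "compare (Gen c) = \<i>\<d> (fobj F (Gen c))"
| "compare (X \<otimes>\<^sub>w Y) = ften F X Y \<cdot> (compare X \<otimes> compare Y)"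

abbreviation (input) K where "K \<equiv> eval C F"

lemma compare_arr [simp]:
  "iso C (compare X)" "compare X \<in> arr C" "src C (compare X) = word_int K X" "tgt C (compare X) = fobj F X"
proof -
  have "iso C (compare X) \<and> compare X \<in> arr C \<and> src C (compare X) = word_int K X \<and> tgt C (compare X) = fobj F X"
    by (induction X) auto
  then show "iso C (compare X)" "compare X \<in> arr C" "src C (compare X) = word_int K X"
    "tgt C (compare X) = fobj F X" by auto
qed

lemma compare_assoc:
  "farr F (th_class \<langle>Alpha X Y Z\<rangle>) \<cdot> compare ((X \<otimes>\<^sub>w Y) \<otimes>\<^sub>w Z)
   = compare (X \<otimes>\<^sub>w (Y \<otimes>\<^sub>w Z)) \<cdot> \<alpha> (word_int K X) (word_int K Y) (word_int K Z)"
proof -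
  let ?c = compare
  have "farr F (th_class \<langle>Alpha X Y Z\<rangle>) \<cdot> ?c ((X \<otimes>\<^sub>w Y) \<otimes>\<^sub>w Z)
      = (farr F (th_class \<langle>Alpha X Y Z\<rangle>) \<cdot> ften F (X \<otimes>\<^sub>w Y) Z \<cdot> (ften F X Y \<otimes> \<i>\<d> (fobj F Z)))
        \<cdot> ((?c X \<otimes> ?c Y) \<otimes> ?c Z)"
    by (simp add: tensor_cmp')
  also have "\<dots> = (ften F X (Y \<otimes>\<^sub>w Z) \<cdot> (\<i>\<d> (fobj F X) \<otimes> ften F Y Z) \<cdot> \<alpha> (fobj F X) (fobj F Y) (fobj F Z))
        \<cdot> ((?c X \<otimes> ?c Y) \<otimes> ?c Z)"
    using F.ften_assoc[of X Y Z] by simp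
  also have "\<dots> = ?c (X \<otimes>\<^sub>w (Y \<otimes>\<^sub>w Z)) \<cdot> \<alpha> (word_int K X) (word_int K Y) (word_int K Z)"
    by (simp add: assoc_natural' tensor_cmp'')
  finally show ?thesis .
qed

lemma compare_unitors:
  "farr F (th_class \<langle>Lam X\<rangle>) \<cdot> compare (One \<otimes>\<^sub>w X) = compare X \<cdot> \<ll> (word_int K X)"
  "farr F (th_class \<langle>Rho X\<rangle>) \<cdot> compare (X \<otimes>\<^sub>w One) = compare X \<cdot> \<rr> (word_int K X)"
proof -
  have "farr F (th_class \<langle>Lam X\<rangle>) \<cdot> compare (One \<otimes>\<^sub>w X)
      = (farr F (th_class \<langle>Lam X\<rangle>) \<cdot> ften F One X \<cdot> (funit F \<otimes> \<i>\<d> (fobj F X))) \<cdot> (\<i>\<d> \<one> \<otimes> compare X)"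
    by (simp add: tensor_cmp')
  also have "\<dots> = \<ll> (fobj F X) \<cdot> (\<i>\<d> \<one> \<otimes> compare X)"
    using F.ften_lunit[of X] by simp
  finally show "farr F (th_class \<langle>Lam X\<rangle>) \<cdot> compare (One \<otimes>\<^sub>w X) = compare X \<cdot> \<ll> (word_int K X)"
    by (simp add: lunit_natural')
  have "farr F (th_class \<langle>Rho X\<rangle>) \<cdot> compare (X \<otimes>\<^sub>w One)
      = (farr F (th_class \<langle>Rho X\<rangle>) \<cdot> ften F X One \<cdot> (\<i>\<d> (fobj F X) \<otimes> funit F)) \<cdot> (compare X \<otimes> \<i>\<d> \<one>)"
    by (simp add: tensor_cmp')
  also have "\<dots> = \<rr> (fobj F X) \<cdot> (compare X \<otimes> \<i>\<d> \<one>)"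
    using F.ften_runit[of X] by simp
  finally show "farr F (th_class \<langle>Rho X\<rangle>) \<cdot> compare (X \<otimes>\<^sub>w One) = compare X \<cdot> \<rr> (word_int K X)"
    by (simp add: runit_natural')
qed

lemma compare_braid:
  "farr F (th_class \<langle>Tau X Y\<rangle>) \<cdot> compare (X \<otimes>\<^sub>w Y) = compare (Y \<otimes>\<^sub>w X) \<cdot> \<tau> (word_int K X) (word_int K Y)"
proof -
  have "farr F (th_class \<langle>Tau X Y\<rangle>) \<cdot> compare (X \<otimes>\<^sub>w Y)
      = (farr F (th_class \<langle>Tau X Y\<rangle>) \<cdot> ften F X Y) \<cdot> (compare X \<otimes> compare Y)"
    by simp
  also have "\<dots> = (ften F Y X \<cdot> \<tau> (fobj F X) (fobj F Y)) \<cdot> (compare X \<otimes> compare Y)"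
    using F.ften_braid[of X Y] by simp
  finally show ?thesis by (simp add: braid_natural')
qed

lemma compare_inverse:
  assumes "inverse_arrows Th (th_class \<langle>e\<rangle>) (th_class \<langle>e'\<rangle>)" "iso C (edge_int K e)"
    and "farr F (th_class \<langle>e\<rangle>) \<cdot> compare (esrc e) = compare (etgt e) \<cdot> edge_int K e"
  shows "farr F (th_class \<langle>e'\<rangle>) \<cdot> compare (etgt e) = compare (esrc e) \<cdot> iv (edge_int K e)"
proof -
  have "iv (farr F (th_class \<langle>e\<rangle>)) \<cdot> compare (etgt e) = compare (esrc e) \<cdot> iv (edge_int K e)"
    by (rule iso_square_flip) (use assms F_iso[OF assms(1)] in simp_all)
  then show ?thesis by (simp add: F_iso[OF assms(1)])
qed

text \<open>
  The generating operations of \<open>eval C F\<close> are defined so that this square commutes;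
  for the constraints it is a coherence axiom of the functor.
\<close>

lemma compare_edge:
  "farr F (th_class \<langle>e\<rangle>) \<cdot> compare (esrc e) = compare (etgt e) \<cdot> edge_int K e"
proof (induction e)
  case (Alpha X Y Z)
  show ?case using compare_assoc by simp
next
  case (AlphaBar X Y Z)
  show ?case using compare_inverse[OF Th_inverse(1), of X Y Z] compare_assoc by simp
next
  case (Tau X Y)
  show ?case using compare_braid by simp
next
  case (TauBar X Y)
  show ?case using compare_inverse[OF Th_inverse(4), of X Y] compare_braid by simp
next
  case (Lam X)
  show ?case using compare_unitors by simp
next
  case (LamBar X)
  show ?case using compare_inverse[OF Th_inverse(2), of X] compare_unitors by simp
next
  case (Rho X)
  show ?case using compare_unitors by simp
next
  case (RhoBar X)
  show ?case using compare_inverse[OF Th_inverse(3), of X] compare_unitors by simp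
next
  case (TenL Z f)
  have "\<langle>TenL Z f\<rangle> = pid Z \<otimes>\<^sub>p \<langle>f\<rangle>" by (simp add: tenl_def pedge_def)
  then have "farr F (th_class \<langle>TenL Z f\<rangle>) \<cdot> ften F Z (esrc f) = ften F Z (etgt f) \<cdot> (\<i>\<d> (fobj F Z) \<otimes> farr F (th_class \<langle>f\<rangle>))"
    using F_pten[of "pid Z" "\<langle>f\<rangle>"] by (simp del: pten_pid)
  from cmp_square[OF this, of "compare Z \<otimes> compare (esrc f)"] TenL show ?case
    by (simp add: tensor_cmp')
next
  case (TenR f Z)
  have "\<langle>TenR f Z\<rangle> = \<langle>f\<rangle> \<otimes>\<^sub>p pid Z" by (simp add: tenr_def pedge_def)
  then have "farr F (th_class \<langle>TenR f Z\<rangle>) \<cdot> ften F (esrc f) Z = ften F (etgt f) Z \<cdot> (farr F (th_class \<langle>f\<rangle>) \<otimes> \<i>\<d> (fobj F Z))"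
    using F_pten[of "\<langle>f\<rangle>" "pid Z"] by (simp del: pten_pid)
  from cmp_square[OF this, of "compare (esrc f) \<otimes> compare Z"] TenR show ?case
    by (simp add: tensor_cmp')
qed simp_all

lemma compare_path:
  assumes "p \<in> paths"
  shows "farr F (th_class p) \<cdot> compare (psrc p) = compare (ptgt p) \<cdot> path_int K p"
proof -
  have "farr F (th_class (X, es)) \<cdot> compare X = compare (chain_end X es) \<cdot> path_int K (X, es)" if "chain X es" for X es
    using that
  proof (induction X es rule: chain.induct)
    case (1 X)
    have "(X, []) = pid X" by (simp add: pid_def)
    then show ?case by simp
  next
    case (2 X e es)
    let ?q = "(etgt e, es)"
    have q: "?q \<in> paths" "psrc ?q = etgt e" "ptgt ?q = chain_end (etgt e) es" "esrc e = X"
      using 2 by (simp_all add: paths_def psrc_def ptgt_def)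
    have s: "(X, e # es) = ?q \<bullet> \<langle>e\<rangle>" using q by (simp add: pcmp_def pedge_def)
    have "farr F (th_class (X, e # es)) \<cdot> compare X
        = farr F (th_class ?q) \<cdot> farr F (th_class \<langle>e\<rangle>) \<cdot> compare (esrc e)"
      unfolding s using q by (simp add: F_pcmp)
    also have "\<dots> = (farr F (th_class ?q) \<cdot> compare (etgt e)) \<cdot> edge_int K e"
      using q compare_edge[of e] by simp
    also have "\<dots> = (compare (chain_end (etgt e) es) \<cdot> path_int K ?q) \<cdot> edge_int K e"
      using 2 by simp
    also have "\<dots> = compare (chain_end X (e # es)) \<cdot> path_int K (X, e # es)"
      unfolding s using q by simp
    finally show ?case .
  qed
  then show ?thesis using assms by (cases p) (auto simp: paths_def psrc_def ptgt_def)
qed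

text \<open>
  Related paths have the same class, hence the same value under \<open>F\<close>; since
  \<open>compare\<close> is invertible, their interpretations agree as well.
\<close>

theorem eval_knowledgeable: "knowledgeable_frobenius_algebra C K"
proof (rule path_int_complete)
  show "kfrob_data C K" by (rule K.kfrob_data_axioms)
  fix p q :: path assume r: "p \<approx> q"
  note t = th_rel_type[OF r]
  show "path_int K p = path_int K q"
  proof (rule iso_cancel_left[of "compare (ptgt p)"])
    show "compare (ptgt p) \<cdot> path_int K p = compare (ptgt p) \<cdot> path_int K q"
      using compare_path[of p] compare_path[of q] t th_class_relI[OF r] by simp
  qed (use t in auto)
qed

end

section \<open>The functor that interprets the theory in an algebra\<close>

definition free_functor :: "('o, 'a) sm_data \<Rightarrow> ('o, 'a) kfrob \<Rightarrow> (word, path set, 'o, 'a) mon_functor" where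
  "free_functor C K =
     \<lparr>fobj = symmetric_monoidal_category.word_int C K,
      farr = (\<lambda>f\<in>arr Th. symmetric_monoidal_category.path_int C K (th_rep f)),
      ften = (\<lambda>X Y. \<i>\<d>\<^bsub>C\<^esub> (symmetric_monoidal_category.word_int C K (X \<otimes>\<^sub>w Y))),
      funit = \<i>\<d>\<^bsub>C\<^esub> \<one>\<^bsub>C\<^esub>\<rparr>"

locale knowledgeable_model = symmetric_monoidal_category C + kf: knowledgeable_frobenius_algebra C K
  for C :: "('o, 'a) sm_data" (structure) and K :: "('o, 'a) kfrob"
begin

sublocale data: kfrob_data C K
  by (rule knowledgeable_data) (rule kf.knowledgeable_frobenius_algebra_axioms)

lemma path_int_cong: "p \<sim> q \<Longrightarrow> path_int K p = path_int K q"
proof (induction rule: th_cong.induct)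
  case (base p q)
  then show ?case using path_int_sound kf.knowledgeable_frobenius_algebra_axioms by blast
next
  case (comp p p' q q')
  then show ?case using th_cong_type[of p p'] th_cong_type[of q q'] by simp
qed simp_all

lemma free_functor_simps [simp]:
  "fobj (free_functor C K) X = word_int K X" "ften (free_functor C K) X Y = \<i>\<d> (word_int K (X \<otimes>\<^sub>w Y))"
  "funit (free_functor C K) = \<i>\<d> \<one>"
  "p \<in> paths \<Longrightarrow> farr (free_functor C K) (th_class p) = path_int K p"
  using path_int_cong[OF th_rep_cong] by (simp_all add: free_functor_def)

lemma free_functor: "symmetric_monoidal_functor Th C (free_functor C K)"
proof (rule symmetric_monoidal_functorI[OF symmetric_monoidal_category_Th symmetric_monoidal_category_axioms], goal_cases)
  case (2 f)
  then show ?case by (elim Th_arrE) simp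
next
  case (4 f g)
  then show ?case by (elim Th_arrE) simp
next
  case (7 f g)
  then show ?case by (elim Th_arrE) simp
qed simp_all

text \<open>
  On the nose, because the structure maps of the free functor are identities.
\<close>

lemma eval_free_functor: "eval C (free_functor C K) = K"
proof -
  have "eval_alg C (free_functor C K) c = coloured_alg K c" for c
    by (rule frobenius.equality) simp_all
  from this[of Op] this[of Cl] show ?thesis
    by (intro kfrob.equality) simp_all
qed

end

section \<open>Homomorphisms and monoidal transformations\<close>

lemma K_Frob_simps:
  "obj (K_Frob C) = {K. knowledgeable_frobenius_algebra C K}"
  "\<phi> \<in> arr (K_Frob C) \<longleftrightarrow> knowledgeable_frobenius_algebra C (kf_src \<phi>) \<and>
     knowledgeable_frobenius_algebra C (kf_tgt \<phi>) \<and> kfrob_hom C (kf_src \<phi>) (kf_tgt \<phi>) (kf_map \<phi>)"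
  "src (K_Frob C) = kf_src"
  "tgt (K_Frob C) = kf_tgt"
  "\<i>\<d>\<^bsub>K_Frob C\<^esub> K = \<lparr>kf_src = K, kf_tgt = K, kf_map = (\<i>\<d>\<^bsub>C\<^esub> (carA K), \<i>\<d>\<^bsub>C\<^esub> (carC K))\<rparr>"
  "\<psi> \<cdot>\<^bsub>K_Frob C\<^esub> \<phi> = \<lparr>kf_src = kf_src \<phi>, kf_tgt = kf_tgt \<psi>,
     kf_map = (fst (kf_map \<psi>) \<cdot>\<^bsub>C\<^esub> fst (kf_map \<phi>), snd (kf_map \<psi>) \<cdot>\<^bsub>C\<^esub> snd (kf_map \<phi>))\<rparr>"
  "K \<boxtimes>\<^bsub>K_Frob C\<^esub> L = kfrob_tensor C K L"
  "\<phi> \<otimes>\<^bsub>K_Frob C\<^esub> \<psi> = \<lparr>kf_src = kfrob_tensor C (kf_src \<phi>) (kf_src \<psi>), kf_tgt = kfrob_tensor C (kf_tgt \<phi>) (kf_tgt \<psi>),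
     kf_map = (fst (kf_map \<phi>) \<otimes>\<^bsub>C\<^esub> fst (kf_map \<psi>), snd (kf_map \<phi>) \<otimes>\<^bsub>C\<^esub> snd (kf_map \<psi>))\<rparr>"
  "\<one>\<^bsub>K_Frob C\<^esub> = kfrob_unit C"
  "\<alpha>\<^bsub>K_Frob C\<^esub> K L M = \<lparr>kf_src = kfrob_tensor C (kfrob_tensor C K L) M, kf_tgt = kfrob_tensor C K (kfrob_tensor C L M),
     kf_map = (\<alpha>\<^bsub>C\<^esub> (carA K) (carA L) (carA M), \<alpha>\<^bsub>C\<^esub> (carC K) (carC L) (carC M))\<rparr>"
  "\<ll>\<^bsub>K_Frob C\<^esub> K = \<lparr>kf_src = kfrob_tensor C (kfrob_unit C) K, kf_tgt = K,
     kf_map = (\<ll>\<^bsub>C\<^esub> (carA K), \<ll>\<^bsub>C\<^esub> (carC K))\<rparr>"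
  "\<rr>\<^bsub>K_Frob C\<^esub> K = \<lparr>kf_src = kfrob_tensor C K (kfrob_unit C), kf_tgt = K,
     kf_map = (\<rr>\<^bsub>C\<^esub> (carA K), \<rr>\<^bsub>C\<^esub> (carC K))\<rparr>"
  "\<tau>\<^bsub>K_Frob C\<^esub> K L = \<lparr>kf_src = kfrob_tensor C K L, kf_tgt = kfrob_tensor C L K,
     kf_map = (\<tau>\<^bsub>C\<^esub> (carA K) (carA L), \<tau>\<^bsub>C\<^esub> (carC K) (carC L))\<rparr>"
  by (simp_all add: K_Frob_def Let_def)

definition eval_trans :: "('o, 'a) sm_data \<Rightarrow> (word, path set, 'o, 'a) mon_trans \<Rightarrow> ('o, 'a) kfrob_mor" where
  "eval_trans C \<theta> = \<lparr>kf_src = eval C (tr_src \<theta>), kf_tgt = eval C (tr_tgt \<theta>),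
     kf_map = (tr_cmp \<theta> (Gen Op), tr_cmp \<theta> (Gen Cl))\<rparr>"

locale theory_functors = symmetric_monoidal_category C +
  F: theory_functor C F + G: theory_functor C G
  for C :: "('o, 'a) sm_data" (structure) and F G :: "(word, path set, 'o, 'a) mon_functor"
begin

abbreviation (input) K where "K \<equiv> eval C F"
abbreviation (input) L where "L \<equiv> eval C G"

lemma eval_transformation:
  assumes "monoidal_transformation Th C F G \<theta>"
  shows "kfrob_hom C K L (\<theta> (Gen Op), \<theta> (Gen Cl))"
proof -
  interpret t: monoidal_transformation Th C F G \<theta> by fact
  have t [simp]: "\<theta> X \<in> arr C" "src C (\<theta> X) = fobj F X" "tgt C (\<theta> X) = fobj G X" for X
    using t.component_arr[of X] by simp_all
  have nat: "\<theta> (etgt e) \<cdot> farr F (th_class \<langle>e\<rangle>) = farr G (th_class \<langle>e\<rangle>) \<cdot> \<theta> (esrc e)" for e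
    using t.naturality'[of "th_class \<langle>e\<rangle>"] by simp
  have ten: "\<theta> (X \<otimes>\<^sub>w Y) \<cdot> ften F X Y = ften G X Y \<cdot> (\<theta> X \<otimes> \<theta> Y)" for X Y
    using t.component_tensor[of X Y] by simp
  have unit: "\<theta> One \<cdot> funit F = funit G" using t.component_unit by simp
  have ten': "iv (ften G X Y) \<cdot> \<theta> (X \<otimes>\<^sub>w Y) = (\<theta> X \<otimes> \<theta> Y) \<cdot> iv (ften F X Y)" for X Y
    by (rule iso_square_flip) (simp_all add: ten)
  have unit': "iv (funit G) \<cdot> \<theta> One = \<i>\<d> \<one> \<cdot> iv (funit F)"
    by (rule iso_square_flip) (simp_all add: unit)
  have "frobenius_hom C (eval_alg C F c) (eval_alg C G c) (\<theta> (Gen c))" for c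
  proof -
    let ?t = "\<theta> (Gen c)"
    have "?t \<cdot> farr F (th_class \<langle>Mu c\<rangle>) \<cdot> ften F (Gen c) (Gen c)
        = farr G (th_class \<langle>Mu c\<rangle>) \<cdot> \<theta> (Gen c \<otimes>\<^sub>w Gen c) \<cdot> ften F (Gen c) (Gen c)"
      by (rule cmp_square) (use nat[of "Mu c"] in simp_all)
    moreover have "?t \<cdot> farr F (th_class \<langle>Eta c\<rangle>) \<cdot> funit F = farr G (th_class \<langle>Eta c\<rangle>) \<cdot> \<theta> One \<cdot> funit F"
      by (rule cmp_square) (use nat[of "Eta c"] in simp_all)
    moreover have "iv (ften G (Gen c) (Gen c)) \<cdot> \<theta> (Gen c \<otimes>\<^sub>w Gen c) \<cdot> farr F (th_class \<langle>Delta c\<rangle>)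
        = (?t \<otimes> ?t) \<cdot> iv (ften F (Gen c) (Gen c)) \<cdot> farr F (th_class \<langle>Delta c\<rangle>)"
      by (rule cmp_square) (simp_all add: ten')
    moreover have "iv (funit G) \<cdot> \<theta> One \<cdot> farr F (th_class \<langle>Eps c\<rangle>)
        = \<i>\<d> \<one> \<cdot> iv (funit F) \<cdot> farr F (th_class \<langle>Eps c\<rangle>)"
      by (rule cmp_square) (simp_all add: unit')
    ultimately show ?thesis
      using nat[of "Delta c"] nat[of "Eps c"]
      by (simp add: frobenius_hom_def algebra_hom_def coalgebra_hom_def hom_iff ten unit)
  qed
  then show ?thesis using nat[of Iota] nat[of IotaStar] by (simp add: kfrob_hom_def)
qed

text \<open>
  The strict extension of a pair of maps to words: it commutes with the tensor product by
  definition, so that only the generating edges have to be checked for naturality.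
\<close>

fun extend :: "'a \<times> 'a \<Rightarrow> word \<Rightarrow> 'a" where
  "extend \<phi> One = \<i>\<d> \<one>"
| "extend \<phi> (Gen Op) = fst \<phi>"
| "extend \<phi> (Gen Cl) = snd \<phi>"
| "extend \<phi> (X \<otimes>\<^sub>w Y) = extend \<phi> X \<otimes> extend \<phi> Y"

lemma extend_arr [simp]:
  assumes "kfrob_hom C K L \<phi>"
  shows "extend \<phi> X \<in> arr C" "src C (extend \<phi> X) = word_int K X" "tgt C (extend \<phi> X) = word_int L X"
proof -
  have "extend \<phi> X \<in> arr C \<and> src C (extend \<phi> X) = word_int K X \<and> tgt C (extend \<phi> X) = word_int L X"
    using assms
    by (induction \<phi> X rule: extend.induct)
      (simp_all add: kfrob_hom_def frobenius_hom_def algebra_hom_def hom_iff)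
  then show "extend \<phi> X \<in> arr C" "src C (extend \<phi> X) = word_int K X" "tgt C (extend \<phi> X) = word_int L X"
    by simp_all
qed

lemma extend_edge:
  assumes "kfrob_hom C K L \<phi>"
  shows "extend \<phi> (etgt e) \<cdot> edge_int K e = edge_int L e \<cdot> extend \<phi> (esrc e)"
proof (induction e)
  case (Mu c)
  show ?case using assms
    by (cases c) (simp_all add: kfrob_hom_def frobenius_hom_def algebra_hom_def)
next
  case (Eta c)
  show ?case using assms
    by (cases c) (simp_all add: kfrob_hom_def frobenius_hom_def algebra_hom_def)
next
  case (Delta c)
  show ?case using assms
    by (cases c) (simp_all add: kfrob_hom_def frobenius_hom_def coalgebra_hom_def)
next
  case (Eps c)
  show ?case using assms
    by (cases c) (simp_all add: kfrob_hom_def frobenius_hom_def coalgebra_hom_def)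
next
  case (TenL Z f)
  then show ?case using assms by (simp add: tensor_cmp')
next
  case (TenR f Z)
  then show ?case using assms by (simp add: tensor_cmp')
qed (use assms in \<open>simp_all add: assoc_natural' assoc_inv_natural braid_natural' lunit_natural' runit_natural'
      lunit_inv_natural runit_inv_natural kfrob_hom_def\<close>)

lemma extend_path:
  assumes "kfrob_hom C K L \<phi>" "p \<in> paths"
  shows "extend \<phi> (ptgt p) \<cdot> path_int K p = path_int L p \<cdot> extend \<phi> (psrc p)"
proof -
  have "extend \<phi> (chain_end X es) \<cdot> chain_int K X es = chain_int L X es \<cdot> extend \<phi> X" if "chain X es" for X es
    using that
  proof (induction X es rule: chain.induct)
    case (1 X)
    then show ?case using assms(1) by simp
  next
    case (2 X e es)
    then have c: "chain (etgt e) es" "esrc e = X" by simp_all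
    have "extend \<phi> (chain_end (etgt e) es) \<cdot> chain_int K (etgt e) es \<cdot> edge_int K e
        = chain_int L (etgt e) es \<cdot> extend \<phi> (etgt e) \<cdot> edge_int K e"
      by (rule cmp_square) (use 2 c assms(1) in simp_all)
    also have "\<dots> = chain_int L (etgt e) es \<cdot> edge_int L e \<cdot> extend \<phi> X"
      using extend_edge[OF assms(1), of e] c by simp
    finally show ?case using c assms(1) by simp
  qed
  then show ?thesis using assms(2) by (simp add: path_int_def paths_def psrc_def ptgt_def)
qed

lemma extend_transformation:
  assumes "kfrob_hom C K L \<phi>"
  shows "monoidal_transformation Th C F G (\<lambda>X. G.compare X \<cdot> extend \<phi> X \<cdot> iv (F.compare X))"
proof (rule monoidal_transformationI[OF F.F.symmetric_monoidal_functor_axioms G.F.symmetric_monoidal_functor_axioms],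
    goal_cases)
  case (1 X)
  show ?case using assms by simp
next
  case (2 f)
  then obtain p where p: "p \<in> paths" "f = th_class p" by (rule Th_arrE)
  have f: "iv (F.compare (ptgt p)) \<cdot> farr F (th_class p) = path_int K p \<cdot> iv (F.compare (psrc p))"
    by (rule iso_square_flip) (use p F.compare_path[of p] in simp_all)
  have "G.compare (ptgt p) \<cdot> extend \<phi> (ptgt p) \<cdot> path_int K p \<cdot> iv (F.compare (psrc p))
      = G.compare (ptgt p) \<cdot> path_int L p \<cdot> extend \<phi> (psrc p) \<cdot> iv (F.compare (psrc p))"
    using cmp_square[OF extend_path[OF assms p(1)], of "iv (F.compare (psrc p))"] assms p by simp
  also have "\<dots> = farr G (th_class p) \<cdot> G.compare (psrc p) \<cdot> extend \<phi> (psrc p) \<cdot> iv (F.compare (psrc p))"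
    using cmp_square[OF G.compare_path[OF p(1)], of "extend \<phi> (psrc p) \<cdot> iv (F.compare (psrc p))"] assms p by simp
  finally show ?case using assms p f by simp
next
  case (3 X Y)
  show ?case using assms by (simp add: tensor_cmp' tensor_cmp'')
next
  case 4
  show ?case by simp
qed

text \<open>
  The components at the unit and at tensor products are forced by the invertible structure maps.
\<close>

lemma transformation_determined:
  assumes "monoidal_transformation Th C F G \<theta>" "monoidal_transformation Th C F G \<theta>'"
    and "\<And>c. \<theta> (Gen c) = \<theta>' (Gen c)"
  shows "\<theta> X = \<theta>' X"
proof -
  interpret t: monoidal_transformation Th C F G \<theta> by fact
  interpret t': monoidal_transformation Th C F G \<theta>' by fact
  have arr [simp]: "\<theta> X \<in> arr C" "src C (\<theta> X) = fobj F X" "\<theta>' X \<in> arr C" "src C (\<theta>' X) = fobj F X" for X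
    using t.component_arr[of X] t'.component_arr[of X] by simp_all
  show ?thesis
  proof (induction X)
    case One
    show ?case
      by (rule iso_cancel_right[of "funit F"]) (use t.component_unit t'.component_unit in simp_all)
  next
    case (Gen c)
    show ?case by (rule assms(3))
  next
    case (Ten X Y)
    show ?case
      by (rule iso_cancel_right[of "ften F X Y"])
        (use t.component_tensor[of X Y] t'.component_tensor[of X Y] Ten in simp_all)
  qed
qed

text \<open>
  The tensor products of functors and of algebras use the same interchange; for the
  comultiplication this rests on the inverse of an interchange being an interchange.
\<close>

lemma eval_tensor: "eval C (mon_functor_tensor Th C F G) = kfrob_tensor C K L"
proof -
  have "eval_alg C (mon_functor_tensor Th C F G) c = frobenius_tensor C (eval_alg C F c) (eval_alg C G c)" for c
    by (rule frobenius.equality)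
      (simp_all add: frobenius_tensor_def mon_functor_tensor_simps tensor_cmp' tensor_cmp'')
  then show ?thesis
    by (intro kfrob.equality) (simp_all add: kfrob_tensor_def mon_functor_tensor_simps)
qed

end

lemma (in symmetric_monoidal_category) eval_unit: "eval C (mon_functor_unit Th C) = kfrob_unit C"
proof -
  have "eval_alg C (mon_functor_unit Th C) c = frobenius_unit C" for c
    by (rule frobenius.equality) (simp_all add: frobenius_unit_def mon_functor_unit_simps)
  then show ?thesis
    by (intro kfrob.equality) (simp_all add: kfrob_unit_def mon_functor_unit_simps)
qed

text \<open>
  Onto on objects by the free functor, onto on homs by extension, faithful by the preceding lemma,
  and strict by definition of the structure on both sides.
\<close>

lemma (in symmetric_monoidal_category) eval_strict_equivalence:
  "strict_equivalence (Symm_Mon Th C) (K_Frob C) (eval C) (eval_trans C)"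
proof -
  interpret S: functor_category Th C
    by (intro functor_category.intro symmetric_monoidal_category_Th symmetric_monoidal_category_axioms)
  let ?SM = "Symm_Mon Th C"
  have tf: "theory_functor C F" if "F \<in> Symm_Mon_obj Th C" for F
    using S.functor_of[OF that] symmetric_monoidal_category_axioms by (simp add: theory_functor_def)
  have tfs: "theory_functors C F G" if "F \<in> Symm_Mon_obj Th C" "G \<in> Symm_Mon_obj Th C" for F G
    using that tf symmetric_monoidal_category_axioms by (simp add: theory_functors_def)
  have ten: "eval C (mon_functor_tensor Th C F G) = kfrob_tensor C (eval C F) (eval C G)"
    if "F \<in> Symm_Mon_obj Th C" "G \<in> Symm_Mon_obj Th C" for F G
    using theory_functors.eval_tensor[OF tfs[OF that]] .
  show ?thesis
  proof (intro strict_equivalence.intro strict_full_surjection.intro S.symmetric_monoidal_category_SM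
      strict_full_surjection_axioms.intro strict_equivalence_axioms.intro, goal_cases)
    case 1
    have "K \<in> eval C ` Symm_Mon_obj Th C" if "knowledgeable_frobenius_algebra C K" for K
    proof -
      interpret knowledgeable_model C K
        using that symmetric_monoidal_category_axioms by (simp add: knowledgeable_model_def)
      have "free_functor C K \<in> Symm_Mon_obj Th C"
        using free_functor by (simp add: Symm_Mon_obj_def extensional_mon_functor_def extensional_def free_functor_def)
      then show ?thesis using eval_free_functor by force
    qed
    then show ?case
      using theory_functor.eval_knowledgeable[OF tf] by (auto simp: Symm_Mon_simps K_Frob_simps)
  next
    case (2 h)
    then show ?case by (simp add: K_Frob_simps)
  next
    \<comment> \<open>Hom sets: the inverse of evaluation transports the extension of a homomorphism along \<open>compare\<close>.\<close>
    case (3 F G)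
    then have o: "F \<in> Symm_Mon_obj Th C" "G \<in> Symm_Mon_obj Th C" by (simp_all add: Symm_Mon_simps)
    interpret FG: theory_functors C F G using tfs[OF o] .
    show ?case
    proof (rule set_eqI, rule iffI)
      fix \<phi> assume \<phi>: "\<phi> \<in> hom (K_Frob C) (eval C F) (eval C G)"
      then have h: "kfrob_hom C (eval C F) (eval C G) (kf_map \<phi>)" by (auto simp: hom_iff K_Frob_simps)
      let ?t = "transf Th F G (\<lambda>X. FG.G.compare X \<cdot> FG.extend (kf_map \<phi>) X \<cdot> iv (FG.F.compare X))"
      have "?t \<in> hom ?SM F G"
        using S.transf_arr[OF o FG.extend_transformation[OF h]] by (simp add: hom_iff Symm_Mon_simps)
      moreover have "eval_trans C ?t = \<phi>"
        using \<phi> FG.extend_arr[OF h, of "Gen Op"] FG.extend_arr[OF h, of "Gen Cl"]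
        by (intro kfrob_mor.equality) (simp_all add: eval_trans_def hom_iff K_Frob_simps)
      ultimately show "\<phi> \<in> eval_trans C ` hom ?SM F G" by (rule rev_image_eqI[OF _ HOL.sym])
    next
      fix \<phi> assume "\<phi> \<in> eval_trans C ` hom ?SM F G"
      then obtain \<theta> where t: "\<theta> \<in> arr ?SM" "tr_src \<theta> = F" "tr_tgt \<theta> = G" "\<phi> = eval_trans C \<theta>"
        by (auto simp: hom_iff Symm_Mon_simps)
      show "\<phi> \<in> hom (K_Frob C) (eval C F) (eval C G)"
        using t FG.eval_transformation[of "tr_cmp \<theta>"] S.arr_SM(1)[OF t(1)]
        by (simp add: hom_iff K_Frob_simps eval_trans_def FG.F.eval_knowledgeable FG.G.eval_knowledgeable)
    qed
  next
    case (13 f g)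
    then have fg: "f \<in> arr ?SM" "g \<in> arr ?SM" "tr_src f = tr_src g" "tr_tgt f = tr_tgt g"
      "tr_cmp f (Gen Op) = tr_cmp g (Gen Op)" "tr_cmp f (Gen Cl) = tr_cmp g (Gen Cl)"
      by (simp_all add: Symm_Mon_simps eval_trans_def)
    interpret FG: theory_functors C "tr_src g" "tr_tgt g"
      using tfs S.arr_SM(2,3)[OF fg(2)] by blast
    have "tr_cmp f X = tr_cmp g X" for X
    proof (rule FG.transformation_determined)
      show "tr_cmp f (Gen c) = tr_cmp g (Gen c)" for c using fg by (cases c) simp_all
    qed (use S.arr_SM(1)[OF fg(1)] S.arr_SM(1)[OF fg(2)] fg in simp_all)
    then show ?case using fg by (intro transf_eqI)
  qed (auto simp: Symm_Mon_simps K_Frob_simps eval_trans_def ten eval_unit)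
qed

theorem proposition2p8:
  fixes C :: "('o, 'a) sm_data"
  assumes "symmetric_monoidal_category C"
  shows "symmetric_monoidal_equivalent (Symm_Mon Th_K_Frob C) (K_Frob C)"
proof -
  interpret symmetric_monoidal_category C by (rule assms)
  show ?thesis
    by (rule strict_equivalence.symmetric_monoidal_equivalence) (rule eval_strict_equivalence)
qed

end
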